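(* There exists a constant $c_1>0$, independent of $h$ and $k$, such that for any $(w_h,\boldsymbol{\chi}_h)\in V_h\times\boldsymbol{\Sigma}_h$ $$\sup_{\substack{(v_h,\boldsymbol{\tau}_h)\in V_h\times\boldsymbol{\Sigma}_h\\ v_h\neq 0}}\frac{\operatorname{Re} A_h(w_h,\boldsymbol{\chi}_h;v_h,\boldsymbol{\tau}_h)}{\|v_h\|_{DG}}+\sup_{\substack{(v_h,\boldsymbol{\tau}_h)\in V_h\times\boldsymbol{\Sigma}_h\\ v_h\neq 0}}\frac{\operatorname{Im} A_h(w_h,\boldsymbol{\chi}_h;v_h,\boldsymbol{\tau}_h)}{\|v_h\|_{DG}}\ \ge\ \frac{c_1}{\gamma_1}\,\|w_h\|_{DG},$$ where $$\gamma_1:=1+k+\sqrt{\frac{\beta}{\delta}}+\max_{e\in\mathcal{E}_h^I}\Bigl(\frac{k^2+1}{\beta h_e}+\frac{1}{h_e^2}+\frac{1}{\beta h_e^3}\Bigr),$$ $$\|w_h\|_{DG}:=\Bigl(k^2\|w_h\|_{L^2(\Omega)}^2+k^2\|w_h\|_{L^2(\Gamma)}^2+c_\Omega\|\nabla_h w_h\|_{L^2(\Gamma)}^2+|w_h|_{1,h}^2\Bigr)^{1/2},\qquad |w_h|_{1,h}:=\Bigl(\sum_{K\in\mathcal{T}_h}\|\nabla w_h\|_{L^2(K)}^2\Bigr)^{1/2}.$$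
   Context: Let $\Omega\subset\mathbb{R}^d$ ($d=2,3$) be a bounded domain with boundary $\Gamma=\partial\Omega$ and outward unit normal $\mathbf{n}_\Omega$, strictly star-shaped with respect to a point $x_\Omega\in\Omega$, i.e. there is $c_\Omega>0$ with $(x-x_\Omega)\cdot\mathbf{n}_\Omega\ge c_\Omega$ for all $x\in\partial\Omega$. $\mathcal{T}_h$ is a family of partitions of $\Omega$ into triangles/tetrahedra, parameterized by $h>0$ and satisfying the minimal angle condition; $h_K=\operatorname{diam}(K)$, $h=\max_{K}h_K$, $h_e=\operatorname{diam}(e)$ for an edge/face $e$; $\mathcal{E}_h^I$ is the set of interior edges/faces. $k>0$ is the wave number, and $\beta,\delta>0$ are given penalty parameters (possibly chosen depending on the mesh). All functions are complex-valued. $(u,v)_\Omega=\int_\Omega u\bar v\,dx$, $\langle u,v\rangle_e=\int_e u\bar v\,ds$, $\langle u,v\rangle_\Gamma=\int_\Gamma u\bar v\,ds$ (with dot products for vector functions); $\mathbf{i}=\sqrt{-1}$. $\nabla_h$ is the piecewise gradient, $\nabla_h|_K=\nabla|_K$ for $K\in\mathcal{T}_h$. On an interior edge/face $e$ shared by $K_1,K_2$ with outward unit normals $\mathbf{n}_1,\mathbf{n}_2$: $\{v\}=\frac12(v_1+v_2)$ and $[[v]]=v_1\mathbf{n}_1+v_2\mathbf{n}_2$ for scalar $v$; $\{\mathbf{v}\}=\frac12(\mathbf{v}_1+\mathbf{v}_2)$ and $[[\mathbf{v}]]=\mathbf{v}_1\cdot\mathbf{n}_1+\mathbf{v}_2\cdot\mathbf{n}_2$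 for vector $\mathbf{v}$, where subscripts denote traces from $K_1,K_2$. $V_h$ is the space of (discontinuous) functions in $L^2(\Omega)$ whose real and imaginary parts restricted to each $K\in\mathcal{T}_h$ are polynomials of degree $\le 1$; $\boldsymbol{\Sigma}_h$ is the space of vector fields in $(L^2(\Omega))^d$ whose real and imaginary parts restricted to each $K$ lie in $(P_1(K))^d$. The sesquilinear form is $$A_h(w_h,\boldsymbol{\chi}_h;v_h,\boldsymbol{\tau}_h)=(\boldsymbol{\chi}_h,\nabla_h v_h)_\Omega-k^2(w_h,v_h)_\Omega+\mathbf{i}k\langle w_h,v_h\rangle_\Gamma-\sum_{e\in\mathcal{E}_h^I}\langle\{\nabla_h w_h\}-\mathbf{i}\beta[[w_h]],[[v_h]]\rangle_e$$ $$-\sum_{e\in\mathcal{E}_h^I}\Bigl(\mathbf{i}\delta\langle[[\nabla_h w_h]],[[\boldsymbol{\tau}_h]]\rangle_e-\langle[[w_h]],\{\boldsymbol{\tau}_h\}\rangle_e\Bigr)+(\boldsymbol{\chi}_h,\boldsymbol{\tau}_h)_\Omega-(\nabla_h w_h,\boldsymbol{\tau}_h)_\Omega.$$ *)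

theory Defs
  imports "HOL-Analysis.Analysis"
begin

section \<open>Domains\<close>

text \<open>The vector \<open>n\<close> is an outward unit normal of \<open>\<Omega>\<close> at a boundary point \<open>x\<close> if, to first order at
  \<open>x\<close>, \<open>\<Omega>\<close> is the half-space below the hyperplane through \<open>x\<close> orthogonal to \<open>n\<close>.  On a
  polyhedral boundary there is none at vertices and (in 3D) on edges, i.e. on a null set of
  \<open>\<partial>\<Omega>\<close>; there the star-shape condition below is void, as it is in the usual reading.\<close>

definition outward_unit_normal :: "(real^'d) set \<Rightarrow> real^'d \<Rightarrow> real^'d \<Rightarrow> bool" where
  "outward_unit_normal \<Omega> x n \<longleftrightarrow> x \<in> frontier \<Omega> \<and> norm n = 1 \<and>
     (\<forall>\<epsilon>>0. \<exists>r>0. \<forall>y\<in>ball x r.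
        ((y - x) \<bullet> n < - \<epsilon> * norm (y - x) \<longrightarrow> y \<in> \<Omega>) \<and>
        ((y - x) \<bullet> n > \<epsilon> * norm (y - x) \<longrightarrow> y \<notin> \<Omega>))"

definition strictly_star_shaped :: "(real^'d) set \<Rightarrow> real^'d \<Rightarrow> real \<Rightarrow> bool" where
  "strictly_star_shaped \<Omega> x\<^sub>0 c \<longleftrightarrow> x\<^sub>0 \<in> \<Omega> \<and> c > 0 \<and>
     (\<forall>x\<in>frontier \<Omega>. \<forall>n. outward_unit_normal \<Omega> x n \<longrightarrow> (x - x\<^sub>0) \<bullet> n \<ge> c)"


section \<open>Meshes\<close>

text \<open>A mesh is a finite set of closed, nondegenerate simplices.  The library's
  \<open>triangulation\<close> makes it conforming: any two elements meet in a common (possibly empty) face.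
  Taking the interior of the union excludes slits and punctures of \<open>\<Omega>\<close>, on which an
  outward normal would make no sense.\<close>

definition partition_of :: "(real^'d) set \<Rightarrow> (real^'d) set set \<Rightarrow> bool" where
  "partition_of \<Omega> \<T> \<longleftrightarrow> triangulation \<T> \<and> (\<forall>K\<in>\<T>. int CARD('d) simplex K) \<and> interior (\<Union>\<T>) = \<Omega>"

definition facet_normal :: "(real^'d) set \<Rightarrow> (real^'d) set \<Rightarrow> real^'d" where
  "facet_normal K e =
     (THE n. norm n = 1 \<and> (\<exists>b. e \<subseteq> {x. n \<bullet> x = b} \<and> K \<subseteq> {x. n \<bullet> x \<le> b}))"

text \<open>The angles of a simplex are the planar angles of its triangles (at \<open>a\<close>, between \<open>b\<close> and \<open>c\<close>)
  and the dihedral angles between its facets.  For \<open>d = 2\<close> both are the angles of the triangle;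
  for \<open>d = 3\<close> both kinds are needed to exclude needles as well as slivers.\<close>

definition minimal_angle_condition :: "(real^'d) set set set \<Rightarrow> bool" where
  "minimal_angle_condition \<TT> \<longleftrightarrow> (\<exists>\<theta>>0. \<forall>\<T>\<in>\<TT>. \<forall>K\<in>\<T>.
     (\<forall>a b c. a extreme_point_of K \<and> b extreme_point_of K \<and> c extreme_point_of K \<and>
              a \<noteq> b \<and> a \<noteq> c \<and> b \<noteq> c \<longrightarrow>
              arccos ((b - a) \<bullet> (c - a) / (norm (b - a) * norm (c - a))) \<ge> \<theta>) \<and>
     (\<forall>e f. e facet_of K \<and> f facet_of K \<and> e \<noteq> f \<longrightarrow>
              arccos (- (facet_normal K e \<bullet> facet_normal K f)) \<ge> \<theta>))"

definition interior_facets :: "(real^'d) set set \<Rightarrow> (real^'d) set set" where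
  "interior_facets \<T> = {e. \<exists>K\<in>\<T>. \<exists>L\<in>\<T>. K \<noteq> L \<and> e facet_of K \<and> e facet_of L}"

definition boundary_facets :: "(real^'d) set \<Rightarrow> (real^'d) set \<Rightarrow> (real^'d) set set" where
  "boundary_facets \<Omega> K = {e. e facet_of K \<and> e \<subseteq> frontier \<Omega>}"


section \<open>Surface measure on flat facets\<close>

text \<open>For \<open>e\<close> contained in a hyperplane, the \<open>d\<close>-dimensional volume of the right prism of height 1
  over a part of \<open>e\<close> is the \<open>(d-1)\<close>-dimensional measure of that part.  Hence the surface measure
  \<open>ds\<close> on \<open>e\<close> is the image of Lebesgue measure on the prism over \<open>e\<close> (centred at \<open>e\<close>)
  under orthogonal projection onto the hyperplane.\<close>

definition prism :: "(real^'d) set \<Rightarrow> (real^'d) set" where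
  "prism e = {y. closest_point (affine hull e) y \<in> e \<and> infdist y (affine hull e) \<le> 1/2}"

definition facet_measure :: "(real^'d) set \<Rightarrow> (real^'d) measure" where
  "facet_measure e = distr (restrict_space lborel (prism e)) borel (closest_point (affine hull e))"


section \<open>Broken functions\<close>

text \<open>Elements of \<open>L\<^sup>2(\<Omega>)\<close> are represented by functions on the whole space.  Everything below
  depends only on their values in the open elements, so values on the mesh skeleton and outside
  \<open>\<Omega>\<close> (which are not determined by an \<open>L\<^sup>2\<close> class) are left arbitrary.  Membership
  in \<open>L\<^sup>2(\<Omega>)\<close> is automatic for bounded \<open>\<Omega>\<close>.\<close>

definition P1_on :: "(real^'d) set \<Rightarrow> (real^'d \<Rightarrow> real) \<Rightarrow> bool" where
  "P1_on S p \<longleftrightarrow> (\<exists>a b. \<forall>x\<in>S. p x = a \<bullet> x + b)"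

definition V_h :: "(real^'d) set set \<Rightarrow> (real^'d \<Rightarrow> complex) set" where
  "V_h \<T> = {v. \<forall>K\<in>\<T>. P1_on (interior K) (\<lambda>x. Re (v x)) \<and> P1_on (interior K) (\<lambda>x. Im (v x))}"

definition \<Sigma>_h :: "(real^'d) set set \<Rightarrow> (real^'d \<Rightarrow> complex^'d) set" where
  "\<Sigma>_h \<T> = {\<tau>. \<forall>i. (\<lambda>x. \<tau> x $ i) \<in> V_h \<T>}"

text \<open>At points of open elements this is the piecewise gradient \<open>\<nabla>\<^sub>h\<close>.\<close>

definition grad :: "(real^'d \<Rightarrow> complex) \<Rightarrow> real^'d \<Rightarrow> complex^'d" where
  "grad v x = (\<chi> i. frechet_derivative v (at x) (axis i 1))"

definition trace_from :: "(real^'d) set \<Rightarrow> (real^'d \<Rightarrow> 'b::t2_space) \<Rightarrow> real^'d \<Rightarrow> 'b" where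
  "trace_from K v x = Lim (at x within interior K) v"

definition cdot :: "complex^'d \<Rightarrow> complex^'d \<Rightarrow> complex" where
  "cdot u v = (\<Sum>i\<in>UNIV. u $ i * cnj (v $ i))"

definition smul_normal :: "complex \<Rightarrow> real^'d \<Rightarrow> complex^'d" where
  "smul_normal z n = (\<chi> i. z * of_real (n $ i))"

definition dot_normal :: "complex^'d \<Rightarrow> real^'d \<Rightarrow> complex" where
  "dot_normal u n = (\<Sum>i\<in>UNIV. u $ i * of_real (n $ i))"

text \<open>An interior facet \<open>e\<close> belongs to exactly two elements, so that the following sums have the
  two terms indexed 1 and 2 in the usual notation.\<close>

definition avg :: "(real^'d) set set \<Rightarrow> (real^'d) set \<Rightarrow>
    (real^'d \<Rightarrow> 'b::real_normed_vector) \<Rightarrow> real^'d \<Rightarrow> 'b" where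
  "avg \<T> e v x = (1/2) *\<^sub>R (\<Sum>K\<in>{K\<in>\<T>. e facet_of K}. trace_from K v x)"

definition jump :: "(real^'d) set set \<Rightarrow> (real^'d) set \<Rightarrow>
    (real^'d \<Rightarrow> complex) \<Rightarrow> real^'d \<Rightarrow> complex^'d" where
  "jump \<T> e v x = (\<Sum>K\<in>{K\<in>\<T>. e facet_of K}. smul_normal (trace_from K v x) (facet_normal K e))"

definition vjump :: "(real^'d) set set \<Rightarrow> (real^'d) set \<Rightarrow>
    (real^'d \<Rightarrow> complex^'d) \<Rightarrow> real^'d \<Rightarrow> complex" where
  "vjump \<T> e \<tau> x = (\<Sum>K\<in>{K\<in>\<T>. e facet_of K}. dot_normal (trace_from K \<tau> x) (facet_normal K e))"


section \<open>Inner products and norms\<close>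

definition L2_inner :: "(real^'d) set \<Rightarrow> (real^'d \<Rightarrow> complex) \<Rightarrow> (real^'d \<Rightarrow> complex) \<Rightarrow> complex" where
  "L2_inner \<Omega> u v = (LINT x:\<Omega>|lebesgue. u x * cnj (v x))"

definition L2_vinner ::
    "(real^'d) set \<Rightarrow> (real^'d \<Rightarrow> complex^'d) \<Rightarrow> (real^'d \<Rightarrow> complex^'d) \<Rightarrow> complex" where
  "L2_vinner \<Omega> u v = (LINT x:\<Omega>|lebesgue. cdot (u x) (v x))"

definition facet_inner :: "(real^'d) set \<Rightarrow> (real^'d \<Rightarrow> complex) \<Rightarrow> (real^'d \<Rightarrow> complex) \<Rightarrow> complex" where
  "facet_inner e u v = (LINT x|facet_measure e. u x * cnj (v x))"

definition facet_vinner ::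
    "(real^'d) set \<Rightarrow> (real^'d \<Rightarrow> complex^'d) \<Rightarrow> (real^'d \<Rightarrow> complex^'d) \<Rightarrow> complex" where
  "facet_vinner e u v = (LINT x|facet_measure e. cdot (u x) (v x))"

definition bdry_inner :: "(real^'d) set \<Rightarrow> (real^'d) set set \<Rightarrow>
    (real^'d \<Rightarrow> complex) \<Rightarrow> (real^'d \<Rightarrow> complex) \<Rightarrow> complex" where
  "bdry_inner \<Omega> \<T> u v =
     (\<Sum>K\<in>\<T>. \<Sum>e\<in>boundary_facets \<Omega> K. facet_inner e (trace_from K u) (trace_from K v))"

definition L2_norm :: "(real^'d) set \<Rightarrow> (real^'d \<Rightarrow> 'b::real_normed_vector) \<Rightarrow> real" where
  "L2_norm S u = sqrt (LINT x:S|lebesgue. (norm (u x))\<^sup>2)"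

definition bdry_norm :: "(real^'d) set \<Rightarrow> (real^'d) set set \<Rightarrow>
    (real^'d \<Rightarrow> 'b::real_normed_vector) \<Rightarrow> real" where
  "bdry_norm \<Omega> \<T> u = sqrt
     (\<Sum>K\<in>\<T>. \<Sum>e\<in>boundary_facets \<Omega> K. LINT x|facet_measure e. (norm (trace_from K u x))\<^sup>2)"

definition H1_seminorm :: "(real^'d) set set \<Rightarrow> (real^'d \<Rightarrow> complex) \<Rightarrow> real" where
  "H1_seminorm \<T> w = sqrt (\<Sum>K\<in>\<T>. (L2_norm K (grad w))\<^sup>2)"

definition DG_norm :: "(real^'d) set \<Rightarrow> real \<Rightarrow> (real^'d) set set \<Rightarrow> real \<Rightarrow>
    (real^'d \<Rightarrow> complex) \<Rightarrow> real" where
  "DG_norm \<Omega> c\<^sub>\<Omega> \<T> k w = sqrt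
     (k\<^sup>2 * (L2_norm \<Omega> w)\<^sup>2 + k\<^sup>2 * (bdry_norm \<Omega> \<T> w)\<^sup>2
      + c\<^sub>\<Omega> * (bdry_norm \<Omega> \<T> (grad w))\<^sup>2 + (H1_seminorm \<T> w)\<^sup>2)"


section \<open>The sesquilinear form and the stability constant\<close>

definition A_h :: "(real^'d) set \<Rightarrow> (real^'d) set set \<Rightarrow> real \<Rightarrow> real \<Rightarrow> real \<Rightarrow>
    (real^'d \<Rightarrow> complex) \<Rightarrow> (real^'d \<Rightarrow> complex^'d) \<Rightarrow>
    (real^'d \<Rightarrow> complex) \<Rightarrow> (real^'d \<Rightarrow> complex^'d) \<Rightarrow> complex" where
  "A_h \<Omega> \<T> k \<beta> \<delta> w \<xi> v \<tau> =
     L2_vinner \<Omega> \<xi> (grad v) - of_real (k\<^sup>2) * L2_inner \<Omega> w v + \<i> * of_real k * bdry_inner \<Omega> \<T> w v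
     - (\<Sum>e\<in>interior_facets \<T>.
          facet_vinner e (\<lambda>x. avg \<T> e (grad w) x - (\<i> * of_real \<beta>) *s jump \<T> e w x) (jump \<T> e v))
     - (\<Sum>e\<in>interior_facets \<T>.
          \<i> * of_real \<delta> * facet_inner e (vjump \<T> e (grad w)) (vjump \<T> e \<tau>)
          - facet_vinner e (jump \<T> e w) (avg \<T> e \<tau>))
     + L2_vinner \<Omega> \<xi> \<tau> - L2_vinner \<Omega> (grad w) \<tau>"

text \<open>All terms in the maximum are positive, so inserting 0 only fixes the value 0 for a mesh without
  interior facets.\<close>

definition \<gamma>\<^sub>1 :: "(real^'d) set set \<Rightarrow> real \<Rightarrow> real \<Rightarrow> real \<Rightarrow> real" where
  "\<gamma>\<^sub>1 \<T> k \<beta> \<delta> = 1 + k + sqrt (\<beta> / \<delta>) +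
     Max (insert 0 ((\<lambda>e. (k\<^sup>2 + 1) / (\<beta> * diameter e) + 1 / (diameter e)\<^sup>2 + 1 / (\<beta> * (diameter e) ^ 3))
                      ` interior_facets \<T>))"

text \<open>Suprema over this set are taken in \<open>ereal\<close>: they may be \<open>\<infinity>\<close>, since \<open>\<tau>\<^sub>h\<close> is not controlled by the denominator.\<close>

definition test_pairs :: "(real^'d) set \<Rightarrow> (real^'d) set set \<Rightarrow>
    ((real^'d \<Rightarrow> complex) \<times> (real^'d \<Rightarrow> complex^'d)) set" where
  "test_pairs \<Omega> \<T> = {(v, \<tau>). v \<in> V_h \<T> \<and> \<tau> \<in> \<Sigma>_h \<T> \<and> \<not> (AE x\<in>\<Omega> in lebesgue. v x = 0)}"

end

theory Submission
  imports Defs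
begin

text \<open>
  Testing with \<open>\<tau> = - \<nabla>\<^sub>h v\<close> removes \<open>\<xi>\<close> from the form and leaves a sesquilinear form \<open>a(w, v)\<close> of interior
  penalty type (\<open>A_h_reduced\<close>).  Let \<open>s\<close> be the sum of the two suprema, both of which are nonnegative.  Then the
  real and the imaginary part of \<open>a(w, v)\<close> are at most \<open>s \<parallel>v\<parallel>\<close> for every \<open>v\<close>, and the claim follows
  from an estimate of \<open>\<parallel>w\<parallel>\<^sup>2\<close> by \<open>\<gamma>\<^sub>1 s \<parallel>w\<parallel>\<close> up to a constant (\<open>DG_norm_le\<close>).  It rests on two test functions.

  With \<open>v = w\<close> the two consistency terms are conjugate to each other, so that \<open>Im a(w, w)\<close> is the sum of
  \<open>k \<parallel>w\<parallel>\<^sup>2\<close> on \<open>\<Gamma>\<close> and of the penalties \<open>\<beta> |[[w]]|\<^sup>2 + \<delta> |[[\<nabla>\<^sub>h w]]|\<^sup>2\<close> (\<open>Im_A_h_self\<close>).  Hence the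
  jumps and the boundary values of \<open>w\<close> are controlled by \<open>s \<parallel>w\<parallel>\<close>.

  The Rellich multiplier \<open>v = \<alpha> \<bullet> \<nabla>\<^sub>h w\<close> with \<open>\<alpha> = x - x\<^sub>\<Omega>\<close> is again piecewise affine and has the
  piecewise gradient of \<open>w\<close>.  The divergence theorem on each simplex, for the fields \<open>\<alpha>\<close> and
  \<open>|w|\<^sup>2 \<alpha>\<close>, turns \<open>2 Re a(w, v) + (d - 1) Re a(w, w)\<close> into the sum of \<open>|\<nabla>\<^sub>h w|\<^sup>2 + k\<^sup>2 |w|\<^sup>2\<close> over
  \<open>\<Omega>\<close>, of boundary terms, and of terms on interior facets (\<open>rellich_lower_bound\<close>).  On \<open>\<Gamma>\<close> the factor
  \<open>\<alpha> \<bullet> n\<close> is at least \<open>c\<^sub>\<Omega>\<close>, which gives the gradient on the boundary.  On interior facets every term has a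
  jump as a factor.  In the products with the mean of \<open>\<nabla>\<^sub>h w\<close> the normal jump of the gradient
  cancels; the tangential jump that remains is the tangential gradient of \<open>[[w]]\<close>, and an
  inverse inequality on the facet bounds it by \<open>h\<^sub>e\<^sup>-\<^sup>1 [[w]]\<close> (\<open>interior_facet_estimate\<close>).
  Young's inequality then absorbs the means and leaves multiples of the penalties; the powers of \<open>h\<^sub>e\<close>, \<open>k\<close>, \<open>\<beta>\<close>
  and \<open>\<delta>\<close> that it produces are those in \<open>\<gamma>\<^sub>1\<close>.

  Two ingredients are geometric.  The divergence theorem is only needed for squares of affine
  functions on a simplex and is derived from the change of their integrals under shrinking the
  simplex towards a vertex (\<open>cone_surface_integral\<close>); an affine combination over the vertices then
  allows an arbitrary centre \<open>x\<^sub>\<Omega>\<close> (\<open>divergence_identity\<close>).  The trace and inverse inequalities follow from a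
  bound for affine functions on convex sets (\<open>affine_norm_sq_le_integral\<close>), once the minimal angle bounds
  the heights of a simplex from below (\<open>height_ge_diameter\<close>).
\<close>

section \<open>Affine changes of variables\<close>

lemma det_rank_one_update:
  fixes n a :: "real^'n"
  assumes n: "norm n = 1"
  shows "det (matrix (\<lambda>x. x + (n \<bullet> x) *\<^sub>R a)) = 1 + n \<bullet> a"
proof -
  let ?D = "\<lambda>x. x + (n \<bullet> x) *\<^sub>R a"
  fix k :: 'n
  obtain f :: "real^'n \<Rightarrow> real^'n" where f: "orthogonal_transformation f" "f (axis k 1) = n"
    using orthogonal_transformation_exists[of "axis k (1::real)" n] n by auto
  have lf: "linear f" and inv: "\<And>x y. f x \<bullet> f y = x \<bullet> y"
    using f by (auto simp: orthogonal_transformation_def)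
  obtain g where g: "linear g" "\<And>x. f (g x) = x" "\<And>x. g (f x) = x"
    using orthogonal_transformation_inv[OF f(1)] orthogonal_transformation_bij[OF f(1)]
      orthogonal_transformation_linear bij_inv_eq_iff by metis
  have lD: "linear ?D"
    by (auto intro!: linearI simp: inner_simps algebra_simps)
  let ?E = "g \<circ> (?D \<circ> f)"
  have E: "?E x = x + x $ k *\<^sub>R g a" for x
  proof -
    have "n \<bullet> f x = axis k 1 \<bullet> x" using f(2) inv by metis
    then have "?E x = g (f x + (x $ k) *\<^sub>R a)" by (simp add: inner_axis')
    then show ?thesis using g by (simp add: linear_add linear_cmul)
  qed
  have dm: "det (matrix f) * det (matrix g) = 1"
  proof -
    have "matrix (f \<circ> g) = mat 1" using g(2) by (simp add: o_def matrix_id_mat_1[symmetric] id_def)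
    then have "matrix f ** matrix g = mat 1" using matrix_compose[OF g(1) lf] by simp
    then show ?thesis by (metis det_I det_mul)
  qed
  have "det (matrix ?E) = det (matrix g) * (det (matrix ?D) * det (matrix f))"
    using matrix_compose[OF lf lD] matrix_compose[OF linear_compose[OF lf lD] g(1)] by (simp add: det_mul)
  then have "det (matrix ?D) = det (matrix ?E)" using dm by (simp add: algebra_simps)
  also have "matrix ?E = (\<chi> i j. if j = k then (mat 1 *v (axis k 1 + g a)) $ i else (mat 1 :: real^'n^'n) $ i $ j)"
    unfolding matrix_vector_mul_lid matrix_def by (simp only: E) (auto simp: vec_eq_iff mat_def axis_def)
  also have "det \<dots> = (axis k 1 + g a) $ k * det (mat 1 :: real^'n^'n)"
    by (rule cramer_lemma)
  also have "\<dots> = 1 + g a $ k" by (simp add: axis_def)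
  also have "g a $ k = n \<bullet> a" using inv[of "axis k 1" "g a"] f g by (simp add: inner_axis')
  finally show ?thesis .
qed

text \<open>Images under linear maps are measured by the determinant when the coordinates are well-ordered.  The
  next lemmas carry this over to an index type of two or three elements, by renumbering the coordinates
  with the numeral types; the maps \<open>x \<mapsto> x + (n \<bullet> x) a\<close> keep their form under such a renumbering.\<close>

lemma emeasure_lborel_linear_vimage:
  fixes L :: "real^'n::{finite,wellorder} \<Rightarrow> real^'n::_"
  assumes L: "linear L" and D: "det (matrix L) \<noteq> 0" and A: "A \<in> sets borel"
  shows "emeasure lborel A = ennreal \<bar>det (matrix L)\<bar> * emeasure lborel (L -` A)"
proof -
  have mL: "L \<in> borel_measurable borel"
    using L by (simp add: borel_measurable_continuous_onI linear_continuous_on linear_conv_bounded_linear)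
  have inj: "inj L" "surj L" using D L
    using det_nz_iff_inj linear_injective_imp_surjective by blast+
  define M where "M = inv L"
  have M: "linear M" "\<And>x. M (L x) = x" "\<And>x. L (M x) = x"
    using L inj by (auto simp: M_def inj_linear_imp_inv_linear surj_f_inv_f)
  have "lborel = density (distr lborel borel L) (\<lambda>_. ennreal \<bar>det (matrix L)\<bar>)"
  proof (rule lborel_eqI)
    fix l u :: "real^'n::_" assume lu: "\<And>b. b \<in> Basis \<Longrightarrow> l \<bullet> b \<le> u \<bullet> b"
    let ?B = "box l u"
    have V: "L -` ?B = M ` ?B" using M by (auto simp: image_iff) metis+
    have lm: "L -` ?B \<in> lmeasurable" unfolding V by (rule measurable_linear_image[OF M(1)]) simp
    have sB: "L -` ?B \<in> sets borel" using mL by (simp add: measurable_sets_borel)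
    have im: "L ` (L -` ?B) = ?B" using inj by (simp add: surj_image_vimage_eq)
    have "measure lebesgue ?B = \<bar>det (matrix L)\<bar> * measure lebesgue (L -` ?B)"
      using measure_linear_image[OF L lm] im by simp
    moreover have "emeasure lborel (L -` ?B) = ennreal (measure lebesgue (L -` ?B))"
      using emeasure_eq_measure2[OF lm] sB by simp
    ultimately have "ennreal (measure lebesgue ?B) = ennreal \<bar>det (matrix L)\<bar> * emeasure lborel (L -` ?B)"
      by (simp add: ennreal_mult)
    moreover have "ennreal (measure lebesgue ?B) = (\<Prod>b\<in>Basis. (u - l) \<bullet> b)"
      using lu by (simp add: measure_lborel_box_eq)
    ultimately show "emeasure (density (distr lborel borel L) (\<lambda>_. ennreal \<bar>det (matrix L)\<bar>)) ?B = (\<Prod>b\<in>Basis. (u - l) \<bullet> b)"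
      using mL sB by (simp add: emeasure_density_const emeasure_distr)
  qed simp
  then have "emeasure lborel A = emeasure (density (distr lborel borel L) (\<lambda>_. ennreal \<bar>det (matrix L)\<bar>)) A" by simp
  then show ?thesis using A mL by (simp add: emeasure_density_const emeasure_distr)
qed

lemma emeasure_lborel_reindex_vimage:
  fixes g :: "'e::finite \<Rightarrow> 'd::finite"
  assumes g: "bij g" and A: "A \<in> sets borel"
  shows "emeasure lborel ((\<lambda>x::real^'d. \<chi> j. x $ g j) -` A) = emeasure lborel (A :: (real^'e) set)"
proof -
  let ?r = "\<lambda>x::real^'d. (\<chi> j. x $ g j) :: real^'e"
  let ?s = "\<lambda>y::real^'e. (\<chi> i. y $ inv g i) :: real^'d"
  have m: "?r \<in> borel_measurable borel"
    by (intro borel_measurable_continuous_onI continuous_intros)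
  have "lborel = distr lborel borel ?r"
  proof (rule lborel_eqI)
    fix l u :: "real^'e" assume lu: "\<And>b. b \<in> Basis \<Longrightarrow> l \<bullet> b \<le> u \<bullet> b"
    have le: "l $ j \<le> u $ j" for j using lu[of "axis j 1"] by (auto simp: inner_axis)
    have V: "?r -` box l u = box (?s l) (?s u)"
      using g by (auto simp: mem_box_cart bij_is_surj surj_f_inv_f) (metis bij_inv_eq_iff)+
    have "emeasure (distr lborel borel ?r) (box l u) = emeasure lborel (box (?s l) (?s u))"
      using m by (simp add: emeasure_distr V)
    also have "\<dots> = (\<Prod>b\<in>Basis. (?s u - ?s l) \<bullet> b)"
      by (subst emeasure_lborel_box_eq) (auto simp: Basis_vec_def inner_axis le)
    also have "(\<Prod>b\<in>Basis. (?s u - ?s l) \<bullet> b) = (\<Prod>i\<in>UNIV. (u - l) $ inv g i)"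
      by (simp add: Basis_vec_def UNION_singleton_eq_range prod.reindex axis_eq_axis inj_on_def inner_axis)
    also have "\<dots> = (\<Prod>j\<in>UNIV. (u - l) $ j)"
      by (rule prod.reindex_bij_betw) (simp add: g bij_imp_bij_inv)
    also have "\<dots> = (\<Prod>b\<in>Basis. (u - l) \<bullet> b)"
      by (simp add: Basis_vec_def UNION_singleton_eq_range prod.reindex axis_eq_axis inj_on_def inner_axis)
    finally show "emeasure (distr lborel borel ?r) (box l u) = (\<Prod>b\<in>Basis. (u - l) \<bullet> b)" .
  qed simp
  then have "emeasure lborel A = emeasure (distr lborel borel ?r) A" by simp
  then show ?thesis using A m by (simp add: emeasure_distr)
qed

lemma emeasure_lborel_rank_one_vimage_reindexed:
  fixes n a :: "real^'d" and g :: "'e::{finite,wellorder} \<Rightarrow> 'd"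
  assumes n: "norm n = 1" and g: "bij g" and D: "1 + n \<bullet> a \<noteq> 0" and A: "A \<in> sets borel"
  shows "emeasure lborel A = ennreal \<bar>1 + n \<bullet> a\<bar> * emeasure lborel ((\<lambda>x. x + (n \<bullet> x) *\<^sub>R a) -` A)"
proof -
  let ?r = "\<lambda>x::real^'d. (\<chi> j. x $ g j) :: real^'e::_"
  let ?s = "\<lambda>y::real^'e::_. (\<chi> i. y $ inv g i) :: real^'d"
  let ?T = "\<lambda>x. x + (n \<bullet> x) *\<^sub>R a"
  let ?U = "\<lambda>y. y + (?r n \<bullet> y) *\<^sub>R ?r a"
  have rs: "?r (?s y) = y" "?s (?r x) = x" for x y
    using g by (auto simp: vec_eq_iff bij_is_inj bij_is_surj surj_f_inv_f)
  have inn: "?r x \<bullet> ?r y = x \<bullet> y" for x y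
    using sum.reindex_bij_betw[OF g, of "\<lambda>i. x $ i * y $ i"] by (simp add: inner_vec_def)
  have Un: "norm (?r n) = 1" using n inn[of n n] by (simp add: norm_eq_1)
  have lU: "linear ?U" by (auto intro!: linearI simp: inner_simps algebra_simps)
  have ms: "?s \<in> borel_measurable borel"
    by (intro borel_measurable_continuous_onI continuous_intros)
  have mU: "?U \<in> borel_measurable borel"
    by (intro borel_measurable_continuous_onI continuous_intros)
  have sA: "?s -` A \<in> sets borel" using measurable_sets_borel[OF ms A] .
  have UA: "?U -` ?s -` A \<in> sets borel" using measurable_sets_borel[OF mU sA] .
  have "emeasure lborel A = emeasure lborel (?r -` ?s -` A)"
    using rs by (simp add: vimage_def)
  also have "\<dots> = emeasure lborel (?s -` A)"
    by (rule emeasure_lborel_reindex_vimage[OF g sA])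
  also have "\<dots> = ennreal \<bar>1 + n \<bullet> a\<bar> * emeasure lborel (?U -` ?s -` A)"
    using emeasure_lborel_linear_vimage[OF lU _ sA] D det_rank_one_update[OF Un, of "?r a"] inn by simp
  also have "emeasure lborel (?U -` ?s -` A) = emeasure lborel (?r -` ?U -` ?s -` A)"
    by (rule emeasure_lborel_reindex_vimage[OF g UA, symmetric])
  also have "?r -` ?U -` ?s -` A = ?T -` A"
  proof -
    have "?s (?U (?r x)) = ?T x" for x
    proof -
      have "?U (?r x) = ?r (?T x)" by (simp add: inn) (simp add: vec_eq_iff)
      then have "?s (?U (?r x)) = ?s (?r (?T x))" by (rule arg_cong)
      then show ?thesis by (simp only: rs)
    qed
    then show ?thesis by (simp add: vimage_def)
  qed
  finally show ?thesis .
qed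

lemma emeasure_lborel_rank_one_vimage:
  fixes n a :: "real^'d"
  assumes dim: "CARD('d) = 2 \<or> CARD('d) = 3"
    and n: "norm n = 1" and D: "1 + n \<bullet> a \<noteq> 0" and A: "A \<in> sets borel"
  shows "emeasure lborel A = ennreal \<bar>1 + n \<bullet> a\<bar> * emeasure lborel ((\<lambda>x. x + (n \<bullet> x) *\<^sub>R a) -` A)"
  using dim
proof
  assume "CARD('d) = 2"
  then obtain g :: "2 \<Rightarrow> 'd" where "bij g"
    using finite_same_card_bij[of "UNIV :: 2 set" "UNIV :: 'd set"] by auto
  then show ?thesis by (rule emeasure_lborel_rank_one_vimage_reindexed[OF n _ D A])
next
  assume "CARD('d) = 3"
  then obtain g :: "3 \<Rightarrow> 'd" where "bij g"
    using finite_same_card_bij[of "UNIV :: 3 set" "UNIV :: 'd set"] by auto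
  then show ?thesis by (rule emeasure_lborel_rank_one_vimage_reindexed[OF n _ D A])
qed

lemma lborel_eq_distr_rank_one:
  fixes n a t :: "real^'d"
  assumes dim: "CARD('d) = 2 \<or> CARD('d) = 3" and n: "norm n = 1" and D: "1 + n \<bullet> a \<noteq> 0"
  shows "lborel = density (distr lborel borel (\<lambda>x. t + (x + (n \<bullet> x) *\<^sub>R a))) (\<lambda>_. ennreal \<bar>1 + n \<bullet> a\<bar>)"
proof (rule measure_eqI)
  fix A :: "(real^'d) set" assume A: "A \<in> sets lborel"
  let ?T = "\<lambda>x. x + (n \<bullet> x) *\<^sub>R a"
  have mT: "(\<lambda>x. t + ?T x) \<in> borel_measurable borel"
    by (intro borel_measurable_continuous_onI continuous_intros)
  have mt: "(+) t \<in> borel_measurable borel" by simp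
  have tA: "(+) t -` A \<in> sets borel" using measurable_sets_borel[OF mt] A by simp
  have "emeasure lborel A = emeasure lborel ((+) t -` A)"
    using emeasure_distr[of "(+) t" lborel borel A] A by (simp add: lborel_distr_plus)
  also have "\<dots> = ennreal \<bar>1 + n \<bullet> a\<bar> * emeasure lborel (?T -` (+) t -` A)"
    by (rule emeasure_lborel_rank_one_vimage[OF dim n D tA])
  finally show "emeasure lborel A = emeasure (density (distr lborel borel (\<lambda>x. t + ?T x)) (\<lambda>_. ennreal \<bar>1 + n \<bullet> a\<bar>)) A"
    using A mT by (simp add: emeasure_density_const emeasure_distr vimage_def)
qed simp

text \<open>The common form of the two kinds of substitution that follow, homotheties and maps
  \<open>x \<mapsto> t + x + (n \<bullet> x) a\<close>: both are given as an identity for Lebesgue measure.\<close>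

lemma set_integral_affine_substitution:
  fixes f :: "'a::euclidean_space \<Rightarrow> real"
  assumes T: "T \<in> borel_measurable borel"
    and eq: "lborel = density (distr lborel borel T) (\<lambda>_. ennreal c)" and c: "c > 0"
    and f: "f \<in> borel_measurable borel" and S: "S \<in> sets borel" and im: "T -` S' = S"
    and S': "S' \<in> sets borel"
  shows "(LINT x:S'|lborel. f x) = c * (LINT x:S|lborel. f (T x))"
    and "measure lborel S' = c * measure lborel S"
proof -
  have "(LINT x|lborel. indicator S' x *\<^sub>R f x) =
      (LINT x|density (distr lborel borel T) (\<lambda>_. ennreal c). indicator S' x *\<^sub>R f x)"
    using eq by simp
  also have "\<dots> = (LINT x|distr lborel borel T. c *\<^sub>R (indicator S' x *\<^sub>R f x))"
    using f S' c by (subst integral_density) auto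
  also have "\<dots> = (LINT x|lborel. c *\<^sub>R (indicator S' (T x) *\<^sub>R f (T x)))"
    using f S' T by (subst integral_distr) auto
  also have "\<dots> = c * (LINT x|lborel. indicator S x *\<^sub>R f (T x))"
    using im by (subst integral_scaleR_right) (auto simp: indicator_def vimage_def)
  finally show "(LINT x:S'|lborel. f x) = c * (LINT x:S|lborel. f (T x))"
    by (simp add: set_lebesgue_integral_def)
  have "emeasure lborel S' = emeasure (density (distr lborel borel T) (\<lambda>_. ennreal c)) S'" using eq by simp
  also have "\<dots> = ennreal c * emeasure lborel S"
    using S' T im by (simp add: emeasure_density_const emeasure_distr)
  finally show "measure lborel S' = c * measure lborel S"
    using c by (simp add: measure_def enn2real_mult)
qed

section \<open>An inverse inequality for affine functions\<close>

lemma set_integrable_lborel_continuous: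
  fixes f :: "'a::euclidean_space \<Rightarrow> 'b::{banach, second_countable_topology}"
  assumes "continuous_on UNIV f" "compact S"
  shows "set_integrable lborel S f"
  using assms borel_integrable_compact[of S f] continuous_on_subset[of UNIV f S]
  by (auto simp: set_integrable_def indicator_def if_distrib cong: if_cong)

text \<open>From \<open>J a = 2 J ((a + x)/2) - J x\<close> one bounds \<open>|J a|\<^sup>2\<close> by values at \<open>x\<close> and at the midpoint of \<open>a\<close> and \<open>x\<close>,
  and integrates over \<open>x \<in> P\<close>.  By convexity the midpoints stay in \<open>P\<close>, in a copy of \<open>P\<close> shrunk by the factor 2.
  The constant depends on the dimension alone and not on the shape of \<open>P\<close>.\<close>

lemma affine_norm_sq_le_integral:
  fixes J :: "real^'d \<Rightarrow> complex"
  assumes P: "convex P" "compact P" and a: "a \<in> P"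
    and mid: "\<And>x y. J ((1/2) *\<^sub>R (x + y)) = (J x + J y) / 2" and J: "continuous_on UNIV J"
  shows "measure lborel P * (norm (J a))\<^sup>2 \<le> (2 ^ (CARD('d) + 3) + 2) * (LINT x:P|lborel. (norm (J x))\<^sup>2)"
proof -
  let ?T = "\<lambda>x. (1/2) *\<^sub>R a + (1/2) *\<^sub>R x"
  let ?q = "\<lambda>x. (norm (J x))\<^sup>2"
  have q: "continuous_on UNIV ?q" by (intro continuous_intros J)
  then have qm: "?q \<in> borel_measurable borel" by (rule borel_measurable_continuous_onI)
  have PT: "compact (?T ` P)" using P by (intro compact_continuous_image continuous_intros)
  have sub: "?T ` P \<subseteq> P" using P a by (auto intro!: convexD)
  note int = set_integrable_lborel_continuous
  have qT: "continuous_on UNIV (\<lambda>x. ?q (?T x))"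
    by (intro continuous_intros continuous_on_compose2[OF J]) auto
  have eq: "lborel = density (distr lborel borel ?T) (\<lambda>_. ennreal ((1/2) ^ CARD('d)))"
    using lborel_affine[of "1/2" "(1/2) *\<^sub>R a"] by simp
  have im: "?T -` (?T ` P) = P" by (auto simp: inj_image_mem_iff)
  have "(LINT x:?T ` P|lborel. ?q x) = (1/2) ^ CARD('d) * (LINT x:P|lborel. ?q (?T x))"
    by (rule set_integral_affine_substitution[OF _ eq _ qm _ im])
       (use P PT in \<open>auto intro: borel_compact\<close>)
  then have "(LINT x:P|lborel. ?q (?T x)) = 2 ^ CARD('d) * (LINT x:?T ` P|lborel. ?q x)"
    by (simp add: power_divide)
  also have "(LINT x:?T ` P|lborel. ?q x) \<le> (LINT x:P|lborel. ?q x)"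
    unfolding set_lebesgue_integral_def
    by (rule integral_mono)
       (use int[OF q P(2)] int[OF q PT] sub in \<open>auto simp: set_integrable_def indicator_def\<close>)
  finally have scaled: "(LINT x:P|lborel. ?q (?T x)) \<le> 2 ^ CARD('d) * (LINT x:P|lborel. ?q x)" by simp
  have pt: "?q a \<le> 8 * ?q (?T x) + 2 * ?q x" for x
  proof -
    have "J a = 2 * J (?T x) - J x" using mid[of a x] by (simp add: scaleR_add_right algebra_simps)
    then have "norm (J a) \<le> 2 * norm (J (?T x)) + norm (J x)"
      using norm_triangle_ineq4[of "2 * J (?T x)" "J x"] by (simp add: norm_mult)
    then have "?q a \<le> (2 * norm (J (?T x)) + norm (J x))\<^sup>2" by (intro power_mono) auto
    also have "\<dots> \<le> 8 * ?q (?T x) + 2 * ?q x"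
      using sum_squares_bound[of "2 * norm (J (?T x))" "norm (J x)"] by (simp add: power2_sum power_mult_distrib)
    finally show ?thesis .
  qed
  have "measure lborel P * ?q a = (LINT x:P|lborel. ?q a)"
    using P by (simp add: set_lebesgue_integral_def borel_compact emeasure_compact_finite)
  also have "\<dots> \<le> (LINT x:P|lborel. 8 * ?q (?T x) + 2 * ?q x)"
    by (rule set_integral_mono) (auto intro!: int P continuous_intros qT q pt simp: )
  also have "\<dots> = 8 * (LINT x:P|lborel. ?q (?T x)) + 2 * (LINT x:P|lborel. ?q x)"
    using int[OF qT P(2)] int[OF q P(2)] by (subst set_integral_add) auto
  finally show ?thesis using scaled by (simp add: power_add algebra_simps)
qed

section \<open>Surface measure on a flat facet\<close>

lemma closest_point_hyperplane:
  fixes n :: "real^'d"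
  assumes n: "norm n = 1"
  shows "closest_point {x. n \<bullet> x = b} y = y - (n \<bullet> y - b) *\<^sub>R n"
    and "infdist y {x. n \<bullet> x = b} = \<bar>n \<bullet> y - b\<bar>"
proof -
  let ?p = "y - (n \<bullet> y - b) *\<^sub>R n"
  have nn: "n \<bullet> n = 1" using n by (simp add: norm_eq_1)
  have p: "?p \<in> {x. n \<bullet> x = b}" using nn by (simp add: inner_diff_right)
  have d: "dist y ?p = \<bar>n \<bullet> y - b\<bar>" using n by (simp add: dist_norm)
  have le: "\<bar>n \<bullet> y - b\<bar> \<le> dist y z" if "n \<bullet> z = b" for z
    using Cauchy_Schwarz_ineq2[of n "y - z"] n that by (simp add: inner_diff_right dist_norm)
  show "closest_point {x. n \<bullet> x = b} y = ?p"
    by (rule closest_point_unique[symmetric]) (use p d le in \<open>auto simp: convex_hyperplane closed_hyperplane\<close>)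
  have "infdist y {x. n \<bullet> x = b} \<le> \<bar>n \<bullet> y - b\<bar>" using infdist_le[OF p, of y] unfolding d .
  moreover have "\<bar>n \<bullet> y - b\<bar> \<le> infdist y {x. n \<bullet> x = b}"
    using p le by (subst infdist_notempty) (auto intro!: cINF_greatest)
  ultimately show "infdist y {x. n \<bullet> x = b} = \<bar>n \<bullet> y - b\<bar>" by simp
qed

text \<open>The hyperplane spanned by \<open>e\<close> is given by a unit normal, so that projection onto it and the prism
  over \<open>e\<close> become explicit.\<close>

locale flat_facet =
  fixes e :: "(real^'d) set" and n :: "real^'d" and b :: real
  assumes unit: "norm n = 1" and hull: "affine hull e = {x. n \<bullet> x = b}" and comp: "compact e"
begin

definition proj :: "real^'d \<Rightarrow> real^'d" where "proj y = y - (n \<bullet> y - b) *\<^sub>R n"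

lemma nn: "n \<bullet> n = 1" using unit by (simp add: norm_eq_1)

lemma closest_point_eq: "closest_point (affine hull e) = proj"
  by (rule ext) (simp add: hull closest_point_hyperplane[OF unit] proj_def)

lemma in_hyperplane: "x \<in> e \<Longrightarrow> n \<bullet> x = b" using hull hull_subset[of e affine] by auto

lemma nonempty: "e \<noteq> {}"
proof
  assume "e = {}"
  then have "{x. n \<bullet> x = b} = {}" using hull by simp
  moreover have "b *\<^sub>R n \<in> {x. n \<bullet> x = b}" using nn by simp
  ultimately show False by blast
qed

lemma prism_eq: "prism e = {y. proj y \<in> e \<and> \<bar>n \<bullet> y - b\<bar> \<le> 1/2}"
  by (simp add: prism_def hull closest_point_hyperplane[OF unit] proj_def)

lemma proj_continuous: "continuous_on S proj" unfolding proj_def[abs_def] by (intro continuous_intros)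

lemma proj_measurable: "proj \<in> borel_measurable borel"
  by (intro borel_measurable_continuous_onI proj_continuous)

lemma proj_id: "x \<in> e \<Longrightarrow> proj x = x" by (simp add: proj_def in_hyperplane)

lemma prism_image: "prism e = (\<lambda>(y, s). y + s *\<^sub>R n) ` (e \<times> {-1/2..1/2})"
proof (intro set_eqI iffI)
  fix x assume "x \<in> prism e"
  then show "x \<in> (\<lambda>(y, s). y + s *\<^sub>R n) ` (e \<times> {-1/2..1/2})"
    by (intro image_eqI[of _ _ "(proj x, n \<bullet> x - b)"]) (auto simp: prism_eq proj_def abs_if split: if_splits)
next
  fix x assume "x \<in> (\<lambda>(y, s). y + s *\<^sub>R n) ` (e \<times> {-1/2..1/2})"
  then obtain y s where "y \<in> e" "-1/2 \<le> s" "s \<le> 1/2" "x = y + s *\<^sub>R n" by auto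
  then show "x \<in> prism e"
    using in_hyperplane[of y] nn by (simp add: prism_eq proj_def inner_add_right abs_if)
qed

lemma compact_prism: "compact (prism e)"
  unfolding prism_image
  by (intro compact_continuous_image compact_Times comp compact_Icc)
     (auto simp: case_prod_unfold intro!: continuous_intros)

lemma prism_sets: "prism e \<in> sets borel" using compact_prism by (rule borel_compact)

lemma sets_facet_measure: "sets (facet_measure e) = sets borel" by (simp add: facet_measure_def)

lemma space_facet_measure: "space (facet_measure e) = UNIV" by (simp add: facet_measure_def)

lemma proj_restrict: "proj \<in> restrict_space lborel (prism e) \<rightarrow>\<^sub>M borel"
  by (intro measurable_restrict_space1) (simp add: proj_measurable)

lemma facet_measure_proj: "facet_measure e = distr (restrict_space lborel (prism e)) borel proj"
  by (simp add: facet_measure_def closest_point_eq)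

lemma integral_facet_measure:
  fixes f :: "real^'d \<Rightarrow> 'b::{banach, second_countable_topology}"
  assumes f: "f \<in> borel_measurable borel"
  shows "(LINT x|facet_measure e. f x) = (LINT x:prism e|lborel. f (proj x))"
proof -
  have "(LINT x|facet_measure e. f x) = (LINT x|restrict_space lborel (prism e). f (proj x))"
    unfolding facet_measure_proj by (rule integral_distr[OF proj_restrict f])
  then show ?thesis
    by (simp add: integral_restrict_space prism_sets set_lebesgue_integral_def)
qed

lemma finite_facet_measure: "finite_measure (facet_measure e)"
proof
  have "emeasure (facet_measure e) (space (facet_measure e)) = emeasure lborel (prism e)"
    unfolding facet_measure_proj using proj_restrict prism_sets
    by (simp add: emeasure_distr space_restrict_space emeasure_restrict_space)
  then show "emeasure (facet_measure e) (space (facet_measure e)) \<noteq> \<infinity>"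
    using emeasure_compact_finite[OF compact_prism] by simp
qed

lemma measure_facet_measure: "measure (facet_measure e) UNIV = measure lborel (prism e)"
  unfolding facet_measure_proj using proj_restrict prism_sets
  by (simp add: measure_distr space_restrict_space measure_restrict_space)

lemma AE_facet_measure: "AE x in facet_measure e. x \<in> e"
proof -
  have "e \<in> sets borel" using comp by (rule borel_compact)
  then show ?thesis
    unfolding facet_measure_proj
    by (subst AE_distr_iff[OF proj_restrict])
       (use prism_sets in \<open>auto simp: AE_restrict_space_iff prism_eq\<close>)
qed

lemma integrable_facet_measure:
  fixes f :: "real^'d \<Rightarrow> 'b::{banach, second_countable_topology}"
  assumes f: "f \<in> borel_measurable borel" and bd: "\<And>x. x \<in> e \<Longrightarrow> norm (f x) \<le> B"
  shows "integrable (facet_measure e) f"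
  by (rule finite_measure.integrable_const_bound[OF finite_facet_measure, of _ B])
     (use f bd AE_facet_measure in \<open>auto simp: measurable_cong_sets[OF sets_facet_measure refl]\<close>)

lemma integrable_facet_measure_continuous:
  fixes f :: "real^'d \<Rightarrow> 'b::{banach, second_countable_topology}"
  assumes f: "continuous_on UNIV f"
  shows "integrable (facet_measure e) f"
proof -
  have "compact (f ` e)" using comp f continuous_on_subset by (blast intro: compact_continuous_image)
  then obtain B where "\<And>y. y \<in> f ` e \<Longrightarrow> norm y \<le> B" using compact_imp_bounded bounded_iff by metis
  then show ?thesis using f by (intro integrable_facet_measure[of _ B] borel_measurable_continuous_onI) auto
qed

end

section \<open>Surface integrals by shrinking a cone\<close>

text \<open>Shrinking the cone \<open>K\<close> towards its apex by the factor \<open>1 - \<epsilon>\<close> cuts off a frustum over \<open>e\<close>.  Up to a set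
  of measure \<open>O(\<epsilon>\<^sup>2)\<close> it is the oblique prism of height \<open>\<epsilon> h\<close> over \<open>e\<close>, which is an affine image of the right
  prism that defines the surface measure.  So the derivative at 1 of the integral over the shrunken
  cone is \<open>h\<close> times the surface integral.\<close>

lemma (in flat_facet) cone_surface_integral:
  fixes v :: "real^'d" and q :: "real^'d \<Rightarrow> real"
  assumes dim: "CARD('d) = 2 \<or> CARD('d) = 3"
    and cvx: "convex e" and v: "n \<bullet> v = b - h" and h: "h > 0"
    and K: "K = convex hull (insert v e)"
    and q: "continuous_on UNIV q"
    and D: "((\<lambda>r. r ^ CARD('d) * (LINT x:K|lborel. q (v + r *\<^sub>R (x - v)))) has_real_derivative D) (at 1)"
  shows "D = h * (LINT x|facet_measure e. q x)"
proof -
  define \<Phi> where "\<Phi> r = r ^ CARD('d) * (LINT x:K|lborel. q (v + r *\<^sub>R (x - v)))" for r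
  define m where "m = measure lborel (prism e)"
  obtain y0 where y0: "y0 \<in> e" using nonempty by blast
  define u where "u = v - y0"
  have nu: "n \<bullet> u = - h" using v in_hyperplane[OF y0] by (simp add: u_def inner_diff_right)
  have cK: "compact K" unfolding K using comp by (simp add: compact_convex_hull)
  have convK: "convex K" unfolding K by simp
  have vK: "v \<in> K" and eK: "e \<subseteq> K" unfolding K using hull_subset[of "insert v e" convex] by auto
  have Kchar: "x \<in> K \<longleftrightarrow> (\<exists>y\<in>e. \<exists>t\<in>{0..1}. x = v + t *\<^sub>R (y - v))" for x
  proof
    assume "x \<in> K"
    then obtain s t y where "0 \<le> s" "0 \<le> t" "s + t = 1" "y \<in> e" "x = s *\<^sub>R v + t *\<^sub>R y"
      unfolding K convex_hull_insert[OF nonempty] using cvx by (auto simp: hull_same)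
    then show "\<exists>y\<in>e. \<exists>t\<in>{0..1}. x = v + t *\<^sub>R (y - v)"
      by (intro bexI[of _ y] bexI[of _ t]) (auto simp: algebra_simps simp flip: scaleR_add_left)
  next
    assume "\<exists>y\<in>e. \<exists>t\<in>{0..1}. x = v + t *\<^sub>R (y - v)"
    then obtain y t where "y \<in> e" "0 \<le> t" "t \<le> 1" "x = v + t *\<^sub>R (y - v)" by auto
    then have "x = (1 - t) *\<^sub>R v + t *\<^sub>R y" by (simp add: algebra_simps)
    then show "x \<in> K" using convexD[OF convK vK, of y "1 - t" t] eK \<open>y \<in> e\<close> \<open>0 \<le> t\<close> \<open>t \<le> 1\<close> by auto
  qed
  have KI: "v + t *\<^sub>R (y - v) \<in> K" if "y \<in> e" "0 \<le> t" "t \<le> 1" for y t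
    unfolding Kchar using that by (intro bexI[of _ y] bexI[of _ t]) auto
  define W where "W = (\<lambda>(y, t). y + t *\<^sub>R u) ` (e \<times> {0..1})"
  have cW: "compact W" unfolding W_def
    by (intro compact_continuous_image compact_Times comp compact_Icc)
       (auto simp: case_prod_unfold intro!: continuous_intros)
  have "compact (q ` W)" using cW q continuous_on_subset by (blast intro: compact_continuous_image)
  then obtain B0 where "\<And>y. y \<in> q ` W \<Longrightarrow> norm y \<le> B0" using compact_imp_bounded bounded_iff by metis
  then have B0: "\<And>x. x \<in> W \<Longrightarrow> \<bar>q x\<bar> \<le> B0" by auto
  define B where "B = max B0 0"
  have B: "\<And>x. x \<in> W \<Longrightarrow> \<bar>q x\<bar> \<le> B" "B \<ge> 0" using B0 by (auto simp: B_def le_max_iff_disj)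
  have qm: "q \<in> borel_measurable borel" using q by (rule borel_measurable_continuous_onI)
  define A where "A \<epsilon> x = proj x + ((n \<bullet> x - b + 1/2) * \<epsilon>) *\<^sub>R u" for \<epsilon> x
  have A_alt: "A \<epsilon> = (\<lambda>x. (b *\<^sub>R n + ((1/2 - b) * \<epsilon>) *\<^sub>R u) + (x + (n \<bullet> x) *\<^sub>R (\<epsilon> *\<^sub>R u - n)))" for \<epsilon>
    by (rule ext) (simp add: A_def proj_def algebra_simps)
  \<comment> \<open>\<open>A \<epsilon>\<close> maps the right prism of height 1 onto the oblique prism with edge vector \<open>\<epsilon> u\<close>.\<close>
  have step: "\<bar>(\<Phi> 1 - \<Phi> (1 - \<epsilon>)) / \<epsilon> - h * (LINT x:prism e|lborel. q (A \<epsilon> x))\<bar> \<le> B * h * m * (1 - (1 - \<epsilon>) ^ CARD('d))"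
    if \<epsilon>: "0 < \<epsilon>" "\<epsilon> < 1" for \<epsilon>
  proof -
    define r where "r = 1 - \<epsilon>"
    have r: "0 < r" "r < 1" using \<epsilon> by (auto simp: r_def)
    define T where "T x = v + r *\<^sub>R (x - v)" for x
    have T_alt: "T = (\<lambda>x. (1 - r) *\<^sub>R v + r *\<^sub>R x)" by (rule ext) (simp add: T_def algebra_simps)
    have Tm: "T \<in> borel_measurable borel" unfolding T_def[abs_def]
      by (intro borel_measurable_continuous_onI continuous_intros)
    have Teq: "lborel = density (distr lborel borel T) (\<lambda>_. ennreal (r ^ CARD('d)))"
      unfolding T_alt using lborel_affine[of r "(1 - r) *\<^sub>R v"] r by simp
    have injT: "inj T" using r by (auto simp: T_def inj_on_def)
    have cTK: "compact (T ` K)" unfolding T_def[abs_def] using cK by (intro compact_continuous_image continuous_intros)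
    have TK: "T ` K \<subseteq> K" using convexD[OF convK vK, of _ "1 - r" r] r by (auto simp: T_alt)
    have intTK: "(LINT x:T ` K|lborel. q x) = \<Phi> r"
      using set_integral_affine_substitution(1)[OF Tm Teq _ qm, of K "T ` K"] r injT cK cTK
      by (simp add: \<Phi>_def inj_vimage_image_eq borel_compact) (simp add: T_def)
    define F where "F = K - T ` K"
    have Fs: "F \<in> sets borel" using cK cTK by (auto simp: F_def borel_compact)
    have iK: "set_integrable lborel K q" "set_integrable lborel (T ` K) q"
      using set_integrable_lborel_continuous[OF q] cK cTK by auto
    have iF: "set_integrable lborel F q"
      by (rule set_integrable_subset[OF iK(1)]) (use Fs in \<open>auto simp: F_def\<close>)
    have intF: "(LINT x:F|lborel. q x) = \<Phi> 1 - \<Phi> r"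
    proof -
      have "(LINT x:F \<union> T ` K|lborel. q x) = (LINT x:F|lborel. q x) + (LINT x:T ` K|lborel. q x)"
        by (rule set_integral_Un[OF _ iF iK(2)]) (auto simp: F_def)
      moreover have "F \<union> T ` K = K" using TK by (auto simp: F_def)
      moreover have "(LINT x:K|lborel. q x) = \<Phi> 1" by (simp add: \<Phi>_def)
      ultimately show ?thesis using intTK by simp
    qed
    define O' where "O' = A \<epsilon> ` prism e"
    have O'_eq: "O' = (\<lambda>(y, t). y + t *\<^sub>R u) ` (e \<times> {0..\<epsilon>})"
    proof -
      have "A \<epsilon> (y + s *\<^sub>R n) = y + ((s + 1/2) * \<epsilon>) *\<^sub>R u" if "y \<in> e" for y s
        using in_hyperplane[OF that] nn by (simp add: A_def proj_def inner_add_right)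
      then have "O' = (\<lambda>(y, s). y + ((s + 1/2) * \<epsilon>) *\<^sub>R u) ` (e \<times> {-1/2..1/2})"
        unfolding O'_def prism_image image_image by (intro image_cong) auto
      also have "\<dots> = (\<lambda>(y, t). y + t *\<^sub>R u) ` (e \<times> (\<lambda>s. (s + 1/2) * \<epsilon>) ` {-1/2..1/2})"
        by force
      also have "(\<lambda>s. (s + 1/2) * \<epsilon>) ` {-1/2..1/2} = {0..\<epsilon>}"
      proof (intro set_eqI iffI)
        fix t assume "t \<in> {0..\<epsilon>}"
        then show "t \<in> (\<lambda>s. (s + 1/2) * \<epsilon>) ` {-1/2..1/2}"
          using \<epsilon> by (intro image_eqI[of _ _ "t / \<epsilon> - 1/2"]) (auto simp: field_simps)
      next
        fix t assume "t \<in> (\<lambda>s. (s + 1/2) * \<epsilon>) ` {-1/2..1/2}"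
        then obtain s where s: "-1/2 \<le> s" "s \<le> 1/2" "t = (s + 1/2) * \<epsilon>" by auto
        then have "(s + 1/2) * \<epsilon> \<le> 1 * \<epsilon>" using \<epsilon> by (intro mult_right_mono) auto
        then show "t \<in> {0..\<epsilon>}" using s \<epsilon> by auto
      qed
      finally show ?thesis .
    qed
    have cO: "compact O'" unfolding O'_eq
      by (intro compact_continuous_image compact_Times comp compact_Icc)
         (auto simp: case_prod_unfold intro!: continuous_intros)
    have OW: "O' \<subseteq> W" unfolding O'_eq W_def using \<epsilon> by auto
    have eh: "1 + n \<bullet> (\<epsilon> *\<^sub>R u - n) = - (\<epsilon> * h)" using nu nn by (simp add: inner_diff_right)
    have Aeq: "lborel = density (distr lborel borel (A \<epsilon>)) (\<lambda>_. ennreal (\<epsilon> * h))"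
      unfolding A_alt using lborel_eq_distr_rank_one[OF dim unit, of "\<epsilon> *\<^sub>R u - n" "b *\<^sub>R n + ((1/2 - b) * \<epsilon>) *\<^sub>R u"]
      using eh \<epsilon> h by simp
    have Am: "A \<epsilon> \<in> borel_measurable borel" unfolding A_alt
      by (intro borel_measurable_continuous_onI continuous_intros)
    have injA: "inj (A \<epsilon>)"
    proof (rule injI)
      fix x y assume eq: "A \<epsilon> x = A \<epsilon> y"
      have nA: "n \<bullet> A \<epsilon> x = b - (n \<bullet> x - b + 1/2) * \<epsilon> * h" for x
        using nn nu by (simp add: A_def proj_def inner_add_right inner_diff_right)
      have "(n \<bullet> x - b + 1/2) * (\<epsilon> * h) = (n \<bullet> y - b + 1/2) * (\<epsilon> * h)"
        using arg_cong[OF eq, of "\<lambda>z. n \<bullet> z"] unfolding nA by (simp only: algebra_simps)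
      then have "n \<bullet> x = n \<bullet> y" using \<epsilon> h by auto
      then show "x = y" using eq by (simp add: A_def proj_def)
    qed
    note sub = set_integral_affine_substitution[OF Am Aeq _ qm, of "prism e" O']
    have intO: "(LINT x:O'|lborel. q x) = \<epsilon> * h * (LINT x:prism e|lborel. q (A \<epsilon> x))"
      using sub(1) \<epsilon> h injA cO prism_sets by (auto simp: O'_def inj_vimage_image_eq borel_compact)
    have mO: "measure lborel O' = \<epsilon> * h * m"
      using sub(2) \<epsilon> h injA cO prism_sets by (auto simp: O'_def inj_vimage_image_eq borel_compact m_def)
    have FO: "F \<subseteq> O'"
    proof
      fix x assume x: "x \<in> F"
      then obtain y t where y: "y \<in> e" "0 \<le> t" "t \<le> 1" "x = v + t *\<^sub>R (y - v)"
        by (auto simp: F_def Kchar)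
      have tr: "t > r"
      proof (rule ccontr)
        assume "\<not> t > r"
        then have "v + (t / r) *\<^sub>R (y - v) \<in> K" using y r by (intro KI) (auto simp: field_simps)
        then have "T (v + (t / r) *\<^sub>R (y - v)) \<in> T ` K" by blast
        moreover have "T (v + (t / r) *\<^sub>R (y - v)) = x" using y r by (simp add: T_def)
        ultimately show False using x by (simp add: F_def)
      qed
      have "(1 - t) *\<^sub>R y0 + t *\<^sub>R y \<in> e" using convexD[OF cvx y0 y(1), of "1 - t" t] y by simp
      moreover have "x = ((1 - t) *\<^sub>R y0 + t *\<^sub>R y) + (1 - t) *\<^sub>R u" by (simp add: y(4) u_def algebra_simps)
      ultimately show "x \<in> O'" unfolding O'_eq using y tr
        by (intro image_eqI[of _ _ "((1 - t) *\<^sub>R y0 + t *\<^sub>R y, 1 - t)"]) (auto simp: r_def)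
    qed
    \<comment> \<open>The shrunken prism lies in the frustum, so the two sets differ by \<open>O(\<epsilon>\<^sup>2)\<close>.\<close>
    define S where "S x = (1 - r) *\<^sub>R y0 + r *\<^sub>R x" for x
    have Seq: "lborel = density (distr lborel borel S) (\<lambda>_. ennreal (r ^ CARD('d)))"
      unfolding S_def[abs_def] using lborel_affine[of r "(1 - r) *\<^sub>R y0"] r by simp
    have Sm: "S \<in> borel_measurable borel" unfolding S_def[abs_def]
      by (intro borel_measurable_continuous_onI continuous_intros)
    have injS: "inj S" using r by (auto simp: S_def inj_on_def)
    have cS: "compact (S ` O')" unfolding S_def[abs_def] using cO by (intro compact_continuous_image continuous_intros)
    have mS: "measure lborel (S ` O') = r ^ CARD('d) * (\<epsilon> * h * m)"
      using set_integral_affine_substitution(2)[OF Sm Seq _ qm, of O' "S ` O'"] r injS cO cS mO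
      by (auto simp: inj_vimage_image_eq borel_compact)
    have SF: "S ` O' \<subseteq> F"
    proof
      fix x assume "x \<in> S ` O'"
      then obtain y t where y: "y \<in> e" "0 \<le> t" "t \<le> \<epsilon>" "x = S (y + t *\<^sub>R u)" by (auto simp: O'_eq)
      define \<rho> where "\<rho> = 1 - r * t"
      have "r * t \<le> r * \<epsilon>" using y r by (intro mult_left_mono) auto
      also have "r * \<epsilon> < 1 * \<epsilon>" using r \<epsilon> by (intro mult_strict_right_mono) auto
      finally have "r * t < \<epsilon>" by simp
      then have \<rho>: "r < \<rho>" "\<rho> \<le> 1" using y r by (auto simp: \<rho>_def r_def)
      define y' where "y' = (1 - r / \<rho>) *\<^sub>R y0 + (r / \<rho>) *\<^sub>R y"
      have y': "y' \<in> e" unfolding y'_def using r \<rho> by (intro convexD[OF cvx y0 y(1)]) auto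
      have "\<rho> *\<^sub>R y' = (\<rho> - r) *\<^sub>R y0 + r *\<^sub>R y"
        using r \<rho> by (simp add: y'_def scaleR_add_right right_diff_distrib)
      then have x: "x = v + \<rho> *\<^sub>R (y' - v)"
        by (simp add: y(4) S_def u_def \<rho>_def algebra_simps)
      have nx: "n \<bullet> x = b - h + \<rho> * h" using x v in_hyperplane[OF y'] by (simp add: inner_add_right inner_diff_right)
      have "n \<bullet> z \<le> b - h + r * h" if "z \<in> T ` K" for z
      proof -
        obtain k where k: "k \<in> K" "z = T k" using \<open>z \<in> T ` K\<close> by blast
        obtain y t where "y \<in> e" "0 \<le> t" "t \<le> 1" "z = T (v + t *\<^sub>R (y - v))"
          using k(1) unfolding Kchar k(2) by auto
        then have "n \<bullet> z = b - h + r * (t * h)" using v in_hyperplane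
          by (simp add: T_def inner_add_right inner_diff_right)
        moreover have "t * h \<le> 1 * h" using \<open>t \<le> 1\<close> h by (intro mult_right_mono) auto
        then have "r * (t * h) \<le> r * h" using r by (intro mult_left_mono) auto
        ultimately show ?thesis by simp
      qed
      moreover have "r * h < \<rho> * h" using \<rho> h by (intro mult_strict_right_mono)
      ultimately have "x \<notin> T ` K" using nx by fastforce
      moreover have "x \<in> K" unfolding x using y' \<rho> r by (intro KI) auto
      ultimately show "x \<in> F" by (simp add: F_def)
    qed
    have iO: "set_integrable lborel O' q" using set_integrable_lborel_continuous[OF q cO] .
    have iOF: "set_integrable lborel (O' - F) q"
      by (rule set_integrable_subset[OF iO]) (use Fs cO in \<open>auto simp: borel_compact\<close>)
    have fin: "emeasure lborel O' < \<infinity>" using emeasure_compact_finite[OF cO] by (simp add: top.not_eq_extremum)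
    have fO: "O' \<in> fmeasurable lborel" using fin cO by (auto intro!: fmeasurableI simp: borel_compact)
    have mOF: "measure lborel (O' - F) \<le> \<epsilon> * h * m * (1 - r ^ CARD('d))"
    proof -
      have "measure lborel (O' - F) \<le> measure lborel (O' - S ` O')"
        by (rule measure_mono_fmeasurable) (use SF Fs cO cS fO in \<open>auto simp: borel_compact intro: fmeasurable_Diff\<close>)
      also have "\<dots> = measure lborel O' - measure lborel (S ` O')"
        using fin SF FO cS cO by (intro measure_Diff) (auto simp: borel_compact)
      finally show ?thesis using mO mS by (simp add: algebra_simps)
    qed
    have "(LINT x:O'|lborel. q x) = (LINT x:O' - F|lborel. q x) + (LINT x:F|lborel. q x)"
      using set_integral_Un[of "O' - F" F lborel q] iOF iF FO by (simp add: Un_absorb2 Int_commute Diff_disjoint)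
    moreover have "\<bar>LINT x:O' - F|lborel. q x\<bar> \<le> B * measure lborel (O' - F)"
    proof -
      have "norm (LINT x:O' - F|lborel. q x) \<le> (LINT x:O' - F|lborel. B)"
        unfolding set_lebesgue_integral_def
      proof (rule order_trans[OF integral_norm_bound], rule integral_mono)
        show "integrable lborel (\<lambda>x. norm (indicator (O' - F) x *\<^sub>R q x))"
          using iOF by (simp add: set_integrable_def)
        show "integrable lborel (\<lambda>x. indicator (O' - F) x *\<^sub>R B)"
          using iOF fmeasurable_Diff[OF fO, of F] Fs
          by (auto simp: fmeasurable_def intro!: integrable_real_indicator)
      qed (use B OW in \<open>auto simp: indicator_def\<close>)
      also have "\<dots> = B * measure lborel (O' - F)"
        using fO Fs cO by (simp add: set_lebesgue_integral_def borel_compact)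
      finally show ?thesis by simp
    qed
    ultimately have "\<bar>(LINT x:O'|lborel. q x) - (LINT x:F|lborel. q x)\<bar> \<le> B * (\<epsilon> * h * m * (1 - r ^ CARD('d)))"
      using mult_left_mono[OF mOF B(2)] by linarith
    then have "\<bar>(\<Phi> 1 - \<Phi> r) - \<epsilon> * (h * (LINT x:prism e|lborel. q (A \<epsilon> x)))\<bar> \<le> \<epsilon> * (B * h * m * (1 - r ^ CARD('d)))"
      using intO intF by (simp add: algebra_simps abs_minus_commute)
    then have "\<bar>(\<Phi> 1 - \<Phi> r) / \<epsilon> - (h * (LINT x:prism e|lborel. q (A \<epsilon> x)))\<bar> \<le> (B * h * m * (1 - r ^ CARD('d)))"
      using \<epsilon> by (simp add: abs_le_iff field_simps)
    then show ?thesis by (simp add: r_def)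
  qed
  define \<epsilon> where "\<epsilon> k = inverse (real (Suc (Suc k)))" for k
  have \<epsilon>: "0 < \<epsilon> k" "\<epsilon> k < 1" for k by (simp_all add: \<epsilon>_def inverse_eq_divide)
  have \<epsilon>0: "\<epsilon> \<longlonglongrightarrow> 0" unfolding \<epsilon>_def by (rule LIMSEQ_Suc[OF LIMSEQ_inverse_real_of_nat])
  have lim1: "(\<lambda>k. (\<Phi> 1 - \<Phi> (1 - \<epsilon> k)) / \<epsilon> k) \<longlonglongrightarrow> D"
  proof -
    have "((\<lambda>y. (\<Phi> y - \<Phi> 1) / (y - 1)) \<longlongrightarrow> D) (at 1)"
      using D unfolding has_field_derivative_iff \<Phi>_def .
    moreover have "filterlim (\<lambda>k. 1 - \<epsilon> k) (at 1) sequentially"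
    proof -
      have "(\<lambda>k. 1 - \<epsilon> k) \<longlonglongrightarrow> 1 - 0" by (intro tendsto_intros \<epsilon>0)
      moreover have "1 - \<epsilon> k \<noteq> 1" for k using \<epsilon>[of k] by simp
      ultimately show ?thesis by (simp add: filterlim_at)
    qed
    ultimately have "(\<lambda>k. (\<Phi> (1 - \<epsilon> k) - \<Phi> 1) / ((1 - \<epsilon> k) - 1)) \<longlonglongrightarrow> D"
      by (rule filterlim_compose)
    moreover have "(\<Phi> (1 - \<epsilon> k) - \<Phi> 1) / ((1 - \<epsilon> k) - 1) = (\<Phi> 1 - \<Phi> (1 - \<epsilon> k)) / \<epsilon> k" for k
      using \<epsilon>[of k] by (simp add: divide_simps)
    ultimately show ?thesis by simp
  qed
  have lim2: "(\<lambda>k. LINT x:prism e|lborel. q (A (\<epsilon> k) x)) \<longlonglongrightarrow> (LINT x:prism e|lborel. q (proj x))"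
    unfolding set_lebesgue_integral_def
  proof (rule integral_dominated_convergence[where w = "\<lambda>x. indicator (prism e) x *\<^sub>R B"])
    show "(\<lambda>x. indicator (prism e) x *\<^sub>R q (proj x)) \<in> borel_measurable lborel"
      using measurable_compose[OF proj_measurable qm] prism_sets by simp
    have "A \<epsilon> \<in> borel_measurable borel" for \<epsilon>
      unfolding A_alt by (intro borel_measurable_continuous_onI continuous_intros)
    from measurable_compose[OF this qm]
    show "(\<lambda>x. indicator (prism e) x *\<^sub>R q (A (\<epsilon> k) x)) \<in> borel_measurable lborel" for k
      using prism_sets by simp
    show "integrable lborel (\<lambda>x. indicator (prism e) x *\<^sub>R B)"
      using set_integrable_lborel_continuous[of "\<lambda>_. B", OF _ compact_prism] by (simp add: set_integrable_def)
    have "continuous (at y) q" for y using q by (simp add: continuous_on_eq_continuous_at)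
    then have "(\<lambda>k. q (A (\<epsilon> k) x)) \<longlonglongrightarrow> q (proj x)" for x
      by (rule continuous_within_tendsto_compose'[of _ UNIV])
         (auto simp: A_def intro!: tendsto_eq_intros \<epsilon>0)
    then show "AE x in lborel. (\<lambda>k. indicator (prism e) x *\<^sub>R q (A (\<epsilon> k) x)) \<longlonglongrightarrow> indicator (prism e) x *\<^sub>R q (proj x)"
      by (intro AE_I2 tendsto_intros)
    have "\<bar>q (A (\<epsilon> k) x)\<bar> \<le> B" if "x \<in> prism e" for x k
    proof -
      have "proj x \<in> e" "0 \<le> (n \<bullet> x - b + 1/2) * \<epsilon> k" "(n \<bullet> x - b + 1/2) * \<epsilon> k \<le> 1"
      proof -
        have s: "0 \<le> n \<bullet> x - b + 1/2" "n \<bullet> x - b + 1/2 \<le> 1" "proj x \<in> e"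
          using that by (auto simp: prism_eq abs_if split: if_splits)
        then show "proj x \<in> e" "0 \<le> (n \<bullet> x - b + 1/2) * \<epsilon> k" "(n \<bullet> x - b + 1/2) * \<epsilon> k \<le> 1"
          using mult_nonneg_nonneg[OF s(1), of "\<epsilon> k"] mult_le_one[OF s(2), of "\<epsilon> k"] \<epsilon>[of k] by auto
      qed
      then have "A (\<epsilon> k) x \<in> W" unfolding W_def A_def
        by (intro image_eqI[of _ _ "(proj x, (n \<bullet> x - b + 1/2) * \<epsilon> k)"]) auto
      then show ?thesis by (rule B)
    qed
    then show "AE x in lborel. norm (indicator (prism e) x *\<^sub>R q (A (\<epsilon> k) x)) \<le> indicator (prism e) x *\<^sub>R B" for k
      by (intro AE_I2) (auto simp: indicator_def)
  qed
  have lim3: "(\<lambda>k. B * h * m * (1 - (1 - \<epsilon> k) ^ CARD('d))) \<longlonglongrightarrow> 0"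
    by (auto intro!: tendsto_eq_intros \<epsilon>0)
  have "(\<lambda>k. (\<Phi> 1 - \<Phi> (1 - \<epsilon> k)) / \<epsilon> k - h * (LINT x:prism e|lborel. q (A (\<epsilon> k) x))) \<longlonglongrightarrow> D - h * (LINT x:prism e|lborel. q (proj x))"
    by (intro tendsto_intros lim1 lim2)
  moreover have "(\<lambda>k. (\<Phi> 1 - \<Phi> (1 - \<epsilon> k)) / \<epsilon> k - h * (LINT x:prism e|lborel. q (A (\<epsilon> k) x))) \<longlonglongrightarrow> 0"
    by (rule Lim_null_comparison[OF _ lim3]) (use step \<epsilon> in auto)
  ultimately have "D - h * (LINT x:prism e|lborel. q (proj x)) = 0" by (rule LIMSEQ_unique)
  then show ?thesis using integral_facet_measure[OF qm] by simp
qed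

section \<open>Affine functions on facets\<close>

lemma linear_dot_normal: "linear (dot_normal g)"
  by (rule linearI)
     (simp_all add: dot_normal_def algebra_simps sum.distrib scaleR_conv_of_real[where 'a = complex] sum_distrib_left)

lemmas dot_normal_right_simps =
  linear_add[OF linear_dot_normal] linear_diff[OF linear_dot_normal] linear_cmul[OF linear_dot_normal, unfolded scaleR_conv_of_real[where 'a = complex]]
  linear_0[OF linear_dot_normal] linear_sum[OF linear_dot_normal]

lemma continuous_on_dot_normal [continuous_intros]:
  "continuous_on S f \<Longrightarrow> continuous_on S (\<lambda>x. dot_normal g (f x))"
  unfolding dot_normal_def by (intro continuous_intros)

lemma (in flat_facet) convex_prism: "convex e \<Longrightarrow> convex (prism e)"
proof -
  assume e: "convex e"
  have "prism e = (\<lambda>(y, s). y + s *\<^sub>R n) ` (e \<times> {-1/2..1/2})" by (rule prism_image)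
  moreover have "linear (\<lambda>(y, s). y + s *\<^sub>R n)" by (rule linearI) (auto simp: algebra_simps)
  ultimately show ?thesis using e by (metis convex_linear_image convex_Times convex_real_interval(5))
qed

text \<open>The inverse inequality applied on the prism over \<open>e\<close>, to an affine function that is constant in the
  normal direction.\<close>

lemma (in flat_facet) affine_difference_le_facet_integral:
  fixes g :: "complex^'d" and a :: complex
  assumes "convex e" and x: "x \<in> e" and y: "y \<in> e"
  shows "(norm (dot_normal g x - dot_normal g y))\<^sup>2 * measure (facet_measure e) UNIV
    \<le> 4 * (2 ^ (CARD('d) + 3) + 2) * (LINT z|facet_measure e. (norm (dot_normal g z + a))\<^sup>2)"
proof -
  let ?J = "\<lambda>z. dot_normal g z + a"
  let ?C = "2 ^ (CARD('d) + 3) + 2 :: real"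
  have contJ: "continuous_on UNIV ?J" by (intro continuous_intros)
  have pm: "measure lborel (prism e) * (norm (?J x))\<^sup>2 \<le> ?C * (LINT z|facet_measure e. (norm (?J z))\<^sup>2)" if "x \<in> e" for x
  proof -
    have "x \<in> prism e" using that by (simp add: prism_eq proj_id in_hyperplane)
    moreover have "?J (proj ((1/2) *\<^sub>R (u + v))) = (?J (proj u) + ?J (proj v)) / 2" for u v
    proof -
      have "proj ((1/2) *\<^sub>R (u + v)) = (1/2) *\<^sub>R (proj u + proj v)"
        by (simp add: proj_def vec_eq_iff inner_add_right field_simps)
      then show ?thesis by (simp add: dot_normal_right_simps field_simps)
    qed
    ultimately have "measure lborel (prism e) * (norm (?J (proj x)))\<^sup>2 \<le> ?C * (LINT z:prism e|lborel. (norm (?J (proj z)))\<^sup>2)"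
      by (intro affine_norm_sq_le_integral convex_prism assms compact_prism)
         (auto intro!: continuous_intros proj_continuous)
    also have "(LINT z:prism e|lborel. (norm (?J (proj z)))\<^sup>2) = (LINT z|facet_measure e. (norm (?J z))\<^sup>2)"
      by (rule integral_facet_measure[symmetric]) (intro borel_measurable_continuous_onI continuous_intros)
    finally show ?thesis using that by (simp add: proj_id)
  qed
  have "(norm (dot_normal g x - dot_normal g y))\<^sup>2 \<le> (norm (?J x) + norm (?J y))\<^sup>2"
    using norm_triangle_ineq4[of "?J x" "?J y"] by (intro power_mono) auto
  also have "\<dots> \<le> 2 * (norm (?J x))\<^sup>2 + 2 * (norm (?J y))\<^sup>2"
    using sum_squares_bound[of "norm (?J x)" "norm (?J y)"] by (simp add: power2_sum)
  finally have "(norm (dot_normal g x - dot_normal g y))\<^sup>2 * measure lborel (prism e)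
      \<le> (2 * (norm (?J x))\<^sup>2 + 2 * (norm (?J y))\<^sup>2) * measure lborel (prism e)"
    by (intro mult_right_mono) auto
  then show ?thesis using pm[OF x] pm[OF y] by (simp add: measure_facet_measure algebra_simps)
qed

section \<open>Simplices\<close>

lemma unit_normal_unique:
  fixes n m :: "'a::real_inner"
  assumes n: "norm n = 1" and m: "norm m = 1" and sub: "{x. n \<bullet> x = b} \<subseteq> {x. m \<bullet> x = b'}"
  shows "m = n \<and> b' = b \<or> m = - n \<and> b' = - b"
proof -
  have nn: "n \<bullet> n = 1" "m \<bullet> m = 1" using n m by (auto simp: norm_eq_1)
  have z: "m \<bullet> (b *\<^sub>R n + z - (n \<bullet> z) *\<^sub>R n) = b'" for z
  proof -
    have "b *\<^sub>R n + z - (n \<bullet> z) *\<^sub>R n \<in> {x. n \<bullet> x = b}" using nn by (simp add: inner_add_right inner_diff_right)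
    then show ?thesis using sub by blast
  qed
  from z[of 0] have b': "b * (m \<bullet> n) = b'" by simp
  from b' z[of "m"] have "1 = (n \<bullet> m) * (m \<bullet> n)"
    using nn by (simp add: inner_add_right inner_diff_right)
  then have sq: "(m \<bullet> n)\<^sup>2 = 1" by (simp add: inner_commute power2_eq_square)
  have "(norm (m - (m \<bullet> n) *\<^sub>R n))\<^sup>2 = 1 - (m \<bullet> n)\<^sup>2"
    unfolding power2_norm_eq_inner using nn by (simp add: inner_diff inner_commute power2_eq_square algebra_simps)
  then have "m = (m \<bullet> n) *\<^sub>R n" using sq by simp
  moreover have "m \<bullet> n = 1 \<or> m \<bullet> n = -1" using sq by (simp add: power2_eq_1_iff)
  ultimately show ?thesis using b' by auto
qed

text \<open>The facets of a simplex are indexed by the opposite vertices.\<close>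

locale full_simplex =
  fixes K :: "(real^'d) set" and C :: "(real^'d) set"
  assumes indep: "\<not> affine_dependent C" and card: "card C = CARD('d) + 1" and K: "K = convex hull C"
begin

definition opp :: "real^'d \<Rightarrow> (real^'d) set" where "opp c = convex hull (C - {c})"

lemma finC: "finite C" using indep by (rule aff_independent_finite)

lemma compact_K: "compact K" unfolding K using finC by (simp add: finite_imp_compact compact_convex_hull)

lemma convex_K: "convex K" unfolding K by simp

lemma vertex_in: "c \<in> C \<Longrightarrow> c \<in> K" unfolding K by (simp add: hull_inc)

lemma aff_dim_C: "aff_dim C = int CARD('d)"
  using aff_dim_affine_independent[OF indep] card by simp

lemma hull_C: "affine hull C = UNIV"
  using aff_dim_C aff_dim_eq_full[of C] by simp

lemma aff_dim_K: "aff_dim K = int CARD('d)" unfolding K aff_dim_convex_hull by (rule aff_dim_C)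

lemma interior_K: "interior K \<noteq> {}"
proof -
  have "affine hull K = UNIV" using aff_dim_K aff_dim_eq_full[of K] by simp
  then have "interior K = rel_interior K" "K \<noteq> {}" using rel_interior_interior[of K] by auto
  then show ?thesis using rel_interior_eq_empty[OF convex_K] by simp
qed

lemma closure_interior_K: "closure (interior K) = K"
  using convex_closure_interior[OF convex_K interior_K] compact_K by (simp add: compact_imp_closed)

lemma measure_K: "measure lborel K > 0"
proof -
  have "emeasure lborel K \<noteq> 0"
  proof
    assume "emeasure lborel K = 0"
    then have "K \<in> null_sets lborel" using compact_K by (auto simp: borel_compact)
    then have "negligible K" by (simp add: negligible_iff_null_sets null_sets_completionI)
    then show False using negligible_subset[OF _ interior_subset] open_not_negligible[OF open_interior interior_K] by blast
  qed
  then show ?thesis using emeasure_compact_finite[OF compact_K]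
    by (simp add: measure_def enn2real_positive_iff top.not_eq_extremum zero_less_iff_neq_zero)
qed

lemma card_ge: "2 \<le> card C" using card by (simp add: Suc_leI)

lemma facet_iff: "e facet_of K \<longleftrightarrow> (\<exists>c\<in>C. e = opp c)"
  unfolding K opp_def facet_of_convex_hull_affine_independent_alt[OF indep] using card_ge by auto

lemma vertex_notin: "c \<in> C \<Longrightarrow> c \<notin> affine hull (C - {c})"
  using indep by (auto simp: affine_dependent_def)

lemma vertex_in_opp: "c \<in> C \<Longrightarrow> c' \<in> C \<Longrightarrow> c \<noteq> c' \<Longrightarrow> c \<in> opp c'"
  by (simp add: opp_def hull_inc)

lemma opp_subset: "opp c \<subseteq> K" unfolding opp_def K by (rule hull_mono) auto

lemma inj_opp: "inj_on opp C"
proof (rule inj_onI)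
  fix c c' assume c: "c \<in> C" "c' \<in> C" "opp c = opp c'"
  show "c = c'"
  proof (rule ccontr)
    assume "c \<noteq> c'"
    then have "c \<in> opp c" using vertex_in_opp c by metis
    then show False using vertex_notin[OF c(1)] convex_hull_subset_affine_hull unfolding opp_def by blast
  qed
qed

lemma facets_eq: "{e. e facet_of K} = opp ` C" using facet_iff by auto

lemma compact_opp: "compact (opp c)"
  unfolding opp_def using finC by (simp add: finite_imp_compact compact_convex_hull)

lemma convex_opp: "convex (opp c)" by (simp add: opp_def)

lemma hull_opp: "affine hull (opp c) = affine hull (C - {c})" by (simp add: opp_def)

lemma hyperplane_exists:
  assumes c: "c \<in> C"
  shows "\<exists>n b. norm n = 1 \<and> affine hull (opp c) = {x. n \<bullet> x = b} \<and> n \<bullet> c < b"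
proof -
  have "\<not> affine_dependent (C - {c})" using indep affine_dependent_subset by blast
  then have "aff_dim (opp c) = int (card (C - {c})) - 1"
    unfolding opp_def aff_dim_convex_hull using aff_dim_affine_independent by force
  also have "\<dots> = int DIM(real^'d) - 1" using c finC card by simp
  finally obtain a b where ab: "a \<noteq> 0" "affine hull (opp c) = {x. a \<bullet> x = b}"
    using aff_dim_eq_hyperplane[of "opp c"] by auto
  have ne: "a \<bullet> c \<noteq> b" using vertex_notin[OF c] ab(2) by (auto simp: hull_opp)
  define s where "s = (if a \<bullet> c < b then 1 else -1) / norm a"
  have s: "s \<noteq> 0" "\<bar>s\<bar> = 1 / norm a" using ab by (auto simp: s_def)
  have "norm (s *\<^sub>R a) = 1" using s ab by simp
  moreover have "affine hull (opp c) = {x. (s *\<^sub>R a) \<bullet> x = s * b}" using ab s by simp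
  moreover have "(s *\<^sub>R a) \<bullet> c < s * b" using ne ab(1) by (auto simp: s_def divide_strict_right_mono)
  ultimately show ?thesis by blast
qed

lemma K_below:
  assumes "c \<in> C" "affine hull (opp c) = {x. n \<bullet> x = b}" "n \<bullet> c < b" "x \<in> K"
  shows "n \<bullet> x \<le> b"
proof -
  have "C \<subseteq> {x. n \<bullet> x \<le> b}"
  proof
    fix c' assume "c' \<in> C"
    then show "c' \<in> {x. n \<bullet> x \<le> b}"
      using assms vertex_in_opp[of c' c] hull_inc[of c' "opp c" affine] by (cases "c' = c") auto
  qed
  then show ?thesis using hull_minimal[of C "{x. n \<bullet> x \<le> b}" convex] assms(4) convex_halfspace_le unfolding K by blast
qed

lemma facet_normal_props:
  assumes c: "c \<in> C"
  shows "norm (facet_normal K (opp c)) = 1"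
    and "\<exists>b. affine hull (opp c) = {x. facet_normal K (opp c) \<bullet> x = b} \<and> facet_normal K (opp c) \<bullet> c < b"
proof -
  obtain n b where n: "norm n = 1" "affine hull (opp c) = {x. n \<bullet> x = b}" "n \<bullet> c < b"
    using hyperplane_exists[OF c] by blast
  have "facet_normal K (opp c) = n"
    unfolding facet_normal_def
  proof (rule the_equality)
    show "norm n = 1 \<and> (\<exists>b. opp c \<subseteq> {x. n \<bullet> x = b} \<and> K \<subseteq> {x. n \<bullet> x \<le> b})"
      using n K_below[OF c n(2,3)] hull_subset[of "opp c" affine] by (intro conjI exI[of _ b]) auto
  next
    fix m assume "norm m = 1 \<and> (\<exists>b. opp c \<subseteq> {x. m \<bullet> x = b} \<and> K \<subseteq> {x. m \<bullet> x \<le> b})"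
    then obtain b' where m: "norm m = 1" "opp c \<subseteq> {x. m \<bullet> x = b'}" "K \<subseteq> {x. m \<bullet> x \<le> b'}" by auto
    have "{x. n \<bullet> x = b} \<subseteq> {x. m \<bullet> x = b'}"
      using m(2) hull_minimal[of "opp c" "{x. m \<bullet> x = b'}" affine] n(2) affine_hyperplane by blast
    then have "m = n \<and> b' = b \<or> m = - n \<and> b' = - b" by (rule unit_normal_unique[OF n(1) m(1)])
    then show "m = n" using m(3) vertex_in[OF c] n(3) by auto
  qed
  then show "norm (facet_normal K (opp c)) = 1"
    and "\<exists>b. affine hull (opp c) = {x. facet_normal K (opp c) \<bullet> x = b} \<and> facet_normal K (opp c) \<bullet> c < b"
    using n by auto
qed

definition offset :: "real^'d \<Rightarrow> real" where
  "offset c = (SOME b. affine hull (opp c) = {x. facet_normal K (opp c) \<bullet> x = b} \<and> facet_normal K (opp c) \<bullet> c < b)"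

definition height :: "real^'d \<Rightarrow> real" where "height c = offset c - facet_normal K (opp c) \<bullet> c"

lemma offset_props:
  assumes "c \<in> C"
  shows "affine hull (opp c) = {x. facet_normal K (opp c) \<bullet> x = offset c}" and "height c > 0"
  using someI_ex[OF facet_normal_props(2)[OF assms]] by (auto simp: offset_def height_def)

lemma flat: "c \<in> C \<Longrightarrow> flat_facet (opp c) (facet_normal K (opp c)) (offset c)"
  by (unfold_locales) (simp_all add: facet_normal_props offset_props compact_opp)

lemma normal_le_offset: "c \<in> C \<Longrightarrow> x \<in> K \<Longrightarrow> facet_normal K (opp c) \<bullet> x \<le> offset c"
  using K_below[OF _ offset_props(1)] offset_props(2) by (simp add: height_def)

lemma normal_eq_offset: "c \<in> C \<Longrightarrow> x \<in> opp c \<Longrightarrow> facet_normal K (opp c) \<bullet> x = offset c"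
  using flat_facet.in_hyperplane[OF flat] .

text \<open>The signed distance to the hyperplane of a facet is affine and vanishes at all vertices but one; hence it is
  a multiple of a barycentric coordinate.\<close>

lemma offset_minus_normal:
  assumes c: "c \<in> C" and \<mu>: "sum \<mu> C = 1" "(\<Sum>c\<in>C. \<mu> c *\<^sub>R c) = p"
  shows "offset c - facet_normal K (opp c) \<bullet> p = \<mu> c * height c"
proof -
  have "facet_normal K (opp c) \<bullet> p = (\<Sum>c'\<in>C. \<mu> c' * (facet_normal K (opp c) \<bullet> c'))"
    by (simp add: \<mu>(2)[symmetric] inner_sum_right)
  also have "\<dots> = (\<Sum>c'\<in>C. \<mu> c' * offset c - (if c' = c then \<mu> c * height c else 0))"
    using normal_eq_offset[OF c] vertex_in_opp[OF _ c] by (intro sum.cong) (auto simp: height_def algebra_simps)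
  also have "\<dots> = offset c - \<mu> c * height c"
    using c finC \<mu>(1) by (simp add: sum_subtractf sum_distrib_right[symmetric])
  finally show ?thesis by simp
qed

lemma K_cone: "c \<in> C \<Longrightarrow> K = convex hull (insert c (opp c))"
  unfolding K opp_def by (metis hull_insert insert_Diff)

text \<open>The divergence theorem for the field \<open>(x - c) |w|\<^sup>2\<close>, whose flux vanishes on all facets through \<open>c\<close>.\<close>

lemma cone_identity:
  fixes g :: "complex^'d" and a :: complex
  assumes dim: "CARD('d) = 2 \<or> CARD('d) = 3" and c: "c \<in> C"
  defines "w \<equiv> \<lambda>x. dot_normal g x + a"
  shows "(LINT x:K|lborel. CARD('d) * (norm (w x))\<^sup>2 + 2 * Re (w x * cnj (w x - w c)))
    = height c * (LINT x|facet_measure (opp c). (norm (w x))\<^sup>2)"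
proof -
  interpret flat_facet "opp c" "facet_normal K (opp c)" "offset c" by (rule flat[OF c])
  let ?d = "CARD('d)"
  have cw: "continuous_on UNIV w" unfolding w_def by (intro continuous_intros)
  define I0 where "I0 = (LINT x:K|lborel. (norm (w c))\<^sup>2)"
  define I1 where "I1 = (LINT x:K|lborel. Re (w x * cnj (w c)))"
  define I2 where "I2 = (LINT x:K|lborel. (norm (w x))\<^sup>2)"
  have i0: "set_integrable lborel K (\<lambda>x. (norm (w c))\<^sup>2)"
    and i1: "set_integrable lborel K (\<lambda>x. Re (w x * cnj (w c)))"
    and i2: "set_integrable lborel K (\<lambda>x. (norm (w x))\<^sup>2)"
    by (intro set_integrable_lborel_continuous compact_K continuous_intros cw)+
  have \<Phi>: "(LINT x:K|lborel. (norm (w (c + r *\<^sub>R (x - c))))\<^sup>2) = (1 - r)\<^sup>2 * I0 + 2 * r * (1 - r) * I1 + r\<^sup>2 * I2" for r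
  proof -
    have pointwise: "(norm (w (c + r *\<^sub>R (x - c))))\<^sup>2 = (1 - r)\<^sup>2 * (norm (w c))\<^sup>2 + 2 * r * (1 - r) * Re (w x * cnj (w c)) + r\<^sup>2 * (norm (w x))\<^sup>2" for x
    proof -
      have "w (c + r *\<^sub>R (x - c)) = of_real (1 - r) * w c + of_real r * w x"
        by (simp add: w_def dot_normal_right_simps algebra_simps)
      then show ?thesis
        by (simp only: cmod_power2 plus_complex.sel times_complex.sel Re_complex_of_real Im_complex_of_real
            complex_cnj) (simp add: field_simps power2_eq_square)
    qed
    have "(LINT x:K|lborel. (norm (w (c + r *\<^sub>R (x - c))))\<^sup>2)
      = (LINT x:K|lborel. (1 - r)\<^sup>2 * (norm (w c))\<^sup>2 + 2 * r * (1 - r) * Re (w x * cnj (w c)) + r\<^sup>2 * (norm (w x))\<^sup>2)"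
      by (simp only: pointwise)
    also have "\<dots> = (LINT x:K|lborel. (1 - r)\<^sup>2 * (norm (w c))\<^sup>2 + 2 * r * (1 - r) * Re (w x * cnj (w c)))
      + (LINT x:K|lborel. r\<^sup>2 * (norm (w x))\<^sup>2)"
      using i0 i1 i2 by (intro set_integral_add set_integrable_mult_right) auto
    also have "(LINT x:K|lborel. (1 - r)\<^sup>2 * (norm (w c))\<^sup>2 + 2 * r * (1 - r) * Re (w x * cnj (w c)))
      = (LINT x:K|lborel. (1 - r)\<^sup>2 * (norm (w c))\<^sup>2) + (LINT x:K|lborel. 2 * r * (1 - r) * Re (w x * cnj (w c)))"
      using i0 i1 by (intro set_integral_add set_integrable_mult_right) auto
    finally show ?thesis unfolding I0_def I1_def I2_def by (simp only: set_integral_mult_right)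
  qed
  have "((\<lambda>r. r ^ ?d * (LINT x:K|lborel. (norm (w (c + r *\<^sub>R (x - c))))\<^sup>2)) has_real_derivative (?d * I2 + 2 * I2 - 2 * I1)) (at 1)"
    unfolding \<Phi> by (auto intro!: derivative_eq_intros simp: algebra_simps)
  from cone_surface_integral[OF dim convex_opp _ offset_props(2)[OF c] K_cone[OF c] _ this]
  have "?d * I2 + 2 * I2 - 2 * I1 = height c * (LINT x|facet_measure (opp c). (norm (w x))\<^sup>2)"
    using cw by (simp add: height_def continuous_intros)
  moreover have "(LINT x:K|lborel. ?d * (norm (w x))\<^sup>2 + 2 * Re (w x * cnj (w x - w c))) = ?d * I2 + 2 * I2 - 2 * I1"
  proof -
    have "?d * (norm (w x))\<^sup>2 + 2 * Re (w x * cnj (w x - w c)) = (?d + 2) * (norm (w x))\<^sup>2 + (- 2) * Re (w x * cnj (w c))" for x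
      by (simp only: cmod_power2) (simp add: power2_eq_square, algebra)
    then have "(LINT x:K|lborel. ?d * (norm (w x))\<^sup>2 + 2 * Re (w x * cnj (w x - w c)))
      = (LINT x:K|lborel. (?d + 2) * (norm (w x))\<^sup>2 + (- 2) * Re (w x * cnj (w c)))" by simp
    also have "\<dots> = (LINT x:K|lborel. (?d + 2) * (norm (w x))\<^sup>2) + (LINT x:K|lborel. (- 2) * Re (w x * cnj (w c)))"
      using i1 i2 by (intro set_integral_add set_integrable_mult_right) auto
    also have "\<dots> = (?d + 2) * I2 + (- 2) * I1" unfolding I1_def I2_def by (simp only: set_integral_mult_right)
    finally show ?thesis by (simp add: algebra_simps)
  qed
  ultimately show ?thesis by simp
qed

lemma volume_eq:
  assumes dim: "CARD('d) = 2 \<or> CARD('d) = 3" and c: "c \<in> C"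
  shows "CARD('d) * measure lborel K = height c * measure (facet_measure (opp c)) UNIV"
  using cone_identity[OF dim c, of 0 1] compact_K flat_facet.space_facet_measure[OF flat[OF c]]
  by (simp add: dot_normal_def set_lebesgue_integral_def borel_compact emeasure_compact_finite mult.commute)

text \<open>The divergence theorem for the field \<open>(x - p) |w|\<^sup>2\<close>.  Both sides are affine in \<open>p\<close> and agree when \<open>p\<close> is a
  vertex, and the vertices of a simplex affinely span the space.\<close>

lemma divergence_identity:
  fixes g :: "complex^'d" and a :: complex
  assumes dim: "CARD('d) = 2 \<or> CARD('d) = 3"
  defines "w \<equiv> \<lambda>x. dot_normal g x + a"
  shows "(LINT x:K|lborel. CARD('d) * (norm (w x))\<^sup>2 + 2 * Re (w x * cnj (dot_normal g (x - p))))
    = (\<Sum>c\<in>C. (offset c - facet_normal K (opp c) \<bullet> p) * (LINT x|facet_measure (opp c). (norm (w x))\<^sup>2))"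
proof -
  have "p \<in> affine hull C" by (simp add: hull_C)
  then obtain \<mu> where \<mu>: "sum \<mu> C = 1" "(\<Sum>c\<in>C. \<mu> c *\<^sub>R c) = p"
    unfolding affine_hull_finite[OF finC] by auto
  have cw: "continuous_on UNIV w" unfolding w_def by (intro continuous_intros)
  let ?f = "\<lambda>c x. CARD('d) * (norm (w x))\<^sup>2 + 2 * Re (w x * cnj (w x - w c))"
  have wsum: "(\<Sum>c\<in>C. of_real (\<mu> c) * (w x - w c)) = dot_normal g (x - p)" for x
  proof -
    have "(\<Sum>c\<in>C. of_real (\<mu> c) * (w x - w c)) = (\<Sum>c\<in>C. \<mu> c *\<^sub>R dot_normal g x - \<mu> c *\<^sub>R dot_normal g c)"
      by (simp add: w_def scaleR_conv_of_real[where 'a = complex] algebra_simps)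
    also have "\<dots> = sum \<mu> C *\<^sub>R dot_normal g x - (\<Sum>c\<in>C. \<mu> c *\<^sub>R dot_normal g c)"
      by (simp only: sum_subtractf scaleR_left.sum)
    also have "(\<Sum>c\<in>C. \<mu> c *\<^sub>R dot_normal g c) = dot_normal g p"
      by (simp add: \<mu>(2)[symmetric] dot_normal_right_simps scaleR_conv_of_real[where 'a = complex])
    finally show ?thesis by (simp add: \<mu> dot_normal_right_simps)
  qed
  have pt: "CARD('d) * (norm (w x))\<^sup>2 + 2 * Re (w x * cnj (dot_normal g (x - p))) = (\<Sum>c\<in>C. \<mu> c * ?f c x)" for x
  proof -
    have "(\<Sum>c\<in>C. \<mu> c * ?f c x) = (\<Sum>c\<in>C. \<mu> c * (CARD('d) * (norm (w x))\<^sup>2)) + (\<Sum>c\<in>C. 2 * Re (w x * cnj (of_real (\<mu> c) * (w x - w c))))"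
      by (simp add: sum.distrib[symmetric] algebra_simps)
    also have "(\<Sum>c\<in>C. \<mu> c * (CARD('d) * (norm (w x))\<^sup>2)) = CARD('d) * (norm (w x))\<^sup>2"
      by (simp add: sum_distrib_right[symmetric] \<mu>)
    also have "(\<Sum>c\<in>C. 2 * Re (w x * cnj (of_real (\<mu> c) * (w x - w c)))) = 2 * Re (w x * cnj (\<Sum>c\<in>C. of_real (\<mu> c) * (w x - w c)))"
      by (simp only: cnj_sum sum_distrib_left Re_sum)
    finally show ?thesis by (simp only: wsum)
  qed
  have int: "set_integrable lborel K (\<lambda>x. \<mu> c * ?f c x)" for c
    by (intro set_integrable_lborel_continuous compact_K continuous_intros cw)
  note hs = offset_minus_normal[OF _ \<mu>]
  have "(LINT x:K|lborel. CARD('d) * (norm (w x))\<^sup>2 + 2 * Re (w x * cnj (dot_normal g (x - p))))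
      = (LINT x:K|lborel. (\<Sum>c\<in>C. \<mu> c * ?f c x))" by (simp only: pt)
  also have "\<dots> = (\<Sum>c\<in>C. (LINT x:K|lborel. \<mu> c * ?f c x))"
    using int unfolding set_lebesgue_integral_def set_integrable_def
    by (simp only: scaleR_sum_right) (rule Bochner_Integration.integral_sum)
  also have "\<dots> = (\<Sum>c\<in>C. \<mu> c * (LINT x:K|lborel. ?f c x))" by (simp only: set_integral_mult_right)
  also have "\<dots> = (\<Sum>c\<in>C. (offset c - facet_normal K (opp c) \<bullet> p) * (LINT x|facet_measure (opp c). (norm (w x))\<^sup>2))"
    using cone_identity[OF dim, of _ g a] hs unfolding w_def by (intro sum.cong) auto
  finally show ?thesis .
qed

lemma norm_sq_le_integral:
  fixes g :: "complex^'d" and a :: complex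
  assumes "x \<in> K"
  shows "measure lborel K * (norm (dot_normal g x + a))\<^sup>2 \<le> (2 ^ (CARD('d) + 3) + 2) * (LINT x:K|lborel. (norm (dot_normal g x + a))\<^sup>2)"
  by (rule affine_norm_sq_le_integral[OF convex_K compact_K assms])
     (auto intro!: continuous_intros simp: dot_normal_right_simps field_simps)

text \<open>The inverse inequality on \<open>K\<close> bounds the function pointwise, and by \<open>volume_eq\<close> the facet has area \<open>d |K|\<close> divided by
  the height.\<close>

lemma trace_inequality:
  fixes g :: "complex^'d" and a :: complex
  assumes dim: "CARD('d) = 2 \<or> CARD('d) = 3" and c: "c \<in> C"
  shows "(LINT x|facet_measure (opp c). (norm (dot_normal g x + a))\<^sup>2)
    \<le> CARD('d) * (2 ^ (CARD('d) + 3) + 2) / height c * (LINT x:K|lborel. (norm (dot_normal g x + a))\<^sup>2)"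
proof -
  interpret flat_facet "opp c" "facet_normal K (opp c)" "offset c" by (rule flat[OF c])
  let ?w = "\<lambda>x. dot_normal g x + a"
  let ?M = "(2 ^ (CARD('d) + 3) + 2) * (LINT x:K|lborel. (norm (?w x))\<^sup>2) / measure lborel K"
  have "(LINT x|facet_measure (opp c). (norm (?w x))\<^sup>2) \<le> (LINT x|facet_measure (opp c). ?M)"
  proof (rule integral_mono_AE)
    show "integrable (facet_measure (opp c)) (\<lambda>x. (norm (?w x))\<^sup>2)"
      by (intro integrable_facet_measure_continuous continuous_intros)
    show "integrable (facet_measure (opp c)) (\<lambda>x. ?M)"
      by (intro integrable_facet_measure_continuous continuous_intros)
    show "AE x in facet_measure (opp c). (norm (?w x))\<^sup>2 \<le> ?M"
      using AE_facet_measure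
    proof eventually_elim
      case (elim x)
      then have "x \<in> K" using opp_subset by blast
      then show ?case using norm_sq_le_integral[of x g a] measure_K by (simp add: field_simps)
    qed
  qed
  also have "\<dots> = measure (facet_measure (opp c)) UNIV * ?M" by (simp add: space_facet_measure)
  also have "measure (facet_measure (opp c)) UNIV = CARD('d) * measure lborel K / height c"
    using volume_eq[OF dim c] offset_props(2)[OF c] by (simp add: field_simps)
  also have "CARD('d) * measure lborel K / height c * ?M = CARD('d) * (2 ^ (CARD('d) + 3) + 2) / height c * (LINT x:K|lborel. (norm (?w x))\<^sup>2)"
    using measure_K by (simp add: distrib_left)
  finally show ?thesis .
qed

end

section \<open>Consequences of the minimal angle condition\<close>

lemma norm_le_orthonormal_coordinates:
  fixes z :: "'a::euclidean_space"
  assumes B: "finite B" "card B = DIM('a)" "pairwise orthogonal B" "\<And>u. u \<in> B \<Longrightarrow> norm u = 1"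
  shows "norm z \<le> (\<Sum>u\<in>B. \<bar>z \<bullet> u\<bar>)"
proof -
  have "0 \<notin> B" using B(4) by force
  then have "independent B" using B(3) by (simp add: pairwise_orthogonal_independent)
  then have "span B = UNIV" using card_ge_dim_independent[of B UNIV] B(2) by auto
  then have "z = (\<Sum>u\<in>B. (z \<bullet> u) *\<^sub>R u)"
    using orthonormal_basis_expand[OF B(3) B(4), of z] B(1) by simp
  then have "norm z \<le> (\<Sum>u\<in>B. norm ((z \<bullet> u) *\<^sub>R u))" using norm_sum by metis
  then show ?thesis using B(4) by simp
qed

text \<open>In the triangle spanned by \<open>p\<close> and \<open>q\<close>, the foot of the height over \<open>p\<close> is at distance at least \<open>|p|/2\<close> from one end
  of \<open>p\<close>, and the angle at that end is bounded from below.\<close>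

lemma triangle_height_ge:
  fixes p q :: "'a::real_inner"
  assumes p: "p \<noteq> 0" and \<kappa>: "0 \<le> \<kappa>" "\<kappa> < 1"
    and ang: "p \<bullet> q \<le> \<kappa> * norm p * norm q" "p \<bullet> (p - q) \<le> \<kappa> * norm p * norm (p - q)"
  shows "(1 - \<kappa>\<^sup>2) / 4 * (norm p)\<^sup>2 \<le> (norm (q - ((p \<bullet> q) / (norm p)\<^sup>2) *\<^sub>R p))\<^sup>2"
proof -
  have main: "(1 - \<kappa>\<^sup>2) / 4 * (norm p)\<^sup>2 \<le> (norm (q - ((p \<bullet> q) / (norm p)\<^sup>2) *\<^sub>R p))\<^sup>2"
    if "p \<bullet> q \<le> \<kappa> * norm p * norm q" "(p \<bullet> q) / (norm p)\<^sup>2 \<ge> 1/2" for q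
  proof -
    define t where "t = (p \<bullet> q) / (norm p)\<^sup>2"
    have pq: "p \<bullet> q = t * (norm p)\<^sup>2" using p by (simp add: t_def)
    have H: "(norm (q - t *\<^sub>R p))\<^sup>2 = (norm q)\<^sup>2 - t\<^sup>2 * (norm p)\<^sup>2"
    proof -
      have "(norm (q - t *\<^sub>R p))\<^sup>2 = q \<bullet> q - 2 * t * (p \<bullet> q) + t\<^sup>2 * (p \<bullet> p)"
        unfolding power2_norm_eq_inner by (simp add: inner_diff inner_commute power2_eq_square algebra_simps)
      then show ?thesis unfolding pq power2_norm_eq_inner by (simp add: power2_eq_square algebra_simps)
    qed
    have t: "t \<ge> 1/2" using that(2) by (simp add: t_def)
    have "t * norm p \<le> \<kappa> * norm q"
      using that(1) p unfolding pq by (simp add: power2_eq_square mult.assoc mult.left_commute)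
    then have "(t * norm p)\<^sup>2 \<le> (\<kappa> * norm q)\<^sup>2" using t by (intro power_mono) auto
    then have "(1 - \<kappa>\<^sup>2) * (t\<^sup>2 * (norm p)\<^sup>2) \<le> \<kappa>\<^sup>2 * (norm (q - t *\<^sub>R p))\<^sup>2"
      unfolding H by (simp add: power_mult_distrib algebra_simps)
    also have "\<dots> \<le> 1 * (norm (q - t *\<^sub>R p))\<^sup>2"
      using \<kappa> by (intro mult_right_mono) (auto simp: power_le_one)
    finally have 1: "(1 - \<kappa>\<^sup>2) * (t\<^sup>2 * (norm p)\<^sup>2) \<le> (norm (q - t *\<^sub>R p))\<^sup>2" by simp
    have "(1/2)\<^sup>2 \<le> t\<^sup>2" using t by (intro power_mono) auto
    then have "(1/4) * (norm p)\<^sup>2 \<le> t\<^sup>2 * (norm p)\<^sup>2" by (intro mult_right_mono) (auto simp: power2_eq_square)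
    moreover have "0 \<le> 1 - \<kappa>\<^sup>2" using \<kappa> by (simp add: power_le_one)
    ultimately have "(1 - \<kappa>\<^sup>2) * ((1/4) * (norm p)\<^sup>2) \<le> (1 - \<kappa>\<^sup>2) * (t\<^sup>2 * (norm p)\<^sup>2)" by (intro mult_left_mono)
    then show ?thesis using 1 by (simp add: t_def)
  qed
  show ?thesis
  proof (cases "(p \<bullet> q) / (norm p)\<^sup>2 \<ge> 1/2")
    case True
    then show ?thesis using main ang by blast
  next
    case False
    have t: "p \<bullet> (p - q) / (norm p)\<^sup>2 = 1 - (p \<bullet> q) / (norm p)\<^sup>2"
      using p by (simp add: inner_diff_right power2_norm_eq_inner diff_divide_distrib)
    then have "(1 - \<kappa>\<^sup>2) / 4 * (norm p)\<^sup>2 \<le> (norm ((p - q) - (p \<bullet> (p - q) / (norm p)\<^sup>2) *\<^sub>R p))\<^sup>2"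
      using False by (intro main ang) auto
    also have "(p - q) - (p \<bullet> (p - q) / (norm p)\<^sup>2) *\<^sub>R p = - (q - ((p \<bullet> q) / (norm p)\<^sup>2) *\<^sub>R p)"
      unfolding t by (simp add: algebra_simps)
    finally show ?thesis by (simp only: norm_minus_cancel)
  qed
qed

definition width_const :: "real \<Rightarrow> real" where "width_const \<kappa> = 1 + 4 / sqrt (1 - \<kappa>\<^sup>2)"

text \<open>As the normals point outward, \<open>- (n \<bullet> n')\<close> is the cosine of the dihedral angle between two facets.\<close>

locale angle_simplex = full_simplex +
  fixes \<kappa> :: real
  assumes \<kappa>: "0 \<le> \<kappa>" "\<kappa> < 1"
    and planar: "\<And>x y z. \<lbrakk>x \<in> C; y \<in> C; z \<in> C; x \<noteq> y; x \<noteq> z; y \<noteq> z\<rbrakk> \<Longrightarrow> (y - x) \<bullet> (z - x) \<le> \<kappa> * norm (y - x) * norm (z - x)"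
    and dihedral: "\<And>c c'. \<lbrakk>c \<in> C; c' \<in> C; c \<noteq> c'\<rbrakk> \<Longrightarrow> - (facet_normal K (opp c) \<bullet> facet_normal K (opp c')) \<le> \<kappa>"
    and dim: "CARD('a) = 2 \<or> CARD('a) = 3"
begin

lemma \<kappa>2: "0 < 1 - \<kappa>\<^sup>2" "1 - \<kappa>\<^sup>2 \<le> 1" using \<kappa> by (auto simp: abs_square_less_1)

lemma diameter_opp:
  assumes "c \<in> C"
  obtains x y where "x \<in> C - {c}" "y \<in> C - {c}" "x \<noteq> y" "diameter (opp c) = norm (y - x)"
    "\<And>u v. u \<in> C - {c} \<Longrightarrow> v \<in> C - {c} \<Longrightarrow> norm (u - v) \<le> norm (y - x)"
proof -
  have cd: "card (C - {c}) = CARD('a)" using assms card finC by simp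
  have two: "\<exists>u\<in>C - {c}. \<exists>v\<in>C - {c}. u \<noteq> v"
  proof (rule ccontr)
    assume "\<not> ?thesis"
    then have "card (C - {c}) \<le> 1" using card_le_Suc0_iff_eq[of "C - {c}"] finC by auto
    then show False using cd dim by auto
  qed
  then have "C - {c} \<noteq> {}" by blast
  then obtain y x where xy: "x \<in> C - {c}" "y \<in> C - {c}"
    "\<forall>u\<in>opp c. \<forall>v\<in>opp c. norm (u - v) \<le> norm (y - x)"
    using simplex_extremal_le[of "C - {c}"] finC unfolding opp_def by blast
  have sub: "C - {c} \<subseteq> opp c" unfolding opp_def by (rule hull_subset)
  have ne: "x \<noteq> y"
  proof
    assume "x = y"
    obtain u v where "u \<in> C - {c}" "v \<in> C - {c}" "u \<noteq> v" using two by blast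
    then have "norm (u - v) \<le> norm (y - x)" "norm (u - v) > 0" using xy(3) sub by auto
    then show False using \<open>x = y\<close> by simp
  qed
  have "diameter (opp c) = norm (y - x)"
  proof (rule antisym)
    show "diameter (opp c) \<le> norm (y - x)"
      by (rule diameter_le) (use xy in auto)
    show "norm (y - x) \<le> diameter (opp c)"
      using diameter_bounded_bound[of "opp c" y x] compact_imp_bounded[OF compact_opp] xy(1,2) sub by (auto simp: dist_norm)
  qed
  then show ?thesis using that xy ne sub by blast
qed

lemma diameter_pos: "c \<in> C \<Longrightarrow> diameter (opp c) > 0"
  by (erule diameter_opp) auto

lemma edge_perp: "c \<in> C \<Longrightarrow> x \<in> C - {c} \<Longrightarrow> y \<in> C - {c} \<Longrightarrow> facet_normal K (opp c) \<bullet> (y - x) = 0"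
  using normal_eq_offset[of c] vertex_in_opp by (simp add: inner_diff_right)

text \<open>A vector parallel to a facet is determined by its products with the edges of the facet, and the constant is
  uniform because the facet is not thin.  In dimension 2 there is a single edge.  In dimension 3 take the
  longest edge and the height over it as orthogonal directions; \<open>triangle_height_ge\<close> bounds that height.\<close>

lemma tangential_width:
  assumes c: "c \<in> C" and z: "facet_normal K (opp c) \<bullet> z = 0"
    and M: "\<And>x y. x \<in> C - {c} \<Longrightarrow> y \<in> C - {c} \<Longrightarrow> \<bar>z \<bullet> (y - x)\<bar> \<le> M"
  shows "norm z * diameter (opp c) \<le> width_const \<kappa> * M"
proof -
  obtain x y where xy: "x \<in> C - {c}" "y \<in> C - {c}" "x \<noteq> y" "diameter (opp c) = norm (y - x)"
    "\<And>u v. u \<in> C - {c} \<Longrightarrow> v \<in> C - {c} \<Longrightarrow> norm (u - v) \<le> norm (y - x)"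
    using diameter_opp[OF c] by metis
  let ?n = "facet_normal K (opp c)"
  define p where "p = y - x"
  define L where "L = norm p"
  have p: "p \<noteq> 0" "L > 0" using xy by (auto simp: p_def L_def)
  define e1 where "e1 = (1 / L) *\<^sub>R p"
  have e1: "norm e1 = 1" using p by (simp add: e1_def L_def)
  have n1: "norm ?n = 1" by (rule facet_normal_props(1)[OF c])
  have np: "?n \<bullet> p = 0" unfolding p_def using edge_perp[OF c] xy by blast
  have ne1: "orthogonal ?n e1" using np by (simp add: orthogonal_def e1_def)
  have neq1: "?n \<noteq> e1" using ne1 n1 by (auto simp: orthogonal_def norm_eq_1)
  have M0: "0 \<le> M" using M[OF xy(1,2)] by linarith
  have zp: "\<bar>z \<bullet> e1\<bar> \<le> M / L" using M[OF xy(1,2)] p by (simp add: e1_def p_def[symmetric] abs_mult field_simps)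
  have ws: "0 \<le> 4 / sqrt (1 - \<kappa>\<^sup>2)" using \<kappa>2 by simp
  have dimcases: "norm z * L \<le> width_const \<kappa> * M"
    using dim
  proof
    assume d2: "CARD('a) = 2"
    have "norm z \<le> (\<Sum>u\<in>{?n, e1}. \<bar>z \<bullet> u\<bar>)"
      by (rule norm_le_orthonormal_coordinates)
         (use ne1 neq1 n1 e1 d2 in \<open>auto simp: pairwise_def orthogonal_commute\<close>)
    then have "norm z \<le> M / L" using neq1 z zp by (simp add: inner_commute)
    then have "norm z * L \<le> M" using p by (simp add: field_simps)
    moreover have "0 \<le> 4 / sqrt (1 - \<kappa>\<^sup>2) * M" using ws M0 by (intro mult_nonneg_nonneg)
    ultimately show ?thesis by (simp add: width_const_def algebra_simps)
  next
    assume d3: "CARD('a) = 3"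
    have "card (C - {c} - {x, y}) = 1" using xy c card finC d3 by (simp add: card_Diff_subset)
    then obtain v where "C - {c} - {x, y} = {v}" by (auto simp: card_1_singleton_iff)
    then have v: "v \<in> C - {c}" "v \<noteq> x" "v \<noteq> y" by auto
    define q where "q = v - x"
    define t where "t = (p \<bullet> q) / (norm p)\<^sup>2"
    define p' where "p' = q - t *\<^sub>R p"
    have a1: "p \<bullet> q \<le> \<kappa> * norm p * norm q" unfolding p_def q_def using planar[of x y v] xy v by auto
    have a2: "p \<bullet> (p - q) \<le> \<kappa> * norm p * norm (p - q)"
    proof -
      have "(x - y) \<bullet> (v - y) \<le> \<kappa> * norm (x - y) * norm (v - y)" using planar[of y x v] xy v by auto
      moreover have "(x - y) \<bullet> (v - y) = p \<bullet> (p - q)" by (simp add: p_def q_def inner_diff inner_commute)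
      ultimately show ?thesis by (simp add: p_def q_def norm_minus_commute)
    qed
    have H2: "(1 - \<kappa>\<^sup>2) / 4 * L\<^sup>2 \<le> (norm p')\<^sup>2"
      unfolding L_def p'_def t_def by (rule triangle_height_ge[OF p(1) \<kappa> a1 a2])
    define s where "s = sqrt (1 - \<kappa>\<^sup>2)"
    have s: "s > 0" "s\<^sup>2 = 1 - \<kappa>\<^sup>2" using \<kappa>2 by (auto simp: s_def)
    have "(s / 2 * L)\<^sup>2 \<le> (norm p')\<^sup>2" using H2 s by (simp add: power_mult_distrib power_divide)
    then have H: "s / 2 * L \<le> norm p'" by (rule power2_le_imp_le) simp
    then have p'0: "norm p' > 0"
    proof -
      have "0 < s / 2 * L" using s p by simp
      then show ?thesis using H by linarith
    qed
    have qL: "norm q \<le> L" "norm (p - q) \<le> L"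
      using xy(5)[OF v(1) xy(1)] xy(5)[OF xy(2) v(1)] by (auto simp: p_def q_def L_def)
    have t1: "t \<le> 1"
    proof -
      have "p \<bullet> q \<le> norm p * norm q" by (rule norm_cauchy_schwarz)
      also have "\<dots> \<le> L * L" using qL by (simp add: L_def mult_left_mono)
      finally show ?thesis using p by (simp add: t_def L_def power2_eq_square)
    qed
    have t0: "0 \<le> t"
    proof -
      have "(norm (p - q))\<^sup>2 \<le> (norm p)\<^sup>2" using qL(2) by (simp add: L_def power_mono)
      then have "q \<bullet> q \<le> 2 * (p \<bullet> q)" unfolding power2_norm_eq_inner
        by (simp add: inner_diff inner_commute)
      then have "0 \<le> 2 * (p \<bullet> q)" using inner_ge_zero[of q] by linarith
      then have "0 \<le> p \<bullet> q" by simp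
      then show ?thesis using p by (simp add: t_def)
    qed
    define e2 where "e2 = (1 / norm p') *\<^sub>R p'"
    have e2: "norm e2 = 1" using p'0 by (simp add: e2_def)
    have "?n \<bullet> q = 0" unfolding q_def using edge_perp[OF c] xy v by blast
    then have o2: "orthogonal ?n e2" using np by (simp add: orthogonal_def e2_def p'_def inner_diff_right)
    have "p \<bullet> p' = 0" using p by (simp add: p'_def t_def inner_diff_right power2_norm_eq_inner)
    then have o3: "orthogonal e1 e2" by (simp add: orthogonal_def e1_def e2_def)
    have neq: "?n \<noteq> e2" "e1 \<noteq> e2" using o2 o3 n1 e1 by (auto simp: orthogonal_def norm_eq_1)
    have "norm z \<le> (\<Sum>u\<in>{?n, e1, e2}. \<bar>z \<bullet> u\<bar>)"
      by (rule norm_le_orthonormal_coordinates)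
         (use ne1 neq1 n1 e1 e2 o2 o3 neq d3 in \<open>auto simp: pairwise_def orthogonal_commute\<close>)
    then have nz: "norm z \<le> M / L + \<bar>z \<bullet> e2\<bar>" using neq neq1 z zp by (simp add: inner_commute)
    have "\<bar>z \<bullet> p'\<bar> \<le> \<bar>z \<bullet> q\<bar> + t * \<bar>z \<bullet> p\<bar>"
      using t0 abs_triangle_ineq4[of "z \<bullet> q" "t * (z \<bullet> p)"] by (simp add: p'_def inner_diff_right abs_mult)
    also have "\<dots> \<le> M + 1 * M"
      using M[OF xy(1) v(1)] M[OF xy(1,2)] t0 t1 M0
      by (intro add_mono mult_mono) (auto simp: p_def q_def)
    finally have "\<bar>z \<bullet> p'\<bar> \<le> 2 * M" by simp
    then have "\<bar>z \<bullet> e2\<bar> \<le> 2 * M / norm p'" using p'0 by (simp add: e2_def abs_mult field_simps)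
    also have "\<dots> \<le> 2 * M / (s / 2 * L)"
      using H M0 mult_pos_pos[of "s / 2" L] s p p'0 by (intro divide_left_mono mult_pos_pos) auto
    also have "\<dots> = 4 / s * M / L" by simp
    finally have "norm z \<le> (1 + 4 / s) * M / L" using nz by (simp add: algebra_simps add_divide_distrib)
    then show ?thesis using p by (simp add: width_const_def s_def field_simps)
  qed
  then show ?thesis by (simp add: xy(4) p_def L_def)
qed

text \<open>Write the foot \<open>v\<close> of the height over \<open>opp c\<close> in barycentric coordinates of that facet, and choose a vertex
  \<open>i\<close> with coordinate at least \<open>1/d\<close>.  The angle between the facets opposite \<open>c\<close> and \<open>i\<close> is then acute, so the
  lower bound on dihedral angles compares \<open>height c\<close> with \<open>height i\<close>.  On the other hand \<open>height i\<close> is seen by the component of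
  the normal of \<open>opp i\<close> along \<open>opp c\<close>, which is not small, and \<open>tangential_width\<close> compares it with the diameter.\<close>

lemma height_ge_diameter:
  assumes c: "c \<in> C"
  shows "sqrt (1 - \<kappa>\<^sup>2) * diameter (opp c) \<le> CARD('a) * width_const \<kappa> * height c"
proof -
  let ?n = "facet_normal K (opp c)"
  have n1: "?n \<bullet> ?n = 1" using facet_normal_props(1)[OF c] by (simp add: norm_eq_1)
  let ?C = "C - {c}"
  define v where "v = c + height c *\<^sub>R ?n"
  have "?n \<bullet> v = offset c" using n1 by (simp add: v_def height_def inner_add_right)
  then have "v \<in> affine hull ?C" using offset_props(1)[OF c] by (simp add: hull_opp)
  then obtain \<mu> where \<mu>: "sum \<mu> ?C = 1" "(\<Sum>i\<in>?C. \<mu> i *\<^sub>R i) = v"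
    unfolding affine_hull_finite[OF finite_Diff[OF finC]] by auto
  have cd: "card ?C = CARD('a)" using c card finC by simp
  have "\<exists>i\<in>?C. \<mu> i \<ge> 1 / CARD('a)"
  proof (rule ccontr)
    assume "\<not> ?thesis"
    then have lt: "\<And>i. i \<in> ?C \<Longrightarrow> \<mu> i < 1 / CARD('a)" by (meson not_le)
    have "?C \<noteq> {}"
    proof
      assume "?C = {}"
      then have "card ?C = 0" by (simp only: card.empty)
      then show False using cd by simp
    qed
    then have "sum \<mu> ?C < (\<Sum>i\<in>?C. 1 / CARD('a))" using finC lt by (intro sum_strict_mono) auto
    then show False using \<mu>(1) cd by simp
  qed
  then obtain i where i: "i \<in> ?C" "\<mu> i \<ge> 1 / CARD('a)" by blast
  let ?m = "facet_normal K (opp i)"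
  have iC: "i \<in> C" and ic: "i \<noteq> c" using i by auto
  have "?m \<bullet> v = (\<Sum>j\<in>?C. \<mu> j * (?m \<bullet> j))" by (simp add: \<mu>(2)[symmetric] inner_sum_right)
  also have "\<dots> = (\<Sum>j\<in>?C. \<mu> j * offset i - (if j = i then \<mu> i * height i else 0))"
    using normal_eq_offset[OF iC] vertex_in_opp[OF _ iC] by (intro sum.cong) (auto simp: height_def algebra_simps)
  also have "\<dots> = offset i - \<mu> i * height i"
    using i finC \<mu>(1) by (simp add: sum_subtractf sum_distrib_right[symmetric])
  finally have mv: "?m \<bullet> v = offset i - \<mu> i * height i" .
  have "?m \<bullet> c = offset i" using normal_eq_offset[OF iC] vertex_in_opp[OF c iC] ic by auto
  then have eq: "height c * (- (?m \<bullet> ?n)) = \<mu> i * height i" using mv by (simp add: v_def inner_add_right algebra_simps)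
  have hc: "height c > 0" and hi: "height i > 0" using offset_props(2) c iC by auto
  have \<mu>i: "\<mu> i > 0"
  proof -
    have "0 < 1 / real CARD('a)" by simp
    then show ?thesis using i(2) by linarith
  qed
  define s where "s = - (?m \<bullet> ?n)"
  have s0: "s > 0"
  proof -
    have "0 < height c * s" using mult_pos_pos[OF \<mu>i hi] eq by (simp add: s_def)
    then show ?thesis using hc by (rule zero_less_mult_pos)
  qed
  have s\<kappa>: "s \<le> \<kappa>" unfolding s_def using dihedral[OF iC c ic] .
  have hle: "height i \<le> CARD('a) * height c"
  proof -
    have "1 / CARD('a) * height i \<le> \<mu> i * height i" using i(2) hi by (intro mult_right_mono) auto
    also have "\<dots> = height c * s" using eq by (simp add: s_def)
    also have "\<dots> \<le> height c * 1" using hc s\<kappa> \<kappa> by (intro mult_left_mono) auto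
    finally show ?thesis by (simp add: field_simps)
  qed
  define t where "t = ?m - (?m \<bullet> ?n) *\<^sub>R ?n"
  have m1: "?m \<bullet> ?m = 1" using facet_normal_props(1)[OF iC] by (simp add: norm_eq_1)
  have nt: "?n \<bullet> t = 0" using n1 by (simp add: t_def inner_diff_right inner_commute)
  have t2: "(norm t)\<^sup>2 = 1 - s\<^sup>2"
    unfolding power2_norm_eq_inner t_def s_def using n1 m1
    by (simp add: inner_diff inner_commute power2_eq_square algebra_simps)
  have "s\<^sup>2 \<le> \<kappa>\<^sup>2" using s0 s\<kappa> by (intro power_mono) auto
  then have "sqrt (1 - \<kappa>\<^sup>2) \<le> norm t" using t2 by (intro real_le_lsqrt) auto
  have "\<bar>t \<bullet> (y - x)\<bar> \<le> height i" if "x \<in> ?C" "y \<in> ?C" for x y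
  proof -
    have "t \<bullet> (y - x) = ?m \<bullet> (y - x)" using edge_perp[OF c that] by (simp add: t_def inner_diff_left)
    also have "\<dots> = (if y = i then - height i else 0) - (if x = i then - height i else 0)"
      using normal_eq_offset[OF iC] vertex_in_opp[OF _ iC] that by (auto simp: inner_diff_right height_def)
    finally show ?thesis using hi by auto
  qed
  from tangential_width[OF c nt this] have "norm t * diameter (opp c) \<le> width_const \<kappa> * height i" .
  moreover have "sqrt (1 - \<kappa>\<^sup>2) * diameter (opp c) \<le> norm t * diameter (opp c)"
    using \<open>sqrt (1 - \<kappa>\<^sup>2) \<le> norm t\<close> diameter_pos[OF c] by (intro mult_right_mono) auto
  moreover have "width_const \<kappa> * height i \<le> width_const \<kappa> * (CARD('a) * height c)"
    using hle \<kappa>2 by (intro mult_left_mono) (auto simp: width_const_def)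
  ultimately show ?thesis by (simp add: mult.assoc mult.left_commute)
qed

text \<open>The tangential gradient of an affine function on a facet is read offset from differences of values
  at the vertices, and these are bounded by the mean square of the function.\<close>

lemma tangential_inverse_inequality:
  fixes g :: "complex^'a" and a :: complex
  assumes c: "c \<in> C"
  defines "n \<equiv> facet_normal K (opp c)"
  shows "(norm (g - smul_normal (dot_normal g n) n))\<^sup>2 * measure (facet_measure (opp c)) UNIV * (diameter (opp c))\<^sup>2
    \<le> 16 * (width_const \<kappa>)\<^sup>2 * (2 ^ (CARD('a) + 3) + 2) * (LINT x|facet_measure (opp c). (norm (dot_normal g x + a))\<^sup>2)"
proof -
  interpret flat_facet "opp c" n "offset c" unfolding n_def by (rule flat[OF c])
  let ?T = "g - smul_normal (dot_normal g n) n"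
  let ?e = "measure (facet_measure (opp c)) UNIV"
  let ?W = "width_const \<kappa>"
  define X where "X = 4 * (2 ^ (CARD('a) + 3) + 2) * (LINT x|facet_measure (opp c). (norm (dot_normal g x + a))\<^sup>2)"
  have epos: "?e > 0"
  proof -
    have "0 < height c * ?e" unfolding volume_eq[OF dim c, symmetric] using measure_K by simp
    then show ?thesis using offset_props(2)[OF c] by (rule zero_less_mult_pos)
  qed
  define M where "M = sqrt (X / ?e)"
  have dif: "(norm (dot_normal g x - dot_normal g y))\<^sup>2 * ?e \<le> X" if "x \<in> opp c" "y \<in> opp c" for x y
    unfolding X_def by (rule affine_difference_le_facet_integral[OF convex_opp that])
  have difM: "norm (dot_normal g x - dot_normal g y) \<le> M" if "x \<in> opp c" "y \<in> opp c" for x y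
    unfolding M_def using dif[OF that] epos by (intro real_le_rsqrt) (simp add: field_simps)
  have X0: "X \<ge> 0" unfolding X_def by (intro mult_nonneg_nonneg integral_nonneg_AE) auto
  define R where "R f = (\<chi> i. f (?T $ i))" for f :: "complex \<Rightarrow> real"
  have part: "norm (R f) * diameter (opp c) \<le> ?W * M"
    if f: "linear f" "\<And>z. \<bar>f z\<bar> \<le> norm z" for f
  proof (rule tangential_width[OF c])
    have Rz: "R f \<bullet> z = f (dot_normal g z) - f (dot_normal g n) * (n \<bullet> z)" for z
    proof -
      have "R f \<bullet> z = (\<Sum>i\<in>UNIV. f (g $ i) * z $ i - f (dot_normal g n) * (n $ i * z $ i))"
      proof -
        have "f (dot_normal g n * of_real r) = f (dot_normal g n) * r" for r
          using linear_cmul[OF f(1), of r "dot_normal g n"] by (simp add: scaleR_conv_of_real mult.commute)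
        then show ?thesis
          by (simp add: R_def inner_vec_def smul_normal_def linear_diff[OF f(1)] left_diff_distrib mult.assoc)
      qed
      also have "\<dots> = (\<Sum>i\<in>UNIV. f (g $ i) * z $ i) - f (dot_normal g n) * (n \<bullet> z)"
        by (simp add: sum_subtractf inner_vec_def sum_distrib_left)
      also have "(\<Sum>i\<in>UNIV. f (g $ i) * z $ i) = f (dot_normal g z)"
      proof -
        have "f (g $ i * of_real r) = f (g $ i) * r" for i r
          using linear_cmul[OF f(1), of r "g $ i"] by (simp add: scaleR_conv_of_real mult.commute)
        then show ?thesis by (simp add: dot_normal_def linear_sum[OF f(1)])
      qed
      finally show ?thesis .
    qed
    show "facet_normal K (opp c) \<bullet> R f = 0"
      using Rz[of n] nn by (simp add: inner_commute n_def)
    fix x y assume xy: "x \<in> C - {c}" "y \<in> C - {c}"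
    have "R f \<bullet> (y - x) = f (dot_normal g (y - x))" using Rz[of "y - x"] edge_perp[OF c xy] by (simp add: n_def)
    then show "\<bar>R f \<bullet> (y - x)\<bar> \<le> M"
      using f(2)[of "dot_normal g (y - x)"] difM[of y x] xy vertex_in_opp[OF _ c] by (force simp: dot_normal_right_simps)
  qed
  have "norm ?T \<le> norm (R Re) + norm (R Im)"
  proof -
    have "norm ?T \<le> sqrt ((norm (R Re))\<^sup>2 + (norm (R Im))\<^sup>2)"
    proof -
      have "(norm ?T)\<^sup>2 = (\<Sum>i\<in>UNIV. (norm (?T $ i))\<^sup>2)" by (simp add: norm_vec_def L2_set_def sum_nonneg)
      also have "\<dots> = (norm (R Re))\<^sup>2 + (norm (R Im))\<^sup>2"
        by (simp add: R_def norm_vec_def L2_set_def sum_nonneg cmod_power2 sum.distrib)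
      finally show ?thesis by (intro real_le_rsqrt) simp
    qed
    also have "\<dots> \<le> norm (R Re) + norm (R Im)" by (rule sqrt_sum_squares_le_sum) auto
    finally show ?thesis .
  qed
  then have "norm ?T * diameter (opp c) \<le> (norm (R Re) + norm (R Im)) * diameter (opp c)"
    using diameter_pos[OF c] by (intro mult_right_mono) auto
  also have "\<dots> \<le> 2 * ?W * M"
    using part[of Re] part[of Im]
    by (simp add: distrib_right bounded_linear.linear[OF bounded_linear_Re] bounded_linear.linear[OF bounded_linear_Im] abs_Re_le_cmod abs_Im_le_cmod)
  finally have "(norm ?T * diameter (opp c))\<^sup>2 \<le> (2 * ?W * M)\<^sup>2"
    using diameter_pos[OF c] by (intro power_mono) auto
  also have "\<dots> = 4 * ?W\<^sup>2 * X / ?e" using X0 epos by (simp add: M_def power_mult_distrib)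
  finally have "(norm ?T * diameter (opp c))\<^sup>2 * ?e \<le> 4 * ?W\<^sup>2 * X" using epos by (simp add: field_simps)
  then show ?thesis unfolding X_def by (simp add: power_mult_distrib algebra_simps)
qed

end

context full_simplex begin

text \<open>A point lies in the simplex if its barycentric coordinates are nonnegative, and these are the
  scaled distances to the facets.\<close>

lemma in_K_iff: "y \<in> K \<longleftrightarrow> (\<forall>c\<in>C. facet_normal K (opp c) \<bullet> y \<le> offset c)"
proof
  assume "y \<in> K"
  then show "\<forall>c\<in>C. facet_normal K (opp c) \<bullet> y \<le> offset c" using normal_le_offset by blast
next
  assume y: "\<forall>c\<in>C. facet_normal K (opp c) \<bullet> y \<le> offset c"
  have "y \<in> affine hull C" by (simp add: hull_C)
  then obtain \<mu> where \<mu>: "sum \<mu> C = 1" "(\<Sum>c\<in>C. \<mu> c *\<^sub>R c) = y"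
    unfolding affine_hull_finite[OF finC] by auto
  have "0 \<le> \<mu> c" if "c \<in> C" for c
    using offset_minus_normal[OF that \<mu>] y that offset_props(2)[OF that] by (smt (verit) mult_neg_pos)
  then show "y \<in> K" unfolding K convex_hull_finite[OF finC] using \<mu> by blast
qed

text \<open>At a relatively interior point of a facet all other facet inequalities are strict, so that near it
  the simplex is a half-space.\<close>

lemma local_half_ball:
  assumes c: "c \<in> C" and x: "x \<in> rel_interior (opp c)"
  shows "\<exists>r>0. \<forall>y\<in>ball x r. (facet_normal K (opp c) \<bullet> y \<le> offset c \<longrightarrow> y \<in> K)
    \<and> (facet_normal K (opp c) \<bullet> y < offset c \<longrightarrow> y \<in> interior K)"
proof -
  have "\<not> affine_dependent (C - {c})" using indep affine_dependent_subset by blast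
  then obtain u where u: "\<forall>i\<in>C - {c}. 0 < u i" "sum u (C - {c}) = 1" "(\<Sum>i\<in>C - {c}. u i *\<^sub>R i) = x"
    using x unfolding opp_def by (auto simp: rel_interior_convex_hull_explicit)
  define \<mu> where "\<mu> = u(c := 0)"
  have \<mu>: "sum \<mu> C = 1" "(\<Sum>i\<in>C. \<mu> i *\<^sub>R i) = x"
    using u(2,3) c finC by (simp_all add: sum.remove[OF finC c] \<mu>_def)
  let ?U = "\<Inter>i\<in>C - {c}. {y. facet_normal K (opp i) \<bullet> y < offset i}"
  have "open ?U" using finC by (intro open_INT ballI open_halfspace_lt) auto
  moreover have "x \<in> ?U"
  proof
    fix i assume i: "i \<in> C - {c}"
    then have "0 < \<mu> i * height i" using u(1) offset_props(2) by (simp add: \<mu>_def)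
    then show "x \<in> {y. facet_normal K (opp i) \<bullet> y < offset i}" using offset_minus_normal[OF _ \<mu>, of i] i by auto
  qed
  ultimately obtain r where r: "r > 0" "ball x r \<subseteq> ?U" by (meson openE)
  have inK: "y \<in> K" if "y \<in> ball x r" "facet_normal K (opp c) \<bullet> y \<le> offset c" for y
    unfolding in_K_iff
  proof
    fix i assume "i \<in> C"
    moreover have "y \<in> ?U" using that(1) r(2) by blast
    ultimately show "facet_normal K (opp i) \<bullet> y \<le> offset i"
      using that(2) by (cases "i = c") (auto intro: less_imp_le)
  qed
  have "y \<in> interior K" if "y \<in> ball x r" "facet_normal K (opp c) \<bullet> y < offset c" for y
  proof (rule interiorI)
    show "open (ball x r \<inter> {y. facet_normal K (opp c) \<bullet> y < offset c})" by (intro open_Int open_ball open_halfspace_lt)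
  qed (use that inK in auto)
  then show ?thesis using r(1) inK by blast
qed

end

section \<open>Meshes of a domain\<close>

definition verts :: "(real^'d) set \<Rightarrow> (real^'d) set" where "verts K = {x. x extreme_point_of K}"

lemma full_simplex_verts:
  assumes "int CARD('d) simplex (K :: (real^'d) set)"
  shows "full_simplex K (verts K)"
proof -
  obtain C where C: "\<not> affine_dependent C" "int (card C) = int CARD('d) + 1" "K = convex hull C"
    using assms by (auto simp: simplex_def)
  then have "verts K = C" by (auto simp: verts_def extreme_point_of_convex_hull_affine_independent)
  then show ?thesis using C by unfold_locales auto
qed

text \<open>For a facet \<open>e\<close> of \<open>K\<close> all points of \<open>e\<close> give the same value, so the choice is immaterial.\<close>

definition level :: "(real^'d) set \<Rightarrow> (real^'d) set \<Rightarrow> real" where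
  "level K e = facet_normal K e \<bullet> (SOME x. x \<in> e)"

locale mesh =
  fixes \<Omega> :: "(real^'d) set" and \<T> :: "(real^'d) set set"
  assumes dim: "CARD('d) = 2 \<or> CARD('d) = 3" and open_\<Omega>: "open \<Omega>" and part: "partition_of \<Omega> \<T>"
begin

lemma fin: "finite \<T>" using part by (auto simp: partition_of_def triangulation_def)

lemma full: "K \<in> \<T> \<Longrightarrow> full_simplex K (verts K)"
  using part by (auto simp: partition_of_def intro: full_simplex_verts)

lemma \<Omega>_eq: "\<Omega> = interior (\<Union>\<T>)" using part by (simp add: partition_of_def)

lemma Int_face: "K \<in> \<T> \<Longrightarrow> L \<in> \<T> \<Longrightarrow> (K \<inter> L) face_of K"
  using part by (auto simp: partition_of_def triangulation_def)

lemma facet_vertex: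
  assumes K: "K \<in> \<T>" and e: "e facet_of K"
  obtains c where "c \<in> verts K" "e = full_simplex.opp (verts K) c" "full_simplex.offset K (verts K) c = level K e"
proof -
  interpret full_simplex K "verts K" by (rule full[OF K])
  obtain c where c: "c \<in> verts K" "e = opp c" using e facet_iff by auto
  have "(SOME x. x \<in> e) \<in> e" using flat_facet.nonempty[OF flat[OF c(1)]] c(2) by (auto intro: someI_ex)
  then have "offset c = level K e" using normal_eq_offset[OF c(1)] c(2) by (simp add: level_def)
  then show ?thesis using that c by blast
qed

lemma
  assumes KT: "K \<in> \<T>" and e: "e facet_of K"
  shows flat: "flat_facet e (facet_normal K e) (level K e)"
    and below: "x \<in> K \<Longrightarrow> facet_normal K e \<bullet> x \<le> level K e"
    and facet_convex: "convex e"
proof -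
  interpret full_simplex K "verts K" by (rule full[OF KT])
  obtain c where c: "c \<in> verts K" "e = opp c" "offset c = level K e" by (rule facet_vertex[OF KT e])
  show "flat_facet e (facet_normal K e) (level K e)" using flat[OF c(1)] unfolding c(2)[symmetric] c(3) .
  show "x \<in> K \<Longrightarrow> facet_normal K e \<bullet> x \<le> level K e" using normal_le_offset[OF c(1), of x] unfolding c(2)[symmetric] c(3) .
  show "convex e" unfolding c(2) by (rule convex_opp)
qed

lemma half_ball:
  assumes "K \<in> \<T>" "e facet_of K" "x \<in> rel_interior e"
  obtains r where "r > 0" "\<And>y. y \<in> ball x r \<Longrightarrow> facet_normal K e \<bullet> y \<le> level K e \<Longrightarrow> y \<in> K"
    "\<And>y. y \<in> ball x r \<Longrightarrow> facet_normal K e \<bullet> y < level K e \<Longrightarrow> y \<in> interior K"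
proof -
  interpret full_simplex K "verts K" by (rule full[OF assms(1)])
  obtain c where c: "c \<in> verts K" "e = opp c" "offset c = level K e" by (rule facet_vertex[OF assms(1,2)])
  obtain r where "r > 0" "\<forall>y\<in>ball x r. (facet_normal K e \<bullet> y \<le> level K e \<longrightarrow> y \<in> K)
    \<and> (facet_normal K e \<bullet> y < level K e \<longrightarrow> y \<in> interior K)"
    using local_half_ball[OF c(1), of x, unfolded c(2)[symmetric] c(3), OF assms(3)] by (elim exE conjE)
  then show ?thesis by (intro that[of r]) auto
qed

lemma facet_subset: "e facet_of K \<Longrightarrow> e \<subseteq> K" by (simp add: facet_of_imp_subset)

lemma rel_interior_facet:
  assumes "K \<in> \<T>" "e facet_of K"
  shows "\<exists>x. x \<in> rel_interior e"
proof -
  have "rel_interior e \<noteq> {}"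
    using rel_interior_eq_empty[OF facet_convex[OF assms]] assms(2) by (simp add: facet_of_def)
  then show ?thesis by blast
qed

lemma aff_dim_K: "K \<in> \<T> \<Longrightarrow> aff_dim K = int CARD('d)" by (rule full_simplex.aff_dim_K[OF full])

lemma convex_K: "K \<in> \<T> \<Longrightarrow> convex K" by (rule full_simplex.convex_K[OF full])

lemma compact_K: "K \<in> \<T> \<Longrightarrow> compact K" by (rule full_simplex.compact_K[OF full])

lemma proper_face:
  assumes "K \<in> \<T>" "L \<in> \<T>" "K \<noteq> L"
  shows "aff_dim (K \<inter> L) < int CARD('d)"
proof (rule ccontr)
  assume "\<not> ?thesis"
  then have nl: "\<not> aff_dim (K \<inter> L) < aff_dim K" "\<not> aff_dim (L \<inter> K) < aff_dim L"
    unfolding Int_commute[of L K] aff_dim_K[OF assms(1)] aff_dim_K[OF assms(2)] by assumption+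
  have "K \<inter> L = K"
    using face_of_aff_dim_lt[OF convex_K[OF assms(1)] Int_face[OF assms(1,2)]] nl(1) by metis
  moreover have "L \<inter> K = L"
    using face_of_aff_dim_lt[OF convex_K[OF assms(2)] Int_face[OF assms(2,1)]] nl(2) by metis
  ultimately show False using assms(3) by blast
qed

text \<open>The intersection \<open>K \<inter> L\<close> is a proper face of \<open>K\<close> that meets the relative interior of the facet \<open>e\<close>; so it contains \<open>e\<close>,
  and by dimension it is \<open>e\<close>.\<close>

lemma shared_facet:
  assumes K: "K \<in> \<T>" and L: "L \<in> \<T>" "K \<noteq> L" and e: "e facet_of K" and x: "x \<in> rel_interior e" "x \<in> L"
  shows "K \<inter> L = e" and "e facet_of L"
proof -
  have xe: "x \<in> e" using x(1) rel_interior_subset by blast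
  then have "(K \<inter> L) \<inter> rel_interior e \<noteq> {}" using facet_subset[OF e] x by blast
  then have sub: "e \<subseteq> K \<inter> L" using subset_of_face_of[OF Int_face[OF K L(1)] facet_subset[OF e]] by blast
  have ed: "aff_dim e = int CARD('d) - 1" using e aff_dim_K[OF K] by (simp add: facet_of_def)
  have "e face_of (K \<inter> L)" using e sub by (auto simp: facet_of_def intro: face_of_subset)
  moreover have "convex (K \<inter> L)" using K L convex_K by (simp add: convex_Int)
  ultimately show eq: "K \<inter> L = e"
    using face_of_aff_dim_lt[of "K \<inter> L" e] proper_face[OF K L] ed by fastforce
  have "e face_of L" using Int_face[OF L(1) K] eq by (simp add: Int_commute)
  then show "e facet_of L" using xe ed aff_dim_K[OF L(1)] by (auto simp: facet_of_def)
qed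

text \<open>If the normals agreed, both simplices would contain a half-ball on the same side of \<open>e\<close>, while by
  \<open>shared_facet\<close> they only meet in \<open>e\<close>.\<close>

lemma opposite_normals:
  assumes K: "K \<in> \<T>" and L: "L \<in> \<T>" "K \<noteq> L" and e: "e facet_of K" "e facet_of L"
  shows "facet_normal L e = - facet_normal K e" and "level L e = - level K e"
proof -
  note k = flat[OF K e(1)] and l = flat[OF L(1) e(2)]
  have "facet_normal L e = facet_normal K e \<and> level L e = level K e \<or>
      facet_normal L e = - facet_normal K e \<and> level L e = - level K e"
    using flat_facet.hull[OF k] flat_facet.hull[OF l]
    by (intro unit_normal_unique[OF flat_facet.unit[OF k] flat_facet.unit[OF l]]) (metis order_refl)
  moreover have False if eq: "facet_normal L e = facet_normal K e" "level L e = level K e"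
  proof -
    obtain x where x: "x \<in> rel_interior e" using rel_interior_facet[OF K e(1)] by blast
    then have xe: "x \<in> e" using rel_interior_subset by blast
    obtain r where r: "r > 0" "\<And>y. y \<in> ball x r \<Longrightarrow> facet_normal K e \<bullet> y \<le> level K e \<Longrightarrow> y \<in> K"
      by (rule half_ball[OF K e(1) x]) blast
    obtain r' where r': "r' > 0" "\<And>y. y \<in> ball x r' \<Longrightarrow> facet_normal L e \<bullet> y \<le> level L e \<Longrightarrow> y \<in> L"
      by (rule half_ball[OF L(1) e(2) x]) blast
    define s where "s = min r r' / 2"
    have s: "s > 0" "s < r" "s < r'" using r r' by (auto simp: s_def)
    let ?y = "x - s *\<^sub>R facet_normal K e"
    have "facet_normal K e \<bullet> ?y = level K e - s" using flat_facet.in_hyperplane[OF k xe] flat_facet.nn[OF k] by (simp add: inner_diff_right)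
    moreover have "dist x ?y = s" using s flat_facet.unit[OF k] by (simp add: dist_norm)
    moreover have "?y \<in> K \<inter> L" using calculation s r(2)[of ?y] r'(2)[of ?y] eq by auto
    moreover have "x \<in> L" using xe facet_subset[OF e(2)] by blast
    ultimately have "?y \<in> e" using shared_facet(1)[OF K L e(1) x] by blast
    then show False using flat_facet.in_hyperplane[OF k] \<open>facet_normal K e \<bullet> ?y = level K e - s\<close> s by fastforce
  qed
  ultimately show "facet_normal L e = - facet_normal K e" and "level L e = - level K e" by (blast, blast)
qed

lemma two_elements:
  assumes "e \<in> interior_facets \<T>"
  obtains K L where "K \<in> \<T>" "L \<in> \<T>" "K \<noteq> L" "{M \<in> \<T>. e facet_of M} = {K, L}"
    "facet_normal L e = - facet_normal K e" "level L e = - level K e"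
proof -
  obtain K L where KL: "K \<in> \<T>" "L \<in> \<T>" "K \<noteq> L" "e facet_of K" "e facet_of L"
    using assms by (auto simp: interior_facets_def)
  have "M = K \<or> M = L" if M: "M \<in> \<T>" "e facet_of M" for M
  proof (rule ccontr)
    assume "\<not> ?thesis"
    then have "facet_normal M e = - facet_normal K e" "facet_normal M e = - facet_normal L e"
      using opposite_normals(1)[of K M e] opposite_normals(1)[of L M e] KL M by auto
    moreover have "facet_normal L e = - facet_normal K e" using opposite_normals(1) KL by blast
    ultimately have "facet_normal K e = - facet_normal K e" by simp
    then have "facet_normal K e = 0" by (simp add: vec_eq_iff)
    then show False using flat_facet.unit[OF flat[OF KL(1,4)]] by simp
  qed
  then have "{M \<in> \<T>. e facet_of M} = {K, L}" using KL by auto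
  then show ?thesis by (rule that[OF KL(1,2,3) _ opposite_normals[OF KL]])
qed

lemma K_closure: "K \<in> \<T> \<Longrightarrow> K \<subseteq> closure \<Omega>"
  using full_simplex.closure_interior_K[OF full] closure_mono[of "interior K" \<Omega>] interior_mono[of K "\<Union>\<T>"]
  by (auto simp: \<Omega>_eq)

lemma interior_subset_\<Omega>: "K \<in> \<T> \<Longrightarrow> interior K \<subseteq> \<Omega>"
  unfolding \<Omega>_eq by (intro interior_mono) auto

text \<open>Near a relatively interior point of an unshared facet, \<open>K\<close> is the only element: any other one containing the
  point would share the facet.  So \<open>\<Omega>\<close> is locally the half-space that \<open>K\<close> is.\<close>

lemma exterior_facet:
  assumes K: "K \<in> \<T>" and e: "e facet_of K" and ne: "e \<notin> interior_facets \<T>" and x: "x \<in> rel_interior e"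
  shows "outward_unit_normal \<Omega> x (facet_normal K e)"
proof -
  interpret flat_facet e "facet_normal K e" "level K e" by (rule flat[OF K e])
  have xe: "x \<in> e" using x rel_interior_subset by blast
  have xl: "facet_normal K e \<bullet> x = level K e" using in_hyperplane[OF xe] .
  have "x \<notin> \<Union>(\<T> - {K})"
  proof
    assume "x \<in> \<Union>(\<T> - {K})"
    then obtain L where L: "L \<in> \<T>" "K \<noteq> L" "x \<in> L" by auto
    have "e facet_of L" by (rule shared_facet(2)[OF K L(1,2) e x L(3)])
    then show False using ne K e L(1,2) unfolding interior_facets_def by blast
  qed
  moreover have "closed (\<Union>(\<T> - {K}))" using fin compact_K by (intro closed_Union) (auto intro: compact_imp_closed)
  ultimately obtain r where r: "r > 0" "ball x r \<subseteq> - \<Union>(\<T> - {K})"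
    using openE[of "- \<Union>(\<T> - {K})" x] by (auto simp: closed_def)
  obtain r' where r': "r' > 0" "\<And>y. y \<in> ball x r' \<Longrightarrow> facet_normal K e \<bullet> y < level K e \<Longrightarrow> y \<in> interior K"
    by (rule half_ball[OF K e x]) blast
  define s where "s = min r r'"
  have s: "s > 0" "ball x s \<subseteq> ball x r" "ball x s \<subseteq> ball x r'" using r r' by (auto simp: s_def)
  have inside: "y \<in> \<Omega>" if "y \<in> ball x s" "(y - x) \<bullet> facet_normal K e < 0" for y
  proof -
    have "y \<in> ball x r'" using s(3) that(1) by blast
    moreover have "facet_normal K e \<bullet> y < level K e"
      using that(2) xl by (simp add: inner_diff_left inner_diff_right inner_commute[of _ "facet_normal K e"])
    ultimately show ?thesis using r'(2) interior_subset_\<Omega>[OF K] by blast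
  qed
  have outside: "y \<notin> \<Omega>" if "y \<in> ball x s" "(y - x) \<bullet> facet_normal K e > 0" for y
  proof
    assume "y \<in> \<Omega>"
    then have "y \<in> \<Union>\<T>" using interior_subset unfolding \<Omega>_eq by blast
    then have "y \<in> K" using r(2) s(2) that(1) by blast
    then show False using below[OF K e, of y] xl that(2) by (simp add: inner_diff_left inner_diff_right inner_commute[of _ "facet_normal K e"])
  qed
  have xO: "x \<notin> \<Omega>"
  proof
    assume "x \<in> \<Omega>"
    then obtain t where t: "t > 0" "ball x t \<subseteq> \<Omega>" using open_\<Omega> by (meson open_contains_ball)
    define q where "q = min s t / 2"
    have q: "q > 0" "q < s" "q < t" using s t by (auto simp: q_def)
    let ?y = "x + q *\<^sub>R facet_normal K e"
    have "dist x ?y = q" using q unit by (simp add: dist_norm)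
    then have "?y \<in> ball x s" "?y \<in> \<Omega>" using q t(2) by auto
    moreover have "(?y - x) \<bullet> facet_normal K e > 0" using q nn by simp
    ultimately show False using outside by blast
  qed
  have "x \<in> closure \<Omega>" using K_closure[OF K] facet_subset[OF e] xe by blast
  then have fr: "x \<in> frontier \<Omega>" using xO open_\<Omega> by (simp add: frontier_def interior_open)
  have nz: "0 \<le> \<epsilon> * norm (y - x)" if "\<epsilon> > 0" for \<epsilon> :: real and y using that by simp
  show ?thesis
    unfolding outward_unit_normal_def
  proof (intro conjI fr unit allI impI exI[of _ s] s(1) ballI)
    fix \<epsilon> :: real and y assume \<epsilon>: "0 < \<epsilon>" "y \<in> ball x s"
    { assume "(y - x) \<bullet> facet_normal K e < - \<epsilon> * norm (y - x)"
      then show "y \<in> \<Omega>" using inside[OF \<epsilon>(2)] nz[OF \<epsilon>(1), of y] by simp }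
    { assume "(y - x) \<bullet> facet_normal K e > \<epsilon> * norm (y - x)"
      then show "y \<notin> \<Omega>" using outside[OF \<epsilon>(2)] nz[OF \<epsilon>(1), of y] by simp }
  qed
qed

text \<open>A shared facet is covered by two half-balls from both sides, hence lies inside \<open>\<Omega>\<close>; an unshared one is in
  the frontier by \<open>exterior_facet\<close>.\<close>

lemma boundary_facets_eq:
  assumes K: "K \<in> \<T>"
  shows "boundary_facets \<Omega> K = {e. e facet_of K \<and> e \<notin> interior_facets \<T>}"
proof (intro set_eqI iffI)
  fix e assume "e \<in> {e. e facet_of K \<and> e \<notin> interior_facets \<T>}"
  then have e: "e facet_of K" "e \<notin> interior_facets \<T>" by auto
  have "rel_interior e \<subseteq> frontier \<Omega>"
    using exterior_facet[OF K e] by (auto simp: outward_unit_normal_def)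
  then have "closure (rel_interior e) \<subseteq> frontier \<Omega>" by (simp add: closure_minimal frontier_closed)
  then have "e \<subseteq> frontier \<Omega>"
    using convex_closure_rel_interior[OF facet_convex[OF K e(1)]] closure_subset by blast
  then show "e \<in> boundary_facets \<Omega> K" using e by (simp add: boundary_facets_def)
next
  fix e assume "e \<in> boundary_facets \<Omega> K"
  then have e: "e facet_of K" "e \<subseteq> frontier \<Omega>" by (auto simp: boundary_facets_def)
  have False if ei: "e \<in> interior_facets \<T>"
  proof -
    obtain K L where KL: "K \<in> \<T>" "L \<in> \<T>" "K \<noteq> L" "{M \<in> \<T>. e facet_of M} = {K, L}"
      "facet_normal L e = - facet_normal K e" "level L e = - level K e"
      by (rule two_elements[OF ei])
    have eKL: "e facet_of K" "e facet_of L" using KL(4) by blast+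
    obtain x where x: "x \<in> rel_interior e" using rel_interior_facet[OF KL(1) eKL(1)] by blast
    obtain r where r: "r > 0" "\<And>y. y \<in> ball x r \<Longrightarrow> facet_normal K e \<bullet> y \<le> level K e \<Longrightarrow> y \<in> K"
      by (rule half_ball[OF KL(1) eKL(1) x]) blast
    obtain r' where r': "r' > 0" "\<And>y. y \<in> ball x r' \<Longrightarrow> facet_normal L e \<bullet> y \<le> level L e \<Longrightarrow> y \<in> L"
      by (rule half_ball[OF KL(2) eKL(2) x]) blast
    have "ball x (min r r') \<subseteq> \<Union>\<T>"
    proof
      fix y assume y: "y \<in> ball x (min r r')"
      then show "y \<in> \<Union>\<T>" using r(2)[of y] r'(2)[of y] KL(1,2) unfolding KL(5,6) by (cases "facet_normal K e \<bullet> y \<le> level K e") auto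
    qed
    then have "x \<in> \<Omega>" unfolding \<Omega>_eq using r(1) r'(1) by (intro interiorI[of "ball x (min r r')"]) auto
    moreover have "x \<in> frontier \<Omega>" using e(2) x rel_interior_subset by blast
    ultimately show False using open_\<Omega> by (simp add: frontier_def interior_open)
  qed
  then show "e \<in> {e. e facet_of K \<and> e \<notin> interior_facets \<T>}" using e by blast
qed

lemma finite_facets: "K \<in> \<T> \<Longrightarrow> finite {e. e facet_of K}"
  using full_simplex.facets_eq[OF full] full_simplex.finC[OF full] by simp

lemma finite_boundary_facets: "K \<in> \<T> \<Longrightarrow> finite (boundary_facets \<Omega> K)"
  by (rule finite_subset[OF _ finite_facets]) (auto simp: boundary_facets_def)

lemma finite_interior_facets: "finite (interior_facets \<T>)"
proof (rule finite_subset)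
  show "interior_facets \<T> \<subseteq> (\<Union>K\<in>\<T>. {e. e facet_of K})" by (auto simp: interior_facets_def)
  show "finite (\<Union>K\<in>\<T>. {e. e facet_of K})" using fin finite_facets by blast
qed

lemma sum_facets:
  fixes F :: "(real^'d) set \<Rightarrow> (real^'d) set \<Rightarrow> 'c::comm_monoid_add"
  shows "(\<Sum>K\<in>\<T>. \<Sum>e | e facet_of K. F K e) =
    (\<Sum>e\<in>interior_facets \<T>. \<Sum>K | K \<in> \<T> \<and> e facet_of K. F K e) + (\<Sum>K\<in>\<T>. \<Sum>e\<in>boundary_facets \<Omega> K. F K e)"
proof -
  have "(\<Sum>e | e facet_of K. F K e) = (\<Sum>e | e \<in> interior_facets \<T> \<and> e facet_of K. F K e) + (\<Sum>e\<in>boundary_facets \<Omega> K. F K e)"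
    if K: "K \<in> \<T>" for K
  proof -
    have eq: "{e. e facet_of K} = {e. e \<in> interior_facets \<T> \<and> e facet_of K} \<union> boundary_facets \<Omega> K"
      unfolding boundary_facets_eq[OF K] by blast
    have "(\<Sum>e | e facet_of K. F K e) = sum (F K) ({e. e \<in> interior_facets \<T> \<and> e facet_of K} \<union> boundary_facets \<Omega> K)"
      by (rule sum.cong[OF eq refl])
    also have "\<dots> = (\<Sum>e | e \<in> interior_facets \<T> \<and> e facet_of K. F K e) + (\<Sum>e\<in>boundary_facets \<Omega> K. F K e)"
      using finite_interior_facets finite_boundary_facets[OF K]
      by (intro sum.union_disjoint) (auto simp: boundary_facets_eq[OF K])
    finally show ?thesis .
  qed
  then have "(\<Sum>K\<in>\<T>. \<Sum>e | e facet_of K. F K e) =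
      (\<Sum>K\<in>\<T>. (\<Sum>e | e \<in> interior_facets \<T> \<and> e facet_of K. F K e)) + (\<Sum>K\<in>\<T>. \<Sum>e\<in>boundary_facets \<Omega> K. F K e)"
    by (simp add: sum.distrib)
  also have "(\<Sum>K\<in>\<T>. (\<Sum>e | e \<in> interior_facets \<T> \<and> e facet_of K. F K e)) = (\<Sum>e\<in>interior_facets \<T>. \<Sum>K | K \<in> \<T> \<and> e facet_of K. F K e)"
    by (rule sum.swap_restrict) (use fin finite_interior_facets in auto)
  finally show ?thesis .
qed

text \<open>By \<open>exterior_facet\<close> the normal of a boundary facet is an outward normal of \<open>\<Omega>\<close> at its relatively interior points.\<close>

lemma level_star_shaped:
  assumes star: "strictly_star_shaped \<Omega> p c" and K: "K \<in> \<T>" and e: "e \<in> boundary_facets \<Omega> K"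
  shows "c \<le> level K e - facet_normal K e \<bullet> p"
proof -
  have e': "e facet_of K" "e \<notin> interior_facets \<T>" using e boundary_facets_eq[OF K] by auto
  obtain x where x: "x \<in> rel_interior e" using rel_interior_facet[OF K e'(1)] by blast
  have o: "outward_unit_normal \<Omega> x (facet_normal K e)" by (rule exterior_facet[OF K e' x])
  then have "(x - p) \<bullet> facet_normal K e \<ge> c"
    using star by (auto simp: strictly_star_shaped_def outward_unit_normal_def)
  moreover have "facet_normal K e \<bullet> x = level K e"
    using flat_facet.in_hyperplane[OF flat[OF K e'(1)]] x rel_interior_subset by blast
  ultimately show ?thesis by (simp add: inner_diff_left inner_diff_right inner_commute[of _ "facet_normal K e"])
qed

lemma disjoint_interiors:
  assumes "K \<in> \<T>" "L \<in> \<T>" "K \<noteq> L"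
  shows "interior K \<inter> interior L = {}"
proof (rule ccontr)
  assume "interior K \<inter> interior L \<noteq> {}"
  then have "interior (K \<inter> L) \<noteq> {}" by simp
  then have "aff_dim (K \<inter> L) = int DIM(real^'d)" by (rule aff_dim_nonempty_interior)
  then show False using proper_face[OF assms] by simp
qed

lemma negligible_skeleton: "negligible (\<Omega> - (\<Union>K\<in>\<T>. interior K))"
proof (rule negligible_subset)
  have "negligible t" if t: "t \<in> frontier ` \<T>" for t
  proof -
    obtain K where K: "K \<in> \<T>" "t = frontier K" using t by blast
    show ?thesis unfolding K(2) by (rule negligible_convex_frontier[OF convex_K[OF K(1)]])
  qed
  then show "negligible (\<Union>K\<in>\<T>. frontier K)"
    by (intro negligible_Union finite_imageI fin)
  show "\<Omega> - (\<Union>K\<in>\<T>. interior K) \<subseteq> (\<Union>K\<in>\<T>. frontier K)"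
  proof
    fix x assume x: "x \<in> \<Omega> - (\<Union>K\<in>\<T>. interior K)"
    then obtain K where K: "K \<in> \<T>" "x \<in> K" using interior_subset[of "\<Union>\<T>"] unfolding \<Omega>_eq by blast
    then have "x \<in> frontier K" using x closure_subset[of K] by (auto simp: frontier_def)
    then show "x \<in> (\<Union>K\<in>\<T>. frontier K)" using K(1) by blast
  qed
qed

end

section \<open>Piecewise affine functions\<close>

text \<open>Explicit coefficients on each element: slopes \<open>G\<close> and constant terms \<open>C\<close> for a scalar function, values \<open>H\<close>
  for a piecewise constant field such as a piecewise gradient.\<close>

definition pw_affine :: "(real^'d) set set \<Rightarrow> (real^'d \<Rightarrow> complex) \<Rightarrow> ((real^'d) set \<Rightarrow> complex^'d) \<Rightarrow> ((real^'d) set \<Rightarrow> complex) \<Rightarrow> bool"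
  where "pw_affine \<T> v G C \<longleftrightarrow> (\<forall>K\<in>\<T>. \<forall>x\<in>interior K. v x = dot_normal (G K) x + C K)"

definition pw_const :: "(real^'d) set set \<Rightarrow> (real^'d \<Rightarrow> complex^'d) \<Rightarrow> ((real^'d) set \<Rightarrow> complex^'d) \<Rightarrow> bool"
  where "pw_const \<T> \<tau> H \<longleftrightarrow> (\<forall>K\<in>\<T>. \<forall>x\<in>interior K. \<tau> x = H K)"

lemma Re_dot_normal: "Re (dot_normal g x) = (\<chi> i. Re (g $ i)) \<bullet> x"
  and Im_dot_normal: "Im (dot_normal g x) = (\<chi> i. Im (g $ i)) \<bullet> x"
  by (simp_all add: dot_normal_def inner_vec_def)

lemma V_h_iff_pw_affine: "v \<in> V_h \<T> \<longleftrightarrow> (\<exists>G C. pw_affine \<T> v G C)"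
proof
  assume v: "v \<in> V_h \<T>"
  have "\<forall>K\<in>\<T>. \<exists>g c. \<forall>x\<in>interior K. v x = dot_normal g x + c"
  proof
    fix K assume "K \<in> \<T>"
    then have "\<exists>a b. \<forall>x\<in>interior K. Re (v x) = a \<bullet> x + b" "\<exists>a b. \<forall>x\<in>interior K. Im (v x) = a \<bullet> x + b"
      using v by (auto simp: V_h_def P1_on_def)
    then obtain a b a' b' where "\<forall>x\<in>interior K. Re (v x) = a \<bullet> x + b" "\<forall>x\<in>interior K. Im (v x) = a' \<bullet> x + b'"
      by blast
    then have "\<forall>x\<in>interior K. v x = dot_normal (\<chi> i. Complex (a $ i) (a' $ i)) x + Complex b b'"
      by (auto simp: complex_eq_iff Re_dot_normal Im_dot_normal)
    then show "\<exists>g c. \<forall>x\<in>interior K. v x = dot_normal g x + c" by blast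
  qed
  then obtain G where "\<forall>K\<in>\<T>. \<exists>c. \<forall>x\<in>interior K. v x = dot_normal (G K) x + c" by metis
  then obtain C where "\<forall>K\<in>\<T>. \<forall>x\<in>interior K. v x = dot_normal (G K) x + C K" by metis
  then show "\<exists>G C. pw_affine \<T> v G C" unfolding pw_affine_def by blast
next
  assume "\<exists>G C. pw_affine \<T> v G C"
  then obtain G C where "pw_affine \<T> v G C" by blast
  then show "v \<in> V_h \<T>"
    by (force simp: V_h_def P1_on_def pw_affine_def Re_dot_normal Im_dot_normal)
qed

lemma pw_const_in_Sigma_h: "pw_const \<T> \<tau> H \<Longrightarrow> \<tau> \<in> \<Sigma>_h \<T>"
  by (force simp: \<Sigma>_h_def V_h_def P1_on_def pw_const_def intro: exI[of _ 0])

lemma grad_eq: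
  assumes "open S" "x \<in> S" "\<And>y. y \<in> S \<Longrightarrow> v y = dot_normal g y + c"
  shows "grad v x = g"
proof -
  have "((\<lambda>y. dot_normal g y + c) has_derivative dot_normal g) (at x)"
    by (auto intro!: derivative_eq_intros bounded_linear_imp_has_derivative simp: linear_dot_normal linear_linear)
  then have "(v has_derivative dot_normal g) (at x)"
    by (rule has_derivative_transform_within_open[OF _ assms(1,2)]) (simp add: assms(3))
  then have "frechet_derivative v (at x) = dot_normal g" by (rule frechet_derivative_at[symmetric])
  then show ?thesis by (simp add: grad_def vec_eq_iff dot_normal_def axis_def if_distrib cong: if_cong)
qed

lemma pw_const_grad: "pw_affine \<T> v G C \<Longrightarrow> pw_const \<T> (grad v) G"
  unfolding pw_const_def pw_affine_def by (auto intro!: grad_eq[OF open_interior])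

lemma borel_measurable_vec_nth:
  fixes f :: "'a \<Rightarrow> complex^'n"
  shows "f \<in> borel_measurable M \<Longrightarrow> (\<lambda>x. f x $ i) \<in> borel_measurable M"
  by (rule measurable_compose[OF _ borel_measurable_continuous_onI]) (auto intro: continuous_intros)

lemma borel_measurable_cdot:
  fixes f g :: "'a \<Rightarrow> complex^'n"
  assumes "f \<in> borel_measurable M" "g \<in> borel_measurable M"
  shows "(\<lambda>x. cdot (f x) (g x)) \<in> borel_measurable M"
proof -
  have "(\<lambda>x. cnj (g x $ i)) \<in> borel_measurable M" for i
    by (rule measurable_compose[OF borel_measurable_vec_nth[OF assms(2)] borel_measurable_continuous_onI]) (intro continuous_intros)
  then show ?thesis unfolding cdot_def
    by (intro borel_measurable_sum borel_measurable_times borel_measurable_vec_nth assms)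
qed

lemma borel_measurable_smul_normal:
  fixes f :: "'a \<Rightarrow> complex"
  shows "f \<in> borel_measurable M \<Longrightarrow> (\<lambda>x. smul_normal (f x) n) \<in> borel_measurable M"
  by (rule measurable_compose[OF _ borel_measurable_continuous_onI])
     (auto simp: smul_normal_def intro!: continuous_intros)

lemma borel_measurable_dot_normal:
  fixes f :: "'a \<Rightarrow> complex^'n"
  shows "f \<in> borel_measurable M \<Longrightarrow> (\<lambda>x. dot_normal (f x) n) \<in> borel_measurable M"
  unfolding dot_normal_def by (intro borel_measurable_sum borel_measurable_times borel_measurable_vec_nth) auto

lemma borel_measurable_scale:
  fixes f :: "'a \<Rightarrow> complex^'n"
  shows "f \<in> borel_measurable M \<Longrightarrow> (\<lambda>x. c *s f x) \<in> borel_measurable M"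
  by (rule measurable_compose[OF _ borel_measurable_continuous_onI])
     (auto simp: vector_scalar_mult_def intro!: continuous_intros)

section \<open>Traces and integrals of piecewise affine functions\<close>

context full_simplex begin

text \<open>Outside \<open>K\<close> the filter defining the trace is trivial, so the limit there is the same unspecified value
  at all points; this makes traces measurable on the whole space.\<close>

lemma trace_from_eq:
  fixes f :: "real^'d \<Rightarrow> 'b::t2_space"
  assumes F: "continuous_on UNIV F" and f: "\<And>x. x \<in> interior K \<Longrightarrow> f x = F x"
  shows "trace_from K f x = (if x \<in> K then F x else (THE l. True))"
proof (cases "x \<in> K")
  case True
  have nt: "at x within interior K \<noteq> bot"
  proof -
    have "x \<in> closure (interior K)" using True closure_interior_K by simp
    then show ?thesis
      by (metis open_interior closure_def Un_iff mem_Collect_eq interior_limit_point interior_interior trivial_limit_within)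
  qed
  have "(F \<longlongrightarrow> F x) (at x within interior K)"
    using F by (meson UNIV_I continuous_on_def subset_UNIV tendsto_within_subset)
  then have "(f \<longlongrightarrow> F x) (at x within interior K)"
    by (rule Lim_transform_eventually) (auto simp: eventually_at_filter f)
  then show ?thesis using True nt by (simp add: trace_from_def tendsto_Lim)
next
  case False
  then have "x \<notin> closure (interior K)" using closure_interior_K by simp
  then have "at x within interior K = bot"
    by (metis closure_def UnCI mem_Collect_eq trivial_limit_within)
  then show ?thesis using False by (simp add: trace_from_def t2_space_class.Lim_def)
qed

lemma trace_from_measurable:
  fixes f :: "real^'d \<Rightarrow> 'b::{real_normed_vector, second_countable_topology}"
  assumes F: "continuous_on UNIV F" and f: "\<And>x. x \<in> interior K \<Longrightarrow> f x = F x"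
  shows "trace_from K f \<in> borel_measurable borel"
proof -
  have "K \<in> sets borel" using compact_K by (rule borel_compact)
  moreover have "F \<in> borel_measurable borel" using F by (rule borel_measurable_continuous_onI)
  ultimately show ?thesis
    using trace_from_eq[OF F f] by (subst measurable_cong[where g = "\<lambda>x. if x \<in> K then F x else (THE l. True)"])
      (auto intro!: measurable_If_set)
qed

lemma
  fixes f :: "real^'d \<Rightarrow> 'b::euclidean_space"
  assumes F: "continuous_on UNIV F" and f: "\<And>x. x \<in> interior K \<Longrightarrow> f x = F x"
    and S: "interior K \<subseteq> S" "S \<subseteq> K"
  shows integral_broken: "(LINT x:S|lebesgue. f x) = (LINT x:K|lborel. F x)"
    and absolutely_integrable_broken: "f absolutely_integrable_on S"
proof -
  have neg: "negligible (K - interior K)"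
    using negligible_convex_frontier[OF convex_K] compact_K by (simp add: frontier_def compact_imp_closed)
  have KF: "(\<lambda>x. indicator K x *\<^sub>R F x) \<in> borel_measurable lborel"
    using compact_K borel_measurable_continuous_onI[OF F]
    by (intro borel_measurable_scaleR borel_measurable_indicator) (auto simp: borel_compact)
  have "F absolutely_integrable_on K"
    using set_integrable_lborel_continuous[OF F compact_K]
    unfolding set_integrable_def integrable_completion[OF KF] .
  then have FS: "F absolutely_integrable_on S"
    by (rule absolutely_integrable_spike_set) (use S in \<open>auto intro!: negligible_subset[OF neg]\<close>)
  have fF: "f x = F x" if "x \<in> S - (K - interior K)" for x using f that S by blast
  show fS: "f absolutely_integrable_on S" by (rule absolutely_integrable_spike[OF FS neg]) (rule fF)
  have "(LINT x:S|lebesgue. f x) = integral S f" by (rule set_lebesgue_integral_eq_integral(2)[OF fS])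
  also have "\<dots> = integral S F" by (rule integral_spike[OF neg]) (simp add: fF)
  also have "\<dots> = integral K F"
    by (rule integral_spike_set) (use S in \<open>auto intro!: negligible_subset[OF neg]\<close>)
  also have "\<dots> = (LINT x:K|lebesgue. F x)"
    using \<open>F absolutely_integrable_on K\<close> by (rule set_lebesgue_integral_eq_integral(2)[symmetric])
  also have "\<dots> = (LINT x:K|lborel. F x)"
    unfolding set_lebesgue_integral_def by (rule integral_completion[OF KF])
  finally show "(LINT x:S|lebesgue. f x) = (LINT x:K|lborel. F x)" .
qed

end

context mesh begin

lemma integral_\<Omega>_broken:
  fixes f :: "real^'d \<Rightarrow> 'b::euclidean_space"
  assumes F: "\<And>K. K \<in> \<T> \<Longrightarrow> continuous_on UNIV (F K)" and f: "\<And>K x. K \<in> \<T> \<Longrightarrow> x \<in> interior K \<Longrightarrow> f x = F K x"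
  shows "(LINT x:\<Omega>|lebesgue. f x) = (\<Sum>K\<in>\<T>. LINT x:K|lborel. F K x)"
proof -
  have ai: "f absolutely_integrable_on (interior K)" and ii: "(LINT x:interior K|lebesgue. f x) = (LINT x:K|lborel. F K x)"
    if K: "K \<in> \<T>" for K
    by (rule full_simplex.absolutely_integrable_broken[OF full[OF K] F[OF K] f[OF K]]
          full_simplex.integral_broken[OF full[OF K] F[OF K] f[OF K]], use interior_subset in auto)+
  let ?U = "\<Union>K\<in>\<T>. interior K"
  have U: "f absolutely_integrable_on ?U"
    using fin ai by (intro set_integrable_UN) auto
  have "{x \<in> ?U - \<Omega>. f x \<noteq> 0} = {}" using interior_subset_\<Omega> by blast
  then have 1: "negligible {x \<in> ?U - \<Omega>. f x \<noteq> 0}" by (simp only: negligible_empty)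
  have 2: "negligible {x \<in> \<Omega> - ?U. f x \<noteq> 0}" by (rule negligible_subset[OF negligible_skeleton]) auto
  have "f absolutely_integrable_on \<Omega>" by (rule absolutely_integrable_spike_set[OF U 1 2])
  then have "(LINT x:\<Omega>|lebesgue. f x) = integral \<Omega> f" by (rule set_lebesgue_integral_eq_integral(2))
  also have "\<dots> = integral ?U f" by (rule integral_spike_set[OF 2 1])
  also have "\<dots> = (LINT x:?U|lebesgue. f x)" by (rule set_lebesgue_integral_eq_integral(2)[OF U, symmetric])
  also have "\<dots> = (\<Sum>K\<in>\<T>. LINT x:interior K|lebesgue. f x)"
    by (rule set_integral_finite_Union) (use fin ai disjoint_interiors in \<open>auto simp: disjoint_family_on_def\<close>)
  finally show ?thesis by (simp add: ii)
qed

lemma facet_integral_cong: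
  fixes f F :: "real^'d \<Rightarrow> 'b::{banach, second_countable_topology}"
  assumes K: "K \<in> \<T>" "e facet_of K" and f: "f \<in> borel_measurable borel" and F: "continuous_on UNIV F"
    and eq: "\<And>x. x \<in> e \<Longrightarrow> f x = F x"
  shows "(LINT x|facet_measure e. f x) = (LINT x|facet_measure e. F x)"
proof -
  interpret flat_facet e "facet_normal K e" "level K e" by (rule flat[OF K])
  show ?thesis
    by (rule integral_cong_AE)
       (use AE_facet_measure f F eq in \<open>auto simp: measurable_cong_sets[OF sets_facet_measure refl] intro: borel_measurable_continuous_onI\<close>)
qed

lemma
  assumes "pw_affine \<T> v G C" and K: "K \<in> \<T>"
  shows trace_pw_affine: "x \<in> K \<Longrightarrow> trace_from K v x = dot_normal (G K) x + C K"
    and trace_pw_affine_measurable: "trace_from K v \<in> borel_measurable borel"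
proof -
  have c: "continuous_on UNIV (\<lambda>x. dot_normal (G K) x + C K)" by (intro continuous_intros)
  have v: "\<And>x. x \<in> interior K \<Longrightarrow> v x = dot_normal (G K) x + C K" using assms by (auto simp: pw_affine_def)
  show "x \<in> K \<Longrightarrow> trace_from K v x = dot_normal (G K) x + C K"
    using full_simplex.trace_from_eq[OF full[OF K] c v] by simp
  show "trace_from K v \<in> borel_measurable borel"
    by (rule full_simplex.trace_from_measurable[OF full[OF K] c v])
qed

lemma
  assumes "pw_const \<T> \<tau> H" and K: "K \<in> \<T>"
  shows trace_pw_const: "x \<in> K \<Longrightarrow> trace_from K \<tau> x = H K"
    and trace_pw_const_measurable: "trace_from K \<tau> \<in> borel_measurable borel"
proof -
  have c: "continuous_on UNIV (\<lambda>x. H K)" by (intro continuous_intros)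
  have v: "\<And>x. x \<in> interior K \<Longrightarrow> \<tau> x = H K" using assms by (auto simp: pw_const_def)
  show "x \<in> K \<Longrightarrow> trace_from K \<tau> x = H K"
    using full_simplex.trace_from_eq[OF full[OF K] c v] by simp
  show "trace_from K \<tau> \<in> borel_measurable borel"
    by (rule full_simplex.trace_from_measurable[OF full[OF K] c v])
qed

end

lemma cdot_smul_normal: "cdot u (smul_normal z n) = dot_normal u n * cnj z"
  by (simp add: cdot_def smul_normal_def dot_normal_def sum_distrib_left mult_ac)

lemma cdot_smul_normal_left: "cdot (smul_normal z n) u = z * cnj (dot_normal u n)"
  by (simp add: cdot_def smul_normal_def dot_normal_def sum_distrib_left mult_ac)

lemma dot_normal_smul_normal: "dot_normal (smul_normal z n) x = z * of_real (n \<bullet> x)"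
  by (simp add: smul_normal_def dot_normal_def inner_vec_def sum_distrib_left mult_ac)

lemma dot_normal_left_simps:
  "dot_normal (u + v) x = dot_normal u x + dot_normal v x"
  "dot_normal (u - v) x = dot_normal u x - dot_normal v x"
  "dot_normal (- u) x = - dot_normal u x"
  "dot_normal (r *\<^sub>R u) x = of_real r * dot_normal u x"
  "dot_normal (c *s u) x = c * dot_normal u x"
  by (simp_all add: dot_normal_def algebra_simps sum.distrib sum_subtractf sum_negf sum_distrib_left scaleR_conv_of_real[where 'a = complex])

lemma smul_normal_minus: "smul_normal z (- n) = - smul_normal z n"
  by (simp add: smul_normal_def vec_eq_iff)

lemma dot_normal_minus_right: "dot_normal u (- n) = - dot_normal u n"
  by (simp add: dot_normal_def sum_negf)

text \<open>The two elements of an interior facet in a fixed order; the normal of the first one orients the facet.\<close>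

locale interior_facet = mesh +
  fixes e K L
  assumes KT: "K \<in> \<T>" and LT: "L \<in> \<T>" and KL: "K \<noteq> L" and elems: "{M \<in> \<T>. e facet_of M} = {K, L}"
    and normal_L: "facet_normal L e = - facet_normal K e" and level_L: "level L e = - level K e"
begin

abbreviation "n \<equiv> facet_normal K e"

lemma eK: "e facet_of K" and eL: "e facet_of L" using elems by blast+

sublocale flat_facet e n "level K e" by (rule flat[OF KT eK])

lemma e_sub: "x \<in> e \<Longrightarrow> x \<in> K" "x \<in> e \<Longrightarrow> x \<in> L" using facet_subset[OF eK] facet_subset[OF eL] by auto

lemma sum_elems: "(\<Sum>M\<in>{M\<in>\<T>. e facet_of M}. f M) = f K + f L" for f :: "(real^'a) set \<Rightarrow> 'c::comm_monoid_add"
  using KL by (simp add: elems)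

lemma avg_measurable: "pw_const \<T> \<tau> H \<Longrightarrow> avg \<T> e \<tau> \<in> borel_measurable borel"
  unfolding avg_def[abs_def] sum_elems
  by (intro borel_measurable_scaleR borel_measurable_add trace_pw_const_measurable KT LT borel_measurable_const)

lemma jump_measurable: "pw_affine \<T> v G C \<Longrightarrow> jump \<T> e v \<in> borel_measurable borel"
  unfolding jump_def[abs_def] sum_elems
  by (intro borel_measurable_add borel_measurable_smul_normal trace_pw_affine_measurable KT LT)

lemma vjump_measurable: "pw_const \<T> \<tau> H \<Longrightarrow> vjump \<T> e \<tau> \<in> borel_measurable borel"
  unfolding vjump_def[abs_def] sum_elems
  by (intro borel_measurable_add borel_measurable_dot_normal trace_pw_const_measurable KT LT)

lemma avg_eq: "pw_const \<T> \<tau> H \<Longrightarrow> x \<in> e \<Longrightarrow> avg \<T> e \<tau> x = (1/2) *\<^sub>R (H K + H L)"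
  unfolding avg_def sum_elems by (simp add: trace_pw_const[OF _ KT] trace_pw_const[OF _ LT] e_sub)

lemma jump_eq: "pw_affine \<T> v G C \<Longrightarrow> x \<in> e \<Longrightarrow> jump \<T> e v x = smul_normal (dot_normal (G K - G L) x + (C K - C L)) n"
  unfolding jump_def sum_elems
  by (simp add: trace_pw_affine[OF _ KT] trace_pw_affine[OF _ LT] e_sub normal_L smul_normal_minus dot_normal_left_simps)
     (simp add: smul_normal_def vec_eq_iff algebra_simps)

lemma vjump_eq: "pw_const \<T> \<tau> H \<Longrightarrow> x \<in> e \<Longrightarrow> vjump \<T> e \<tau> x = dot_normal (H K - H L) n"
  unfolding vjump_def sum_elems
  by (simp add: trace_pw_const[OF _ KT] trace_pw_const[OF _ LT] e_sub normal_L dot_normal_minus_right dot_normal_left_simps)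

lemma flux_term:
  assumes \<tau>: "pw_const \<T> \<tau> H" and w: "pw_affine \<T> w G C" and v: "pw_affine \<T> v G' C'"
  shows "facet_vinner e (\<lambda>x. avg \<T> e \<tau> x - c *s jump \<T> e w x) (jump \<T> e v)
    = (LINT x|facet_measure e. (dot_normal ((1/2) *\<^sub>R (H K + H L)) n - c * (dot_normal (G K - G L) x + (C K - C L)))
         * cnj (dot_normal (G' K - G' L) x + (C' K - C' L)))"
  unfolding facet_vinner_def
proof (rule facet_integral_cong[OF KT eK])
  show "(\<lambda>x. cdot (avg \<T> e \<tau> x - c *s jump \<T> e w x) (jump \<T> e v x)) \<in> borel_measurable borel"
    by (intro borel_measurable_cdot borel_measurable_diff borel_measurable_scale avg_measurable[OF \<tau>]
        jump_measurable[OF w] jump_measurable[OF v])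
  show "continuous_on UNIV (\<lambda>x. (dot_normal ((1/2) *\<^sub>R (H K + H L)) n - c * (dot_normal (G K - G L) x + (C K - C L)))
         * cnj (dot_normal (G' K - G' L) x + (C' K - C' L)))"
    by (intro continuous_intros)
  fix x assume "x \<in> e"
  then show "cdot (avg \<T> e \<tau> x - c *s jump \<T> e w x) (jump \<T> e v x)
      = (dot_normal ((1/2) *\<^sub>R (H K + H L)) n - c * (dot_normal (G K - G L) x + (C K - C L)))
         * cnj (dot_normal (G' K - G' L) x + (C' K - C' L))"
    unfolding avg_eq[OF \<tau> \<open>x \<in> e\<close>] jump_eq[OF w \<open>x \<in> e\<close>] jump_eq[OF v \<open>x \<in> e\<close>] cdot_smul_normal
      dot_normal_left_simps(2)[of "(1/2) *\<^sub>R (H K + H L)"] dot_normal_left_simps(5) dot_normal_smul_normal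
    by (simp add: nn)
qed

lemma vjump_term:
  assumes \<tau>: "pw_const \<T> \<tau> H" and \<sigma>: "pw_const \<T> \<sigma> H'"
  shows "facet_inner e (vjump \<T> e \<tau>) (vjump \<T> e \<sigma>) = measure (facet_measure e) UNIV * (dot_normal (H K - H L) n * cnj (dot_normal (H' K - H' L) n))"
proof -
  have "facet_inner e (vjump \<T> e \<tau>) (vjump \<T> e \<sigma>) = (LINT x|facet_measure e. dot_normal (H K - H L) n * cnj (dot_normal (H' K - H' L) n))"
    unfolding facet_inner_def
  proof (rule facet_integral_cong[OF KT eK])
    have "(\<lambda>x. cnj (vjump \<T> e \<sigma> x)) \<in> borel_measurable borel"
      by (rule measurable_compose[OF vjump_measurable[OF \<sigma>] borel_measurable_continuous_onI]) (intro continuous_intros)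
    then show "(\<lambda>x. vjump \<T> e \<tau> x * cnj (vjump \<T> e \<sigma> x)) \<in> borel_measurable borel"
      by (intro borel_measurable_times vjump_measurable[OF \<tau>])
  qed (auto simp: vjump_eq[OF \<tau>] vjump_eq[OF \<sigma>])
  then show ?thesis by (simp add: space_facet_measure scaleR_conv_of_real)
qed

lemma avg_term:
  assumes w: "pw_affine \<T> w G C" and \<tau>: "pw_const \<T> \<tau> H"
  shows "facet_vinner e (jump \<T> e w) (avg \<T> e \<tau>) =
    (LINT x|facet_measure e. (dot_normal (G K - G L) x + (C K - C L)) * cnj (dot_normal ((1/2) *\<^sub>R (H K + H L)) n))"
  unfolding facet_vinner_def
proof (rule facet_integral_cong[OF KT eK])
  show "(\<lambda>x. cdot (jump \<T> e w x) (avg \<T> e \<tau> x)) \<in> borel_measurable borel"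
    by (intro borel_measurable_cdot avg_measurable[OF \<tau>] jump_measurable[OF w])
  show "continuous_on UNIV (\<lambda>x. (dot_normal (G K - G L) x + (C K - C L)) * cnj (dot_normal ((1/2) *\<^sub>R (H K + H L)) n))"
    by (intro continuous_intros)
  fix x assume "x \<in> e"
  then show "cdot (jump \<T> e w x) (avg \<T> e \<tau> x) = (dot_normal (G K - G L) x + (C K - C L)) * cnj (dot_normal ((1/2) *\<^sub>R (H K + H L)) n)"
    by (simp only: avg_eq[OF \<tau> \<open>x \<in> e\<close>] jump_eq[OF w \<open>x \<in> e\<close>] cdot_smul_normal_left)
qed

end

section \<open>The estimate on an interior facet\<close>

lemma norm_dot_normal_le: "norm (dot_normal u x) \<le> norm u * norm x"
proof -
  have "norm (dot_normal u x) \<le> (\<Sum>i\<in>UNIV. \<bar>norm (u $ i)\<bar> * \<bar>x $ i\<bar>)"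
    unfolding dot_normal_def by (rule order_trans[OF norm_sum]) (simp add: norm_mult)
  also have "\<dots> \<le> L2_set (\<lambda>i. norm (u $ i)) UNIV * L2_set (\<lambda>i. x $ i) UNIV"
    by (rule L2_set_mult_ineq)
  finally show ?thesis by (simp add: norm_vec_def L2_set_def)
qed

lemma norm_cdot_le: "norm (cdot u v) \<le> norm u * norm v"
proof -
  have "norm (cdot u v) \<le> (\<Sum>i\<in>UNIV. \<bar>norm (u $ i)\<bar> * \<bar>norm (v $ i)\<bar>)"
    unfolding cdot_def by (rule order_trans[OF norm_sum]) (simp add: norm_mult)
  also have "\<dots> \<le> L2_set (\<lambda>i. norm (u $ i)) UNIV * L2_set (\<lambda>i. norm (v $ i)) UNIV"
    by (rule L2_set_mult_ineq)
  finally show ?thesis by (simp add: norm_vec_def)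
qed

lemma norm_sq_vec: "(norm (u :: complex^'n))\<^sup>2 = (\<Sum>i\<in>UNIV. (norm (u $ i))\<^sup>2)"
  by (simp add: norm_vec_def L2_set_def sum_nonneg)

lemma norm_sq_diff_cdot: "(norm p)\<^sup>2 - (norm q)\<^sup>2 = 2 * Re (cdot ((1/2) *\<^sub>R (p + q)) (p - q))"
proof -
  have eq: "2 * Re (((1/2) *\<^sub>R (p + q)) $ i * cnj ((p - q) $ i)) = (norm (p $ i))\<^sup>2 - (norm (q $ i))\<^sup>2" for i
    by (simp only: cmod_power2) (simp add: power2_eq_square algebra_simps)
  show ?thesis
    unfolding cdot_def Re_sum sum_distrib_left norm_sq_vec sum_subtractf[symmetric] by (simp only: eq)
qed

lemma cdot_right_simps:
  "cdot u (v + w) = cdot u v + cdot u w" "cdot u (v - w) = cdot u v - cdot u w"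
  by (simp_all add: cdot_def algebra_simps sum.distrib sum_subtractf)

lemma young:
  fixes x y \<eta> :: real
  assumes "\<eta> > 0"
  shows "2 * x * y \<le> \<eta> * x\<^sup>2 + y\<^sup>2 / \<eta>"
proof -
  have "0 \<le> (\<eta> * x - y)\<^sup>2 / \<eta>" using assms by simp
  also have "(\<eta> * x - y)\<^sup>2 / \<eta> = \<eta> * x\<^sup>2 + y\<^sup>2 / \<eta> - 2 * x * y"
    using assms by (simp add: power2_eq_square field_simps)
  finally show ?thesis by simp
qed

lemma (in flat_facet) norm_integral_le:
  fixes f :: "real^'d \<Rightarrow> 'b::{banach, second_countable_topology}"
  assumes "continuous_on UNIV f" "continuous_on UNIV g" "\<And>x. x \<in> e \<Longrightarrow> norm (f x) \<le> g x"
  shows "norm (LINT x|facet_measure e. f x) \<le> (LINT x|facet_measure e. g x)"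
proof -
  have "norm (LINT x|facet_measure e. f x) \<le> (LINT x|facet_measure e. norm (f x))" by (rule integral_norm_bound)
  also have "\<dots> \<le> (LINT x|facet_measure e. g x)"
    by (rule integral_mono_AE)
       (use assms AE_facet_measure in \<open>auto intro!: integrable_facet_measure_continuous continuous_intros\<close>)
  finally show ?thesis .
qed

text \<open>Here \<open>p\<close>, \<open>q\<close> are the slopes and \<open>D\<close>, \<open>m\<close> the jump and the mean of the gradient.  Split \<open>D\<close> into its normal part \<open>Dn\<close> and its
  tangential part \<open>T\<close>.  Since \<open>|p|\<^sup>2 - |q|\<^sup>2 = 2 Re (m \<bullet> D)\<close> and \<open>D \<bullet> (x - x\<^sub>0) = T \<bullet> (x - x\<^sub>0) + a Dn\<close> on the facet, the two products
  of \<open>m \<bullet> n\<close> with \<open>Dn\<close> cancel in the first line, and only \<open>T\<close> is left, which the assumption \<open>tang\<close> bounds by the jump \<open>J\<close>.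
  All products are then split by Young's inequality with weights proportional to \<open>h\<close>, so that the
  trace bounds turn the means into small multiples of volume terms.  The penalty term alone contains
  \<open>Dn\<close>; its weight \<open>sqrt (\<beta> / \<delta>)\<close> balances the two penalties.\<close>

lemma (in interior_facet) interior_facet_estimate:
  fixes p q :: "complex^'a" and cK cL :: complex and x\<^sub>0 :: "real^'a"
    and mK mL SK SL h Ce Ct CT \<epsilon> \<beta> \<delta> R k d :: real
  defines "D \<equiv> p - q" and "m \<equiv> (1/2) *\<^sub>R (p + q)"
  defines "J \<equiv> \<lambda>x. dot_normal D x + (cK - cL)" and "E \<equiv> measure (facet_measure e) UNIV"
  defines "wK \<equiv> \<lambda>x. dot_normal p x + cK" and "wL \<equiv> \<lambda>x. dot_normal q x + cL"
  defines "I \<equiv> LINT x|facet_measure e. (norm (J x))\<^sup>2" and "a \<equiv> level K e - n \<bullet> x\<^sub>0"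
  defines "S1 \<equiv> (norm p)\<^sup>2 * mK + (norm q)\<^sup>2 * mL"
  assumes pos: "h > 0" "Ce > 0" "Ct > 0" "\<epsilon> > 0" "\<beta> > 0" "\<delta> > 0"
    and R: "\<And>x. x \<in> e \<Longrightarrow> norm (x - x\<^sub>0) \<le> R"
    and EK: "E \<le> Ce / h * mK" and EL: "E \<le> Ce / h * mL"
    and trK: "(LINT x|facet_measure e. (norm (wK x))\<^sup>2) \<le> Ct / h * SK"
    and trL: "(LINT x|facet_measure e. (norm (wL x))\<^sup>2) \<le> Ct / h * SL"
    and tang: "(norm (D - smul_normal (dot_normal D n) n))\<^sup>2 * E * h\<^sup>2 \<le> CT * I"
  shows "\<bar>a * E * ((norm p)\<^sup>2 - (norm q)\<^sup>2)
      - 2 * Re (dot_normal m n * (LINT x|facet_measure e. cnj (dot_normal D (x - x\<^sub>0))))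
      - k\<^sup>2 * (a * ((LINT x|facet_measure e. (norm (wK x))\<^sup>2) - (LINT x|facet_measure e. (norm (wL x))\<^sup>2)))
      - 2 * \<beta> * Im (LINT x|facet_measure e. J x * cnj (dot_normal D (x - x\<^sub>0)))
      - 2 * d * Re (dot_normal m n * (LINT x|facet_measure e. cnj (J x)))\<bar>
    \<le> 2 * \<epsilon> * S1 + \<epsilon> * (k\<^sup>2 * (SK + SL))
      + (2 * R\<^sup>2 * Ce * CT / (\<epsilon> * h ^ 3) + k\<^sup>2 * R\<^sup>2 * Ct / (2 * \<epsilon> * h) + \<beta> * R * (1 + CT) / h + d\<^sup>2 * Ce / (2 * \<epsilon> * h)) * I
      + R * sqrt (\<beta> / \<delta>) * (\<beta> * I + \<delta> * E * (norm (dot_normal D n))\<^sup>2)"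
proof -
  let ?\<mu> = "facet_measure e"
  define Dn where "Dn = dot_normal D n"
  define T where "T = D - smul_normal Dn n"
  define M where "M = dot_normal m n"
  have contJ: "continuous_on UNIV J" "continuous_on UNIV wK" "continuous_on UNIV wL"
    unfolding J_def wK_def wL_def by (intro continuous_intros)+
  note int = integrable_facet_measure_continuous
  have E0: "E \<ge> 0" by (simp add: E_def)
  have I0: "I \<ge> 0" by (simp add: I_def)
  have konst: "(LINT x|?\<mu>. c) = E * c" for c :: real by (simp add: E_def space_facet_measure)
  obtain y where y: "y \<in> e" using nonempty by blast
  have R0: "R \<ge> 0" using R[OF y] norm_ge_zero order_trans by blast
  have ax: "n \<bullet> (x - x\<^sub>0) = a" if "x \<in> e" for x using in_hyperplane[OF that] by (simp add: a_def inner_diff_right)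
  have aR: "\<bar>a\<bar> \<le> R"
    using Cauchy_Schwarz_ineq2[of n "y - x\<^sub>0"] R[OF y] unit ax[OF y] by simp
  have Jv: "dot_normal D (x - x\<^sub>0) = dot_normal T (x - x\<^sub>0) + of_real a * Dn" if "x \<in> e" for x
    unfolding T_def dot_normal_left_simps dot_normal_smul_normal ax[OF that] by simp
  have TR: "norm (dot_normal T (x - x\<^sub>0)) \<le> norm T * R" if "x \<in> e" for x
    using norm_dot_normal_le[of T "x - x\<^sub>0"] R[OF that] by (meson mult_left_mono norm_ge_zero order_trans)
  have T2: "(norm T)\<^sup>2 * E * h\<^sup>2 \<le> CT * I" using tang by (simp add: T_def Dn_def)
  have M_le: "norm M \<le> norm m" unfolding M_def using norm_dot_normal_le[of m n] unit by simp
  have m2: "(norm m)\<^sup>2 \<le> ((norm p)\<^sup>2 + (norm q)\<^sup>2) / 2"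
  proof -
    have "norm m \<le> (norm p + norm q) / 2" unfolding m_def using norm_triangle_ineq[of p q] by simp
    then have "(norm m)\<^sup>2 \<le> ((norm p + norm q) / 2)\<^sup>2" by (intro power_mono) auto
    also have "\<dots> \<le> ((norm p)\<^sup>2 + (norm q)\<^sup>2) / 2"
      using sum_squares_bound[of "norm p" "norm q"] by (simp add: power2_eq_square field_simps)
    finally show ?thesis .
  qed
  \<comment> \<open>This weight turns the facet integral of \<open>|m|\<^sup>2\<close> into \<open>\<epsilon>\<close> times the volume terms.\<close>
  define \<eta> where "\<eta> = 2 * \<epsilon> * h / Ce"
  have \<eta>: "\<eta> > 0" using pos by (simp add: \<eta>_def)
  have Em: "\<eta> * (E * (norm m)\<^sup>2) \<le> \<epsilon> * S1"
  proof -
    have "E * (norm m)\<^sup>2 \<le> E * (((norm p)\<^sup>2 + (norm q)\<^sup>2) / 2)" using m2 E0 by (rule mult_left_mono)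
    also have "\<dots> = ((norm p)\<^sup>2 * E + (norm q)\<^sup>2 * E) / 2" by (simp add: algebra_simps)
    also have "\<dots> \<le> ((norm p)\<^sup>2 * (Ce / h * mK) + (norm q)\<^sup>2 * (Ce / h * mL)) / 2"
      using EK EL by (intro divide_right_mono add_mono mult_left_mono) auto
    also have "\<dots> = Ce / (2 * h) * S1" using pos by (simp add: S1_def field_simps)
    finally have "\<eta> * (E * (norm m)\<^sup>2) \<le> \<eta> * (Ce / (2 * h) * S1)" using \<eta> by (intro mult_left_mono) auto
    then show ?thesis using pos by (simp add: \<eta>_def)
  qed
  \<comment> \<open>The terms with \<open>Dn\<close> cancel between the two integrals.\<close>
  have B1: "\<bar>a * E * ((norm p)\<^sup>2 - (norm q)\<^sup>2) - 2 * Re (M * (LINT x|?\<mu>. cnj (dot_normal D (x - x\<^sub>0))))\<bar>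
    \<le> \<epsilon> * S1 + 2 * R\<^sup>2 * Ce * CT / (\<epsilon> * h ^ 3) * I"
  proof -
    define Z where "Z = (LINT x|?\<mu>. cnj (dot_normal T (x - x\<^sub>0)))"
    have "(LINT x|?\<mu>. cnj (dot_normal D (x - x\<^sub>0))) = (LINT x|?\<mu>. cnj (dot_normal T (x - x\<^sub>0)) + of_real a * cnj Dn)"
      by (rule facet_integral_cong[OF KT eK])
         (auto simp: Jv intro!: borel_measurable_continuous_onI continuous_intros)
    also have "\<dots> = Z + of_real (E * a) * cnj Dn"
      unfolding Z_def
      by (subst Bochner_Integration.integral_add)
         (auto intro!: int continuous_intros simp: E_def space_facet_measure scaleR_conv_of_real)
    finally have Jint: "(LINT x|?\<mu>. cnj (dot_normal D (x - x\<^sub>0))) = Z + of_real (E * a) * cnj Dn" .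
    have Zb: "norm Z \<le> E * (norm T * R)"
    proof -
      have "norm Z \<le> (LINT x|?\<mu>. norm T * R)"
        unfolding Z_def by (rule norm_integral_le) (auto intro!: continuous_intros TR)
      then show ?thesis by (simp only: konst)
    qed
    have "cdot m D = cdot m T + M * cnj Dn"
      unfolding M_def T_def by (simp add: cdot_right_simps cdot_smul_normal)
    then have "(norm p)\<^sup>2 - (norm q)\<^sup>2 = 2 * Re (cdot m T) + 2 * Re (M * cnj Dn)"
      unfolding norm_sq_diff_cdot m_def[symmetric] D_def[symmetric] by simp
    then have eq: "a * E * ((norm p)\<^sup>2 - (norm q)\<^sup>2) - 2 * Re (M * (LINT x|?\<mu>. cnj (dot_normal D (x - x\<^sub>0))))
      = 2 * (a * E * Re (cdot m T)) - 2 * Re (M * Z)"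
      unfolding Jint by (simp add: algebra_simps)
    have "\<bar>a * E * Re (cdot m T)\<bar> \<le> R * E * (norm m * norm T)"
      unfolding abs_mult using aR E0 R0 abs_Re_le_cmod[of "cdot m T"] norm_cdot_le[of m T]
      by (intro mult_mono) auto
    moreover have "\<bar>Re (M * Z)\<bar> \<le> R * E * (norm m * norm T)"
    proof -
      have "\<bar>Re (M * Z)\<bar> \<le> norm M * norm Z" using abs_Re_le_cmod[of "M * Z"] by (simp add: norm_mult)
      also have "\<dots> \<le> norm m * (E * (norm T * R))" using M_le Zb by (intro mult_mono) auto
      finally show ?thesis by (simp add: mult_ac)
    qed
    ultimately have "\<bar>a * E * ((norm p)\<^sup>2 - (norm q)\<^sup>2) - 2 * Re (M * (LINT x|?\<mu>. cnj (dot_normal D (x - x\<^sub>0))))\<bar>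
      \<le> E * (2 * norm m * (2 * R * norm T))" unfolding eq by (simp add: mult_ac)
    also have "\<dots> \<le> E * (\<eta> * (norm m)\<^sup>2 + (2 * R * norm T)\<^sup>2 / \<eta>)"
      using young[OF \<eta>, of "norm m" "2 * R * norm T"] E0 by (intro mult_left_mono) auto
    also have "\<dots> = \<eta> * (E * (norm m)\<^sup>2) + 2 * R\<^sup>2 * Ce / (\<epsilon> * h ^ 3) * ((norm T)\<^sup>2 * E * h\<^sup>2)"
      using pos by (simp add: \<eta>_def power2_eq_square power3_eq_cube field_simps)
    also have "\<dots> \<le> \<epsilon> * S1 + 2 * R\<^sup>2 * Ce / (\<epsilon> * h ^ 3) * (CT * I)"
      using Em T2 pos by (intro add_mono mult_left_mono) auto
    finally show ?thesis by (simp add: mult_ac)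
  qed
  have B2: "\<bar>k\<^sup>2 * (a * ((LINT x|?\<mu>. (norm (wK x))\<^sup>2) - (LINT x|?\<mu>. (norm (wL x))\<^sup>2)))\<bar>
    \<le> \<epsilon> * (k\<^sup>2 * (SK + SL)) + k\<^sup>2 * R\<^sup>2 * Ct / (2 * \<epsilon> * h) * I"
  proof -
    define \<theta> where "\<theta> = \<epsilon> * h / Ct"
    have \<theta>: "\<theta> > 0" using pos by (simp add: \<theta>_def)
    have iK: "integrable ?\<mu> (\<lambda>x. (norm (wK x))\<^sup>2)" "integrable ?\<mu> (\<lambda>x. (norm (wL x))\<^sup>2)" "integrable ?\<mu> (\<lambda>x. (norm (J x))\<^sup>2)"
      using contJ by (auto intro!: int continuous_intros)
    have wJ: "wK x - wL x = J x" for x by (simp add: wK_def wL_def J_def D_def dot_normal_left_simps)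
    have "\<bar>a * ((LINT x|?\<mu>. (norm (wK x))\<^sup>2) - (LINT x|?\<mu>. (norm (wL x))\<^sup>2))\<bar>
        = norm (LINT x|?\<mu>. a * ((norm (wK x))\<^sup>2 - (norm (wL x))\<^sup>2))"
      using iK by simp
    also have "\<dots> \<le> (LINT x|?\<mu>. \<theta> * (norm (wK x))\<^sup>2 + \<theta> * (norm (wL x))\<^sup>2 + R\<^sup>2 / (2 * \<theta>) * (norm (J x))\<^sup>2)"
    proof (rule norm_integral_le)
      fix x assume "x \<in> e"
      have "\<bar>(norm (wK x))\<^sup>2 - (norm (wL x))\<^sup>2\<bar> = (norm (wK x) + norm (wL x)) * \<bar>norm (wK x) - norm (wL x)\<bar>"
        by (simp add: power2_eq_square square_diff_square_factored abs_mult)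
      also have "\<dots> \<le> (norm (wK x) + norm (wL x)) * norm (J x)"
        unfolding wJ[symmetric] by (intro mult_left_mono norm_triangle_ineq3) auto
      finally have "norm (a * ((norm (wK x))\<^sup>2 - (norm (wL x))\<^sup>2)) \<le> R * ((norm (wK x) + norm (wL x)) * norm (J x))"
        unfolding real_norm_def abs_mult using aR R0 by (intro mult_mono) auto
      also have "\<dots> = 2 * norm (wK x) * (R * norm (J x) / 2) + 2 * norm (wL x) * (R * norm (J x) / 2)"
        by (simp add: algebra_simps)
      also have "\<dots> \<le> (\<theta> * (norm (wK x))\<^sup>2 + (R * norm (J x) / 2)\<^sup>2 / \<theta>) + (\<theta> * (norm (wL x))\<^sup>2 + (R * norm (J x) / 2)\<^sup>2 / \<theta>)"
        by (intro add_mono young \<theta>)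
      also have "\<dots> = \<theta> * (norm (wK x))\<^sup>2 + \<theta> * (norm (wL x))\<^sup>2 + R\<^sup>2 / (2 * \<theta>) * (norm (J x))\<^sup>2"
        using \<theta> by (simp add: power2_eq_square field_simps)
      finally show "norm (a * ((norm (wK x))\<^sup>2 - (norm (wL x))\<^sup>2))
          \<le> \<theta> * (norm (wK x))\<^sup>2 + \<theta> * (norm (wL x))\<^sup>2 + R\<^sup>2 / (2 * \<theta>) * (norm (J x))\<^sup>2" .
    qed (use contJ \<theta> in \<open>auto intro!: continuous_intros\<close>)
    also have "\<dots> = \<theta> * (LINT x|?\<mu>. (norm (wK x))\<^sup>2) + \<theta> * (LINT x|?\<mu>. (norm (wL x))\<^sup>2) + R\<^sup>2 / (2 * \<theta>) * I"
      unfolding I_def using iK by simp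
    also have "\<dots> \<le> \<theta> * (Ct / h * SK) + \<theta> * (Ct / h * SL) + R\<^sup>2 / (2 * \<theta>) * I"
      using trK trL \<theta> by (intro add_mono mult_left_mono) auto
    also have "\<dots> = \<epsilon> * (SK + SL) + R\<^sup>2 * Ct / (2 * \<epsilon> * h) * I"
      using pos by (simp add: \<theta>_def field_simps)
    finally have "k\<^sup>2 * \<bar>a * ((LINT x|?\<mu>. (norm (wK x))\<^sup>2) - (LINT x|?\<mu>. (norm (wL x))\<^sup>2))\<bar>
        \<le> k\<^sup>2 * (\<epsilon> * (SK + SL) + R\<^sup>2 * Ct / (2 * \<epsilon> * h) * I)" by (intro mult_left_mono) auto
    moreover have "k\<^sup>2 * (\<epsilon> * (SK + SL) + R\<^sup>2 * Ct / (2 * \<epsilon> * h) * I) = \<epsilon> * (k\<^sup>2 * (SK + SL)) + k\<^sup>2 * R\<^sup>2 * Ct / (2 * \<epsilon> * h) * I"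
      by (simp add: distrib_left distrib_right mult_ac)
    ultimately show ?thesis by (simp only: abs_mult[of "k\<^sup>2"] abs_power2)
  qed
  \<comment> \<open>The part with \<open>T\<close> needs the weight \<open>h\<close>, the part with \<open>Dn\<close> the weight \<open>sqrt (\<beta> / \<delta>)\<close>.\<close>
  have B3: "\<bar>2 * \<beta> * Im (LINT x|?\<mu>. J x * cnj (dot_normal D (x - x\<^sub>0)))\<bar>
    \<le> \<beta> * R * (1 + CT) / h * I + R * sqrt (\<beta> / \<delta>) * (\<beta> * I + \<delta> * E * (norm Dn)\<^sup>2)"
  proof -
    define s where "s = sqrt (\<beta> / \<delta>)"
    have s: "s > 0" "s\<^sup>2 = \<beta> / \<delta>" using pos by (auto simp: s_def)
    have "\<bar>Im (LINT x|?\<mu>. J x * cnj (dot_normal D (x - x\<^sub>0)))\<bar> \<le> norm (LINT x|?\<mu>. J x * cnj (dot_normal D (x - x\<^sub>0)))"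
      by (rule abs_Im_le_cmod)
    also have "\<dots> \<le> (LINT x|?\<mu>. (R / (2 * h) + R * s / 2) * (norm (J x))\<^sup>2 + (R * h / 2 * (norm T)\<^sup>2 + R * s * \<delta> / (2 * \<beta>) * (norm Dn)\<^sup>2))"
    proof (rule norm_integral_le)
      fix x assume x: "x \<in> e"
      have "norm (dot_normal D (x - x\<^sub>0)) \<le> norm T * R + R * norm Dn"
        unfolding Jv[OF x] using TR[OF x] aR
        by (intro order_trans[OF norm_triangle_ineq] add_mono) (auto simp: norm_mult intro!: mult_right_mono)
      then have "norm (J x * cnj (dot_normal D (x - x\<^sub>0))) \<le> norm (J x) * (norm T * R + R * norm Dn)"
        by (simp add: norm_mult mult_left_mono)
      also have "\<dots> = R / 2 * (2 * norm T * norm (J x)) + R / 2 * (2 * norm (J x) * norm Dn)"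
        by (simp add: algebra_simps)
      also have "\<dots> \<le> R / 2 * (h * (norm T)\<^sup>2 + (norm (J x))\<^sup>2 / h) + R / 2 * (s * (norm (J x))\<^sup>2 + (norm Dn)\<^sup>2 / s)"
        using R0 by (intro add_mono mult_left_mono young s pos) auto
      also have "1 / s = s * \<delta> / \<beta>" using s pos by (simp add: power2_eq_square field_simps)
      then have "(norm Dn)\<^sup>2 / s = s * \<delta> / \<beta> * (norm Dn)\<^sup>2" by (simp add: divide_inverse mult.commute)
      finally show "norm (J x * cnj (dot_normal D (x - x\<^sub>0)))
        \<le> (R / (2 * h) + R * s / 2) * (norm (J x))\<^sup>2 + (R * h / 2 * (norm T)\<^sup>2 + R * s * \<delta> / (2 * \<beta>) * (norm Dn)\<^sup>2)"
        by (simp add: algebra_simps add_divide_distrib)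
    qed (use contJ in \<open>auto intro!: continuous_intros\<close>)
    also have "\<dots> = (R / (2 * h) + R * s / 2) * I + E * (R * h / 2 * (norm T)\<^sup>2 + R * s * \<delta> / (2 * \<beta>) * (norm Dn)\<^sup>2)"
      unfolding I_def konst[symmetric]
      by (subst Bochner_Integration.integral_add) (use contJ in \<open>auto intro!: int continuous_intros\<close>)
    finally have "2 * \<beta> * \<bar>Im (LINT x|?\<mu>. J x * cnj (dot_normal D (x - x\<^sub>0)))\<bar>
      \<le> 2 * \<beta> * ((R / (2 * h) + R * s / 2) * I + E * (R * h / 2 * (norm T)\<^sup>2 + R * s * \<delta> / (2 * \<beta>) * (norm Dn)\<^sup>2))"
      using pos by (intro mult_left_mono) auto
    also have "\<dots> = \<beta> * R / h * I + \<beta> * R / h * ((norm T)\<^sup>2 * E * h\<^sup>2) + R * s * (\<beta> * I + \<delta> * E * (norm Dn)\<^sup>2)"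
      using pos by (simp add: power2_eq_square field_simps)
    also have "\<dots> \<le> \<beta> * R / h * I + \<beta> * R / h * (CT * I) + R * s * (\<beta> * I + \<delta> * E * (norm Dn)\<^sup>2)"
      using mult_left_mono[OF T2, of "\<beta> * R / h"] pos R0 by simp
    finally show ?thesis using pos by (simp add: s_def abs_mult algebra_simps add_divide_distrib)
  qed
  have B4: "\<bar>2 * d * Re (M * (LINT x|?\<mu>. cnj (J x)))\<bar> \<le> \<epsilon> * S1 + d\<^sup>2 * Ce / (2 * \<epsilon> * h) * I"
  proof -
    have "\<bar>2 * d * Re (M * (LINT x|?\<mu>. cnj (J x)))\<bar> \<le> norm (LINT x|?\<mu>. of_real (2 * d) * M * cnj (J x))"
      using abs_Re_le_cmod[of "of_real (2 * d) * M * (LINT x|?\<mu>. cnj (J x))"] by (simp add: mult.assoc)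
    also have "\<dots> \<le> (LINT x|?\<mu>. \<eta> * (norm m)\<^sup>2 + d\<^sup>2 / \<eta> * (norm (J x))\<^sup>2)"
    proof (rule norm_integral_le)
      fix x assume "x \<in> e"
      have "norm (of_real (2 * d) * M * cnj (J x)) = 2 * norm M * (\<bar>d\<bar> * norm (J x))"
        by (simp add: norm_mult)
      also have "\<dots> \<le> 2 * norm m * (\<bar>d\<bar> * norm (J x))" using M_le by (intro mult_right_mono) auto
      also have "\<dots> \<le> \<eta> * (norm m)\<^sup>2 + (\<bar>d\<bar> * norm (J x))\<^sup>2 / \<eta>" by (rule young[OF \<eta>])
      finally show "norm (of_real (2 * d) * M * cnj (J x)) \<le> \<eta> * (norm m)\<^sup>2 + d\<^sup>2 / \<eta> * (norm (J x))\<^sup>2"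
        by (simp add: power_mult_distrib)
    qed (use contJ \<eta> in \<open>auto intro!: continuous_intros\<close>)
    also have "\<dots> = \<eta> * (E * (norm m)\<^sup>2) + d\<^sup>2 / \<eta> * I"
      unfolding I_def by (subst Bochner_Integration.integral_add)
        (use contJ \<eta> in \<open>auto intro!: int continuous_intros simp: E_def space_facet_measure\<close>)
    also have "d\<^sup>2 / \<eta> = d\<^sup>2 * Ce / (2 * \<epsilon> * h)" using pos by (simp add: \<eta>_def field_simps)
    finally show ?thesis using Em by linarith
  qed
  have "\<bar>x1 - x2 - x3 - x4\<bar> \<le> \<bar>x1\<bar> + \<bar>x2\<bar> + \<bar>x3\<bar> + \<bar>x4\<bar>" for x1 x2 x3 x4 :: real by linarith
  from order_trans[OF this add_mono[OF add_mono[OF add_mono[OF B1 B2] B3] B4]]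
  show ?thesis unfolding M_def Dn_def by (simp only: distrib_right)
qed

section \<open>Constants of a family of meshes\<close>

text \<open>With \<open>h\<close> the diameter of a facet of \<open>K\<close>: \<open>area_const / h\<close> bounds the ratio of the area of the facet to the volume of \<open>K\<close>, \<open>norm_const\<close> is
  the constant of the \<open>L\<^sup>\<infinity>\<close>-\<open>L\<^sup>2\<close> inverse inequality on convex sets, and \<open>tangent_const\<close> that of the inverse inequality for
  tangential gradients.\<close>

definition area_const :: "nat \<Rightarrow> real \<Rightarrow> real" where
  "area_const d \<kappa> = real d * real d * width_const \<kappa> / sqrt (1 - \<kappa>\<^sup>2)"

definition norm_const :: "nat \<Rightarrow> real" where "norm_const d = 2 ^ (d + 3) + 2"

definition tangent_const :: "nat \<Rightarrow> real \<Rightarrow> real" where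
  "tangent_const d \<kappa> = 16 * (width_const \<kappa>)\<^sup>2 * norm_const d"

text \<open>Angles above \<open>\<theta>\<close> have cosines below that of \<open>min \<theta> 1\<close>; the minimum keeps this bound nonnegative and less than 1.\<close>

lemma minimal_angle_condition_simplices:
  fixes \<TT> :: "(real^'d) set set set"
  assumes dim: "CARD('d) = 2 \<or> CARD('d) = 3" and part: "\<forall>\<T>\<in>\<TT>. partition_of \<Omega> \<T>"
    and mac: "minimal_angle_condition \<TT>"
  shows "\<exists>\<kappa>. 0 \<le> \<kappa> \<and> \<kappa> < 1 \<and> (\<forall>\<T>\<in>\<TT>. \<forall>K\<in>\<T>. angle_simplex K (verts K) \<kappa>)"
proof -
  obtain \<theta> where all: "\<theta> > 0 \<and> (\<forall>\<T>\<in>\<TT>. \<forall>K\<in>\<T>.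
     (\<forall>a b c. a extreme_point_of K \<and> b extreme_point_of K \<and> c extreme_point_of K \<and>
              a \<noteq> b \<and> a \<noteq> c \<and> b \<noteq> c \<longrightarrow>
              arccos ((b - a) \<bullet> (c - a) / (norm (b - a) * norm (c - a))) \<ge> \<theta>) \<and>
     (\<forall>e f. e facet_of K \<and> f facet_of K \<and> e \<noteq> f \<longrightarrow>
              arccos (- (facet_normal K e \<bullet> facet_normal K f)) \<ge> \<theta>))"
    using mac unfolding minimal_angle_condition_def by (rule exE)
  then have \<theta>: "\<theta> > 0" by (rule conjunct1)
  have planar: "arccos ((b - a) \<bullet> (c - a) / (norm (b - a) * norm (c - a))) \<ge> \<theta>"
    if "\<T> \<in> \<TT>" "K \<in> \<T>" "a \<in> verts K" "b \<in> verts K" "c \<in> verts K" "a \<noteq> b" "a \<noteq> c" "b \<noteq> c" for \<T> K a b c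
    using all that unfolding verts_def mem_Collect_eq by meson
  have dihedral: "arccos (- (facet_normal K e \<bullet> facet_normal K f)) \<ge> \<theta>"
    if "\<T> \<in> \<TT>" "K \<in> \<T>" "e facet_of K" "f facet_of K" "e \<noteq> f" for \<T> K e f
    using all that by meson
  define t where "t = min \<theta> 1"
  have t: "0 < t" "t \<le> 1" "t \<le> \<theta>" using \<theta> by (auto simp: t_def)
  have tpi: "t < pi / 2" using t pi_gt3 by linarith
  have cos_le: "y \<le> cos t" if "\<bar>y\<bar> \<le> 1" "arccos y \<ge> \<theta>" for y
  proof -
    have "cos (arccos y) \<le> cos t"
      using that t arccos_bounded[of y] by (intro cos_monotone_0_pi_le) auto
    then show ?thesis using that(1) by (simp add: cos_arccos_abs)
  qed
  have "cos t \<ge> 0" using t tpi by (intro cos_ge_zero) auto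
  moreover have "cos t < 1" using cos_monotone_0_pi[of 0 t] t tpi by auto
  moreover have "angle_simplex K (verts K) (cos t)" if T: "\<T> \<in> \<TT>" "K \<in> \<T>" for \<T> K
  proof -
    have "int CARD('d) simplex K" using part T by (auto simp: partition_of_def)
    then interpret full_simplex K "verts K" by (rule full_simplex_verts)
    show ?thesis
    proof (unfold_locales)
      show "0 \<le> cos t" "cos t < 1" by fact+
      show "CARD('d) = 2 \<or> CARD('d) = 3" by (rule dim)
    next
      fix x y z assume xyz: "x \<in> verts K" "y \<in> verts K" "z \<in> verts K" "x \<noteq> y" "x \<noteq> z" "y \<noteq> z"
      let ?r = "(y - x) \<bullet> (z - x) / (norm (y - x) * norm (z - x))"
      have np: "norm (y - x) * norm (z - x) > 0" using xyz by simp
      have "arccos ?r \<ge> \<theta>" by (rule planar[OF T xyz])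
      moreover have "\<bar>?r\<bar> \<le> 1" using Cauchy_Schwarz_ineq2[of "y - x" "z - x"] np by (simp add: abs_mult)
      ultimately have "?r \<le> cos t" by (intro cos_le)
      then show "(y - x) \<bullet> (z - x) \<le> cos t * norm (y - x) * norm (z - x)"
        using np by (simp add: divide_le_eq mult.assoc split: if_splits)
    next
      fix c c' assume c: "c \<in> verts K" "c' \<in> verts K" "c \<noteq> c'"
      have "opp c \<noteq> opp c'" using inj_opp c by (auto simp: inj_on_def)
      then have "arccos (- (facet_normal K (opp c) \<bullet> facet_normal K (opp c'))) \<ge> \<theta>"
        using c facet_iff by (intro dihedral[OF T]) blast+
      moreover have "\<bar>- (facet_normal K (opp c) \<bullet> facet_normal K (opp c'))\<bar> \<le> 1"
        using Cauchy_Schwarz_ineq2[of "facet_normal K (opp c)" "facet_normal K (opp c')"] facet_normal_props(1) c by simp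
      ultimately show "- (facet_normal K (opp c) \<bullet> facet_normal K (opp c')) \<le> cos t" by (intro cos_le)
    qed
  qed
  ultimately show ?thesis by blast
qed

locale shape_mesh = mesh +
  fixes \<kappa> :: real
  assumes angles: "\<And>K. K \<in> \<T> \<Longrightarrow> angle_simplex K (verts K) \<kappa>" and \<kappa>: "0 \<le> \<kappa>" "\<kappa> < 1"
begin

lemma consts_pos: "area_const CARD('a) \<kappa> > 0" "(area_const CARD('a) \<kappa> * norm_const CARD('a)) > 0" "tangent_const CARD('a) \<kappa> > 0"
proof -
  have "0 < 1 - \<kappa>\<^sup>2" using \<kappa> by (simp add: abs_square_less_1)
  then have "width_const \<kappa> > 0" "sqrt (1 - \<kappa>\<^sup>2) > 0" by (simp_all add: width_const_def add_pos_nonneg)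
  then show "area_const CARD('a) \<kappa> > 0" "(area_const CARD('a) \<kappa> * norm_const CARD('a)) > 0" "tangent_const CARD('a) \<kappa> > 0"
    by (simp_all add: area_const_def tangent_const_def norm_const_def add_pos_pos)
qed

lemma
  assumes KT: "K \<in> \<T>" and e: "e facet_of K"
  shows diameter_facet_pos: "diameter e > 0"
    and facet_area_le: "measure (facet_measure e) UNIV \<le> area_const CARD('a) \<kappa> / diameter e * measure lborel K"
    and facet_trace_le: "(LINT x|facet_measure e. (norm (dot_normal g x + c))\<^sup>2)
      \<le> (area_const CARD('a) \<kappa> * norm_const CARD('a)) / diameter e * (LINT x:K|lborel. (norm (dot_normal g x + c))\<^sup>2)"
    and facet_tangent_le: "(norm (g - smul_normal (dot_normal g (facet_normal K e)) (facet_normal K e)))\<^sup>2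
      * measure (facet_measure e) UNIV * (diameter e)\<^sup>2 \<le> tangent_const CARD('a) \<kappa> * (LINT x|facet_measure e. (norm (dot_normal g x + c))\<^sup>2)"
proof -
  interpret angle_simplex K "verts K" \<kappa> by (rule angles[OF KT])
  obtain v where v: "v \<in> verts K" "e = opp v" "offset v = level K e" by (rule facet_vertex[OF KT e])
  have hp: "height v > 0" by (rule offset_props(2)[OF v(1)])
  show dp: "diameter e > 0" unfolding v(2) by (rule diameter_pos[OF v(1)])
  have s: "sqrt (1 - \<kappa>\<^sup>2) > 0" using \<kappa>2 by simp
  have inv: "CARD('a) / height v \<le> area_const CARD('a) \<kappa> / diameter e"
  proof -
    have "sqrt (1 - \<kappa>\<^sup>2) * diameter e \<le> CARD('a) * width_const \<kappa> * height v"
      unfolding v(2) by (rule height_ge_diameter[OF v(1)])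
    then have "CARD('a) * (sqrt (1 - \<kappa>\<^sup>2) * diameter e) \<le> CARD('a) * (CARD('a) * width_const \<kappa> * height v)"
      by (intro mult_left_mono) auto
    then show ?thesis using s hp dp by (simp add: area_const_def field_simps)
  qed
  have "measure (facet_measure e) UNIV = CARD('a) / height v * measure lborel K"
    using volume_eq[OF dim v(1)] hp unfolding v(2) by (simp add: field_simps)
  also have "\<dots> \<le> area_const CARD('a) \<kappa> / diameter e * measure lborel K" using inv by (intro mult_right_mono) auto
  finally show "measure (facet_measure e) UNIV \<le> area_const CARD('a) \<kappa> / diameter e * measure lborel K" .
  have i0: "0 \<le> (LINT x:K|lborel. (norm (dot_normal g x + c))\<^sup>2)"
    unfolding set_lebesgue_integral_def by (intro integral_nonneg_AE) auto
  have "(LINT x|facet_measure e. (norm (dot_normal g x + c))\<^sup>2)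
      \<le> CARD('a) * norm_const CARD('a) / height v * (LINT x:K|lborel. (norm (dot_normal g x + c))\<^sup>2)"
  proof -
    have nc: "real (CARD('a) * (2 ^ (CARD('a) + 3) + 2)) = CARD('a) * norm_const CARD('a)"
      by (simp add: norm_const_def algebra_simps)
    show ?thesis using trace_inequality[OF dim v(1), of g c] unfolding v(2)[symmetric] nc .
  qed
  also have "\<dots> = CARD('a) / height v * norm_const CARD('a) * (LINT x:K|lborel. (norm (dot_normal g x + c))\<^sup>2)"
    by simp
  also have "\<dots> \<le> area_const CARD('a) \<kappa> / diameter e * norm_const CARD('a) * (LINT x:K|lborel. (norm (dot_normal g x + c))\<^sup>2)"
    using inv i0 by (intro mult_right_mono) (auto simp: norm_const_def)
  finally show "(LINT x|facet_measure e. (norm (dot_normal g x + c))\<^sup>2)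
      \<le> (area_const CARD('a) \<kappa> * norm_const CARD('a)) / diameter e * (LINT x:K|lborel. (norm (dot_normal g x + c))\<^sup>2)" by simp
  show "(norm (g - smul_normal (dot_normal g (facet_normal K e)) (facet_normal K e)))\<^sup>2
      * measure (facet_measure e) UNIV * (diameter e)\<^sup>2 \<le> tangent_const CARD('a) \<kappa> * (LINT x|facet_measure e. (norm (dot_normal g x + c))\<^sup>2)"
    using tangential_inverse_inequality[OF v(1), of g c] unfolding v(2) tangent_const_def norm_const_def .
qed

end

context mesh begin

lemma facet_divergence:
  fixes g :: "complex^'d" and c :: complex
  assumes KT: "K \<in> \<T>"
  shows "(LINT x:K|lborel. real CARD('d) * (norm (dot_normal g x + c))\<^sup>2 + 2 * Re ((dot_normal g x + c) * cnj (dot_normal g (x - p))))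
    = (\<Sum>e | e facet_of K. (level K e - facet_normal K e \<bullet> p) * (LINT x|facet_measure e. (norm (dot_normal g x + c))\<^sup>2))"
proof -
  interpret full_simplex K "verts K" by (rule full[OF KT])
  have lev: "offset v = level K (opp v)" if v: "v \<in> verts K" for v
  proof -
    have "opp v facet_of K" using v facet_iff by blast
    then obtain u where u: "u \<in> verts K" "opp v = opp u" "offset u = level K (opp v)" by (rule facet_vertex[OF KT])
    then have "u = v" using inj_opp v by (auto simp: inj_on_def)
    then show ?thesis using u by simp
  qed
  show ?thesis
    unfolding divergence_identity[OF dim] facets_eq sum.reindex[OF inj_opp] o_def
    by (intro sum.cong) (simp_all add: lev)
qed

lemma card_facets: "K \<in> \<T> \<Longrightarrow> card {e. e facet_of K} = CARD('d) + 1"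
  using full_simplex.facets_eq[OF full] full_simplex.inj_opp[OF full] full_simplex.card[OF full]
  by (simp add: card_image)

end

section \<open>The form on interior facets\<close>

text \<open>The contribution of \<open>e\<close> to the form when \<open>\<tau> = - \<nabla>\<^sub>h v\<close>.\<close>

definition facet_form :: "(real^'d) set set \<Rightarrow> real \<Rightarrow> real \<Rightarrow> (real^'d \<Rightarrow> complex) \<Rightarrow> (real^'d \<Rightarrow> complex) \<Rightarrow> (real^'d) set \<Rightarrow> complex" where
  "facet_form \<T> \<beta> \<delta> w v e =
     - facet_vinner e (\<lambda>x. avg \<T> e (grad w) x - (\<i> * of_real \<beta>) *s jump \<T> e w x) (jump \<T> e v)
     - (\<i> * of_real \<delta> * facet_inner e (vjump \<T> e (grad w)) (vjump \<T> e (\<lambda>x. - grad v x))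
        - facet_vinner e (jump \<T> e w) (avg \<T> e (\<lambda>x. - grad v x)))"

lemma pw_const_uminus: "pw_const \<T> \<tau> H \<Longrightarrow> pw_const \<T> (\<lambda>x. - \<tau> x) (\<lambda>K. - H K)"
  by (simp add: pw_const_def)

context interior_facet begin

lemma facet_form_eq:
  assumes w: "pw_affine \<T> w G C" and v: "pw_affine \<T> v G' C'"
  defines "D \<equiv> G K - G L" and "D' \<equiv> G' K - G' L"
  defines "J \<equiv> \<lambda>x. dot_normal D x + (C K - C L)" and "J' \<equiv> \<lambda>x. dot_normal D' x + (C' K - C' L)"
  shows "facet_form \<T> \<beta> \<delta> w v e =
    - (dot_normal ((1/2) *\<^sub>R (G K + G L)) n * (LINT x|facet_measure e. cnj (J' x)))
    + \<i> * of_real \<beta> * (LINT x|facet_measure e. J x * cnj (J' x))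
    + \<i> * of_real \<delta> * (of_real (measure (facet_measure e) UNIV) * (dot_normal D n * cnj (dot_normal D' n)))
    - cnj (dot_normal ((1/2) *\<^sub>R (G' K + G' L)) n) * (LINT x|facet_measure e. J x)"
proof -
  note gw = pw_const_grad[OF w] and gv = pw_const_uminus[OF pw_const_grad[OF v]]
  let ?M = "dot_normal ((1/2) *\<^sub>R (G K + G L)) n"
  have cJ: "continuous_on UNIV J" "continuous_on UNIV J'" unfolding J_def J'_def by (intro continuous_intros)+
  have "facet_vinner e (\<lambda>x. avg \<T> e (grad w) x - (\<i> * of_real \<beta>) *s jump \<T> e w x) (jump \<T> e v)
      = (LINT x|facet_measure e. ?M * cnj (J' x) - \<i> * of_real \<beta> * (J x * cnj (J' x)))"
    unfolding flux_term[OF gw w v] J_def J'_def D_def D'_def by (simp add: left_diff_distrib mult.assoc)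
  also have "\<dots> = ?M * (LINT x|facet_measure e. cnj (J' x)) - \<i> * of_real \<beta> * (LINT x|facet_measure e. J x * cnj (J' x))"
    by (subst Bochner_Integration.integral_diff)
       (use cJ in \<open>auto intro!: integrable_facet_measure_continuous continuous_intros\<close>)
  finally have 1: "facet_vinner e (\<lambda>x. avg \<T> e (grad w) x - (\<i> * of_real \<beta>) *s jump \<T> e w x) (jump \<T> e v) = \<dots>" .
  have "- G' K - - G' L = - D'" by (simp add: D'_def)
  then have 2: "facet_inner e (vjump \<T> e (grad w)) (vjump \<T> e (\<lambda>x. - grad v x))
      = - (of_real (measure (facet_measure e) UNIV) * (dot_normal D n * cnj (dot_normal D' n)))"
    unfolding vjump_term[OF gw gv] by (simp add: D_def dot_normal_left_simps)
  have "(1/2) *\<^sub>R (- G' K + - G' L) = - ((1/2) *\<^sub>R (G' K + G' L))" by (simp add: scaleR_add_right scaleR_diff_right)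
  then have 3: "facet_vinner e (jump \<T> e w) (avg \<T> e (\<lambda>x. - grad v x))
      = - (cnj (dot_normal ((1/2) *\<^sub>R (G' K + G' L)) n) * (LINT x|facet_measure e. J x))"
    unfolding avg_term[OF w gv] by (simp only: dot_normal_left_simps(3)) (simp add: J_def D_def mult.commute)
  show ?thesis unfolding facet_form_def 1 2 3 by (simp add: algebra_simps)
qed

text \<open>The two consistency terms are minus a number and minus its conjugate, so their sum is real and the
  imaginary part consists of the penalties.\<close>

lemma facet_form_self:
  assumes w: "pw_affine \<T> w G C"
  defines "D \<equiv> G K - G L"
  defines "J \<equiv> \<lambda>x. dot_normal D x + (C K - C L)"
  shows "Re (facet_form \<T> \<beta> \<delta> w w e) = - 2 * Re (dot_normal ((1/2) *\<^sub>R (G K + G L)) n * (LINT x|facet_measure e. cnj (J x)))"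
    and "Im (facet_form \<T> \<beta> \<delta> w w e) = \<beta> * (LINT x|facet_measure e. (norm (J x))\<^sup>2)
      + \<delta> * measure (facet_measure e) UNIV * (norm (dot_normal D n))\<^sup>2"
proof -
  let ?M = "dot_normal ((1/2) *\<^sub>R (G K + G L)) n"
  let ?c = "LINT x|facet_measure e. cnj (J x)"
  have Jx: "dot_normal (G K - G L) x + (C K - C L) = J x" for x by (simp add: J_def D_def)
  have c: "(LINT x|facet_measure e. J x) = cnj ?c" by simp
  have sq: "z * cnj z = of_real ((norm z)\<^sup>2)" for z by (simp only: complex_norm_square)
  have JJ: "(LINT x|facet_measure e. J x * cnj (J x)) = of_real (LINT x|facet_measure e. (norm (J x))\<^sup>2)"
    unfolding sq by (rule integral_complex_of_real)
  have eq: "facet_form \<T> \<beta> \<delta> w w e = - (?M * ?c) + \<i> * of_real \<beta> * of_real (LINT x|facet_measure e. (norm (J x))\<^sup>2)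
    + \<i> * of_real \<delta> * (of_real (measure (facet_measure e) UNIV) * of_real ((norm (dot_normal D n))\<^sup>2)) - cnj (?M * ?c)"
    unfolding facet_form_eq[OF w w, of \<beta> \<delta>] D_def Jx JJ unfolding sq complex_cnj_mult c[symmetric] ..
  show "Re (facet_form \<T> \<beta> \<delta> w w e) = - 2 * Re (?M * ?c)"
    unfolding eq by simp
  show "Im (facet_form \<T> \<beta> \<delta> w w e) = \<beta> * (LINT x|facet_measure e. (norm (J x))\<^sup>2)
      + \<delta> * measure (facet_measure e) UNIV * (norm (dot_normal D n))\<^sup>2"
    unfolding eq by simp
qed

text \<open>Here \<open>v\<close> is the multiplier \<open>(x - p) \<bullet> \<nabla>\<^sub>h w\<close>.  Its slopes are those of \<open>w\<close>, so the second penalty is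
  purely imaginary.\<close>

lemma facet_form_multiplier:
  assumes w: "pw_affine \<T> w G C" and v: "pw_affine \<T> v G (\<lambda>K. - dot_normal (G K) p)"
  defines "D \<equiv> G K - G L"
  defines "J \<equiv> \<lambda>x. dot_normal D x + (C K - C L)"
  shows "Re (facet_form \<T> \<beta> \<delta> w v e) =
    - Re (dot_normal ((1/2) *\<^sub>R (G K + G L)) n * (LINT x|facet_measure e. cnj (dot_normal D (x - p))))
    - \<beta> * Im (LINT x|facet_measure e. J x * cnj (dot_normal D (x - p)))
    - Re (dot_normal ((1/2) *\<^sub>R (G K + G L)) n * (LINT x|facet_measure e. cnj (J x)))"
proof -
  let ?M = "dot_normal ((1/2) *\<^sub>R (G K + G L)) n"
  have Jx: "dot_normal (G K - G L) x + (C K - C L) = J x" for x by (simp add: J_def D_def)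
  have Jv: "dot_normal (G K - G L) x + (- dot_normal (G K) p - - dot_normal (G L) p) = dot_normal (G K - G L) (x - p)" for x
    by (simp add: dot_normal_left_simps dot_normal_right_simps)
  have c: "(LINT x|facet_measure e. J x) = cnj (LINT x|facet_measure e. cnj (J x))" by simp
  have sq: "z * cnj z = of_real ((norm z)\<^sup>2)" for z by (simp only: complex_norm_square)
  have eq: "facet_form \<T> \<beta> \<delta> w v e = - (?M * (LINT x|facet_measure e. cnj (dot_normal D (x - p))))
    + \<i> * of_real \<beta> * (LINT x|facet_measure e. J x * cnj (dot_normal D (x - p)))
    + \<i> * of_real \<delta> * (of_real (measure (facet_measure e) UNIV) * of_real ((norm (dot_normal D n))\<^sup>2))
    - cnj (?M * (LINT x|facet_measure e. cnj (J x)))"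
    unfolding facet_form_eq[OF w v, of \<beta> \<delta>] D_def Jv Jx sq complex_cnj_mult c[symmetric] ..
  show ?thesis unfolding eq by simp
qed

end

text \<open>The coefficients of the powers of \<open>h\<close> in \<open>interior_facet_estimate\<close>, all of which \<open>\<gamma>\<^sub>1\<close> dominates.\<close>

definition facet_const :: "nat \<Rightarrow> real \<Rightarrow> real \<Rightarrow> real \<Rightarrow> real" where
  "facet_const d \<kappa> R \<epsilon> = 2 * R\<^sup>2 * area_const d \<kappa> * tangent_const d \<kappa> / \<epsilon>
     + R\<^sup>2 * (area_const d \<kappa> * norm_const d) / (2 * \<epsilon>) + R * (1 + tangent_const d \<kappa>) + R
     + (real d)\<^sup>2 * area_const d \<kappa> / (2 * \<epsilon>)"

lemma (in mesh) interior_facetE: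
  assumes "e \<in> interior_facets \<T>"
  obtains K L where "interior_facet \<Omega> \<T> e K L"
proof -
  obtain K L where KL: "K \<in> \<T>" "L \<in> \<T>" "K \<noteq> L" "{M \<in> \<T>. e facet_of M} = {K, L}"
    "facet_normal L e = - facet_normal K e" "level L e = - level K e"
    by (rule two_elements[OF assms])
  have "interior_facet \<Omega> \<T> e K L" by (unfold_locales) (use KL in auto)
  then show ?thesis by (rule that)
qed

context shape_mesh begin

text \<open>The estimate on one interior facet in the form needed for the summation: volume terms with the small factor \<open>\<epsilon>\<close>, and the
  penalties, written as the imaginary part of \<open>facet_form\<close>, with the large factor \<open>\<gamma>\<close>.\<close>

lemma facet_contribution:
  assumes w: "pw_affine \<T> w G C" and v: "pw_affine \<T> v G (\<lambda>K. - dot_normal (G K) p)" and e: "e \<in> interior_facets \<T>"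
    and R: "\<And>M x. M \<in> \<T> \<Longrightarrow> x \<in> M \<Longrightarrow> norm (x - p) \<le> R"
    and pos: "k > 0" "\<beta> > 0" "\<delta> > 0" "\<epsilon> > 0"
    and \<gamma>: "1 + k + sqrt (\<beta> / \<delta>) + ((k\<^sup>2 + 1) / (\<beta> * diameter e) + 1 / (diameter e)\<^sup>2 + 1 / (\<beta> * diameter e ^ 3)) \<le> \<gamma>"
  shows "\<bar>(\<Sum>M | M \<in> \<T> \<and> e facet_of M. (level M e - facet_normal M e \<bullet> p) *
          ((norm (G M))\<^sup>2 * measure (facet_measure e) UNIV - k\<^sup>2 * (LINT x|facet_measure e. (norm (dot_normal (G M) x + C M))\<^sup>2)))
      + 2 * Re (facet_form \<T> \<beta> \<delta> w v e) + (real CARD('a) - 1) * Re (facet_form \<T> \<beta> \<delta> w w e)\<bar>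
    \<le> 2 * \<epsilon> * (\<Sum>M | M \<in> \<T> \<and> e facet_of M. (norm (G M))\<^sup>2 * measure lborel M + k\<^sup>2 * (LINT x:M|lborel. (norm (dot_normal (G M) x + C M))\<^sup>2))
      + facet_const CARD('a) \<kappa> R \<epsilon> * \<gamma> * Im (facet_form \<T> \<beta> \<delta> w w e)"
    and "0 \<le> Im (facet_form \<T> \<beta> \<delta> w w e)"
proof -
  obtain K L where "interior_facet \<Omega> \<T> e K L" by (rule interior_facetE[OF e])
  then interpret interior_facet \<Omega> \<T> e K L .
  define h where "h = diameter e"
  define E where "E = measure (facet_measure e) UNIV"
  define D where "D = G K - G L"
  define J where "J x = dot_normal D x + (C K - C L)" for x
  define I where "I = (LINT x|facet_measure e. (norm (J x))\<^sup>2)"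
  define Dn where "Dn = dot_normal D n"
  define QK where "QK = (LINT x:K|lborel. (norm (dot_normal (G K) x + C K))\<^sup>2)"
  define QL where "QL = (LINT x:L|lborel. (norm (dot_normal (G L) x + C L))\<^sup>2)"
  let ?Ce = "area_const CARD('a) \<kappa>" and ?Ct = "area_const CARD('a) \<kappa> * norm_const CARD('a)" and ?CT = "tangent_const CARD('a) \<kappa>"
  let ?d = "real CARD('a)"
  have h: "h > 0" unfolding h_def by (rule diameter_facet_pos[OF KT eK])
  have I0: "I \<ge> 0" and E0: "E \<ge> 0" by (simp_all add: I_def E_def)
  have Q0: "QK \<ge> 0" "QL \<ge> 0" unfolding QK_def QL_def set_lebesgue_integral_def by (intro integral_nonneg_AE; auto)+
  obtain y where y: "y \<in> e" using nonempty by blast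
  have R0: "R \<ge> 0" using R[OF KT e_sub(1)[OF y]] norm_ge_zero order_trans by blast
  have im: "Im (facet_form \<T> \<beta> \<delta> w w e) = \<beta> * I + \<delta> * E * (norm Dn)\<^sup>2"
    unfolding facet_form_self(2)[OF w] I_def J_def D_def E_def Dn_def ..
  show "0 \<le> Im (facet_form \<T> \<beta> \<delta> w w e)" unfolding im using I0 E0 pos by simp
  have bI: "\<beta> * I \<le> Im (facet_form \<T> \<beta> \<delta> w w e)" "0 \<le> \<beta> * I" unfolding im using I0 E0 pos by simp_all
  define a where "a = level K e - n \<bullet> p"
  define m where "m = (1/2) *\<^sub>R (G K + G L)"
  define AK where "AK = (LINT x|facet_measure e. (norm (dot_normal (G K) x + C K))\<^sup>2)"
  define AL where "AL = (LINT x|facet_measure e. (norm (dot_normal (G L) x + C L))\<^sup>2)"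
  note est = interior_facet_estimate[where h = h and Ce = ?Ce and Ct = ?Ct and \<epsilon> = \<epsilon> and \<beta> = \<beta> and \<delta> = \<delta> and R = R
      and x\<^sub>0 = p and p = "G K" and q = "G L" and cK = "C K" and cL = "C L" and mK = "measure lborel K" and mL = "measure lborel L"
      and SK = QK and SL = QL and CT = ?CT and k = k and d = ?d,
      folded D_def m_def, folded J_def, folded I_def E_def AK_def AL_def a_def Dn_def]
  have est': "\<bar>a * E * ((norm (G K))\<^sup>2 - (norm (G L))\<^sup>2)
      - 2 * Re (dot_normal m n * (LINT x|facet_measure e. cnj (dot_normal D (x - p))))
      - k\<^sup>2 * (a * (AK - AL))
      - 2 * \<beta> * Im (LINT x|facet_measure e. J x * cnj (dot_normal D (x - p)))
      - 2 * ?d * Re (dot_normal m n * (LINT x|facet_measure e. cnj (J x)))\<bar>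
    \<le> 2 * \<epsilon> * ((norm (G K))\<^sup>2 * measure lborel K + (norm (G L))\<^sup>2 * measure lborel L) + \<epsilon> * (k\<^sup>2 * (QK + QL))
      + (2 * R\<^sup>2 * ?Ce * ?CT / (\<epsilon> * h ^ 3) + k\<^sup>2 * R\<^sup>2 * ?Ct / (2 * \<epsilon> * h) + \<beta> * R * (1 + ?CT) / h + ?d\<^sup>2 * ?Ce / (2 * \<epsilon> * h)) * I
      + R * sqrt (\<beta> / \<delta>) * (\<beta> * I + \<delta> * E * (norm Dn)\<^sup>2)"
  proof (rule est)
    show "\<And>x. x \<in> e \<Longrightarrow> norm (x - p) \<le> R" using R[OF KT] e_sub by blast
    show "E \<le> ?Ce / h * measure lborel K" unfolding E_def h_def by (rule facet_area_le[OF KT eK])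
    show "E \<le> ?Ce / h * measure lborel L" unfolding E_def h_def by (rule facet_area_le[OF LT eL])
    show "AK \<le> ?Ct / h * QK" unfolding AK_def QK_def h_def by (rule facet_trace_le[OF KT eK])
    show "AL \<le> ?Ct / h * QL" unfolding AL_def QL_def h_def by (rule facet_trace_le[OF LT eL])
    show "(norm (D - smul_normal Dn n))\<^sup>2 * E * h\<^sup>2 \<le> ?CT * I"
      unfolding E_def h_def I_def J_def Dn_def by (rule facet_tangent_le[OF KT eK])
  qed (use h pos consts_pos in auto)
  have X: "(\<Sum>M | M \<in> \<T> \<and> e facet_of M. (level M e - facet_normal M e \<bullet> p) *
          ((norm (G M))\<^sup>2 * E - k\<^sup>2 * (LINT x|facet_measure e. (norm (dot_normal (G M) x + C M))\<^sup>2)))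
     = a * E * ((norm (G K))\<^sup>2 - (norm (G L))\<^sup>2) - k\<^sup>2 * (a * (AK - AL))"
    unfolding sum_elems by (simp add: normal_L level_L a_def AK_def AL_def algebra_simps)
  have S: "(\<Sum>M | M \<in> \<T> \<and> e facet_of M. (norm (G M))\<^sup>2 * measure lborel M + k\<^sup>2 * (LINT x:M|lborel. (norm (dot_normal (G M) x + C M))\<^sup>2))
     = (norm (G K))\<^sup>2 * measure lborel K + (norm (G L))\<^sup>2 * measure lborel L + k\<^sup>2 * (QK + QL)"
    unfolding sum_elems QK_def QL_def by (simp add: algebra_simps)
  have ff: "2 * Re (facet_form \<T> \<beta> \<delta> w v e) + (?d - 1) * Re (facet_form \<T> \<beta> \<delta> w w e)
    = - 2 * Re (dot_normal m n * (LINT x|facet_measure e. cnj (dot_normal D (x - p))))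
      - 2 * \<beta> * Im (LINT x|facet_measure e. J x * cnj (dot_normal D (x - p)))
      - 2 * ?d * Re (dot_normal m n * (LINT x|facet_measure e. cnj (J x)))"
    unfolding facet_form_multiplier[OF w v] facet_form_self(1)[OF w] m_def[symmetric] D_def[symmetric] J_def
    by (simp add: left_diff_distrib right_diff_distrib)
  \<comment> \<open>Every power of \<open>h\<close> that occurs is dominated by \<open>\<gamma>\<close>.\<close>
  have ge: "0 \<le> k" "0 \<le> sqrt (\<beta> / \<delta>)" "0 \<le> k\<^sup>2 / (\<beta> * h)" "0 \<le> 1 / (\<beta> * h)" "0 \<le> 1 / h\<^sup>2" "0 \<le> 1 / (\<beta> * h ^ 3)"
    using pos h by auto
  have \<gamma>': "1 + k + sqrt (\<beta> / \<delta>) + (k\<^sup>2 / (\<beta> * h) + 1 / (\<beta> * h) + 1 / h\<^sup>2 + 1 / (\<beta> * h ^ 3)) \<le> \<gamma>"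
    using \<gamma> unfolding h_def[symmetric] by (simp add: add_divide_distrib)
  have "1 / h \<le> 1 + 1 / h\<^sup>2"
    using young[of 1 "1 / h" "1 / 2"] h sum_squares_bound[of 1 "1 / h"] ge(5) by (simp add: power_divide)
  then have g1: "1 / h \<le> \<gamma>" using \<gamma>' ge by linarith
  have g2: "1 / (\<beta> * h ^ 3) \<le> \<gamma>" "k\<^sup>2 / (\<beta> * h) \<le> \<gamma>" "1 / (\<beta> * h) \<le> \<gamma>" "sqrt (\<beta> / \<delta>) \<le> \<gamma>"
    using \<gamma>' ge by linarith+
  have g0: "0 \<le> \<gamma>" using g1 h by (meson divide_nonneg_pos order_trans zero_le_one)
  note cp = consts_pos
  let ?F = "Im (facet_form \<T> \<beta> \<delta> w w e)"
  have mono: "c * t * (\<beta> * I) \<le> c * (\<gamma> * ?F)" if "0 \<le> c" "0 \<le> t" "t \<le> \<gamma>" for c t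
  proof -
    have "t * (\<beta> * I) \<le> \<gamma> * ?F" using that bI g0 by (intro mult_mono) auto
    then show ?thesis using that(1) by (simp add: mult.assoc mult_left_mono)
  qed
  have "2 * R\<^sup>2 * ?Ce * ?CT / \<epsilon> * (1 / (\<beta> * h ^ 3)) * (\<beta> * I) \<le> 2 * R\<^sup>2 * ?Ce * ?CT / \<epsilon> * (\<gamma> * ?F)"
    using g2 ge cp pos by (intro mono) auto
  moreover have "R\<^sup>2 * ?Ct / (2 * \<epsilon>) * (k\<^sup>2 / (\<beta> * h)) * (\<beta> * I) \<le> R\<^sup>2 * ?Ct / (2 * \<epsilon>) * (\<gamma> * ?F)"
    using g2 ge cp pos by (intro mono) auto
  moreover have "R * (1 + ?CT) * (1 / h) * (\<beta> * I) \<le> R * (1 + ?CT) * (\<gamma> * ?F)"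
    using g1 h cp R0 by (intro mono) auto
  moreover have "?d\<^sup>2 * ?Ce / (2 * \<epsilon>) * (1 / (\<beta> * h)) * (\<beta> * I) \<le> ?d\<^sup>2 * ?Ce / (2 * \<epsilon>) * (\<gamma> * ?F)"
    using g2 ge cp pos by (intro mono) auto
  moreover have "R * (sqrt (\<beta> / \<delta>) * ?F) \<le> R * (\<gamma> * ?F)"
    using g2 R0 bI by (intro mult_left_mono mult_right_mono) auto
  moreover have "(2 * R\<^sup>2 * ?Ce * ?CT / (\<epsilon> * h ^ 3) + k\<^sup>2 * R\<^sup>2 * ?Ct / (2 * \<epsilon> * h) + \<beta> * R * (1 + ?CT) / h + ?d\<^sup>2 * ?Ce / (2 * \<epsilon> * h)) * I
      + R * sqrt (\<beta> / \<delta>) * (\<beta> * I + \<delta> * E * (norm Dn)\<^sup>2)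
    = 2 * R\<^sup>2 * ?Ce * ?CT / \<epsilon> * (1 / (\<beta> * h ^ 3)) * (\<beta> * I) + R\<^sup>2 * ?Ct / (2 * \<epsilon>) * (k\<^sup>2 / (\<beta> * h)) * (\<beta> * I)
      + R * (1 + ?CT) * (1 / h) * (\<beta> * I) + ?d\<^sup>2 * ?Ce / (2 * \<epsilon>) * (1 / (\<beta> * h)) * (\<beta> * I) + R * (sqrt (\<beta> / \<delta>) * ?F)"
    unfolding im using pos h by (simp add: field_simps)
  moreover have "facet_const CARD('a) \<kappa> R \<epsilon> * \<gamma> * ?F = 2 * R\<^sup>2 * ?Ce * ?CT / \<epsilon> * (\<gamma> * ?F) + R\<^sup>2 * ?Ct / (2 * \<epsilon>) * (\<gamma> * ?F)
      + R * (1 + ?CT) * (\<gamma> * ?F) + R * (\<gamma> * ?F) + ?d\<^sup>2 * ?Ce / (2 * \<epsilon>) * (\<gamma> * ?F)"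
    unfolding facet_const_def mult.assoc[of _ \<gamma> ?F] distrib_right ..
  ultimately have rhs: "(2 * R\<^sup>2 * ?Ce * ?CT / (\<epsilon> * h ^ 3) + k\<^sup>2 * R\<^sup>2 * ?Ct / (2 * \<epsilon> * h) + \<beta> * R * (1 + ?CT) / h + ?d\<^sup>2 * ?Ce / (2 * \<epsilon> * h)) * I
      + R * sqrt (\<beta> / \<delta>) * (\<beta> * I + \<delta> * E * (norm Dn)\<^sup>2) \<le> facet_const CARD('a) \<kappa> R \<epsilon> * \<gamma> * ?F" by linarith
  have "\<epsilon> * (k\<^sup>2 * (QK + QL)) \<le> 2 * \<epsilon> * (k\<^sup>2 * (QK + QL))" using pos Q0 by simp
  then have lhs: "2 * \<epsilon> * ((norm (G K))\<^sup>2 * measure lborel K + (norm (G L))\<^sup>2 * measure lborel L) + \<epsilon> * (k\<^sup>2 * (QK + QL))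
    \<le> 2 * \<epsilon> * ((norm (G K))\<^sup>2 * measure lborel K + (norm (G L))\<^sup>2 * measure lborel L + k\<^sup>2 * (QK + QL))"
    unfolding distrib_left[of "2 * \<epsilon>"] by simp
  show "\<bar>(\<Sum>M | M \<in> \<T> \<and> e facet_of M. (level M e - facet_normal M e \<bullet> p) *
          ((norm (G M))\<^sup>2 * measure (facet_measure e) UNIV - k\<^sup>2 * (LINT x|facet_measure e. (norm (dot_normal (G M) x + C M))\<^sup>2)))
      + 2 * Re (facet_form \<T> \<beta> \<delta> w v e) + (?d - 1) * Re (facet_form \<T> \<beta> \<delta> w w e)\<bar>
    \<le> 2 * \<epsilon> * (\<Sum>M | M \<in> \<T> \<and> e facet_of M. (norm (G M))\<^sup>2 * measure lborel M + k\<^sup>2 * (LINT x:M|lborel. (norm (dot_normal (G M) x + C M))\<^sup>2))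
      + facet_const CARD('a) \<kappa> R \<epsilon> * \<gamma> * ?F"
    unfolding E_def[symmetric] X S add.assoc[of _ "2 * Re _"] ff
    using est' rhs lhs by linarith
qed

end

section \<open>Reduction to an interior penalty form\<close>

lemma cdot_self: "cdot g g = of_real ((norm g)\<^sup>2)"
  unfolding cdot_def norm_sq_vec of_real_sum by (simp only: complex_norm_square)

lemma Re_set_integral:
  assumes "set_integrable M S f"
  shows "Re (LINT x:S|M. f x) = (LINT x:S|M. Re (f x))"
  using assms integral_Re[of M "\<lambda>x. indicator S x *\<^sub>R f x"]
  by (simp add: set_lebesgue_integral_def set_integrable_def)

context mesh begin

text \<open>The two terms with \<open>\<xi>\<close> cancel for \<open>\<tau> = - \<nabla>\<^sub>h v\<close>.\<close>

lemma A_h_reduced: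
  assumes w: "pw_affine \<T> w G C" and v: "pw_affine \<T> v G' C'"
  shows "A_h \<Omega> \<T> k \<beta> \<delta> w \<xi> v (\<lambda>x. - grad v x) =
    (\<Sum>K\<in>\<T>. of_real (measure lborel K) * cdot (G K) (G' K))
    - of_real (k\<^sup>2) * (\<Sum>K\<in>\<T>. LINT x:K|lborel. (dot_normal (G K) x + C K) * cnj (dot_normal (G' K) x + C' K))
    + \<i> * of_real k * (\<Sum>K\<in>\<T>. \<Sum>e\<in>boundary_facets \<Omega> K. LINT x|facet_measure e. (dot_normal (G K) x + C K) * cnj (dot_normal (G' K) x + C' K))
    + (\<Sum>e\<in>interior_facets \<T>. facet_form \<T> \<beta> \<delta> w v e)"
proof -
  have neg: "cdot u (- z) = - cdot u z" for u z :: "complex^'d" by (simp add: cdot_def sum_negf)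
  have n1: "L2_vinner \<Omega> u (\<lambda>x. - grad v x) = - L2_vinner \<Omega> u (grad v)" for u
    unfolding L2_vinner_def neg set_lebesgue_integral_def by simp
  have gg: "L2_vinner \<Omega> (grad w) (grad v) = (\<Sum>K\<in>\<T>. of_real (measure lborel K) * cdot (G K) (G' K))"
  proof -
    have "L2_vinner \<Omega> (grad w) (grad v) = (\<Sum>K\<in>\<T>. LINT x:K|lborel. cdot (G K) (G' K))"
      unfolding L2_vinner_def
      by (rule integral_\<Omega>_broken) (use pw_const_grad[OF w] pw_const_grad[OF v] in \<open>auto simp: pw_const_def\<close>)
    also have "\<dots> = (\<Sum>K\<in>\<T>. of_real (measure lborel K) * cdot (G K) (G' K))"
      by (intro sum.cong refl)
         (simp add: set_lebesgue_integral_def borel_compact compact_K emeasure_compact_finite scaleR_conv_of_real)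
    finally show ?thesis .
  qed
  have wv: "L2_inner \<Omega> w v = (\<Sum>K\<in>\<T>. LINT x:K|lborel. (dot_normal (G K) x + C K) * cnj (dot_normal (G' K) x + C' K))"
    unfolding L2_inner_def
    by (rule integral_\<Omega>_broken) (use w v in \<open>auto simp: pw_affine_def intro!: continuous_intros\<close>)
  have bd: "bdry_inner \<Omega> \<T> w v = (\<Sum>K\<in>\<T>. \<Sum>e\<in>boundary_facets \<Omega> K. LINT x|facet_measure e. (dot_normal (G K) x + C K) * cnj (dot_normal (G' K) x + C' K))"
    unfolding bdry_inner_def
  proof (intro sum.cong refl)
    fix K e assume K: "K \<in> \<T>" and "e \<in> boundary_facets \<Omega> K"
    then have e: "e facet_of K" by (simp add: boundary_facets_def)
    have m: "(\<lambda>x. cnj (trace_from K v x)) \<in> borel_measurable borel"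
      by (rule measurable_compose[OF trace_pw_affine_measurable[OF v K] borel_measurable_continuous_onI]) (intro continuous_intros)
    show "facet_inner e (trace_from K w) (trace_from K v) = (LINT x|facet_measure e. (dot_normal (G K) x + C K) * cnj (dot_normal (G' K) x + C' K))"
      unfolding facet_inner_def
    proof (rule facet_integral_cong[OF K e])
      show "(\<lambda>x. trace_from K w x * cnj (trace_from K v x)) \<in> borel_measurable borel"
        by (intro borel_measurable_times trace_pw_affine_measurable[OF w K] m)
      show "continuous_on UNIV (\<lambda>x. (dot_normal (G K) x + C K) * cnj (dot_normal (G' K) x + C' K))"
        by (intro continuous_intros)
      fix x assume "x \<in> e"
      then have "x \<in> K" using facet_subset[OF e] by blast
      then show "trace_from K w x * cnj (trace_from K v x) = (dot_normal (G K) x + C K) * cnj (dot_normal (G' K) x + C' K)"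
        by (simp add: trace_pw_affine[OF w K] trace_pw_affine[OF v K])
    qed
  qed
  show ?thesis
    unfolding A_h_def n1 gg wv bd facet_form_def sum_subtractf sum_negf by simp
qed

text \<open>The squares of the four parts of the DG norm, in terms of coefficients.\<close>

definition vol_sq :: "((real^'d) set \<Rightarrow> complex^'d) \<Rightarrow> ((real^'d) set \<Rightarrow> complex) \<Rightarrow> real" where
  "vol_sq G C = (\<Sum>K\<in>\<T>. LINT x:K|lborel. (norm (dot_normal (G K) x + C K))\<^sup>2)"

definition grad_sq :: "((real^'d) set \<Rightarrow> complex^'d) \<Rightarrow> real" where
  "grad_sq G = (\<Sum>K\<in>\<T>. (norm (G K))\<^sup>2 * measure lborel K)"

definition bdry_sq :: "((real^'d) set \<Rightarrow> complex^'d) \<Rightarrow> ((real^'d) set \<Rightarrow> complex) \<Rightarrow> real" where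
  "bdry_sq G C = (\<Sum>K\<in>\<T>. \<Sum>e\<in>boundary_facets \<Omega> K. LINT x|facet_measure e. (norm (dot_normal (G K) x + C K))\<^sup>2)"

definition bdry_grad_sq :: "((real^'d) set \<Rightarrow> complex^'d) \<Rightarrow> real" where
  "bdry_grad_sq G = (\<Sum>K\<in>\<T>. \<Sum>e\<in>boundary_facets \<Omega> K. (norm (G K))\<^sup>2 * measure (facet_measure e) UNIV)"

lemma sq_nonneg: "0 \<le> vol_sq G C" "0 \<le> grad_sq G" "0 \<le> bdry_sq G C" "0 \<le> bdry_grad_sq G"
  unfolding vol_sq_def grad_sq_def bdry_sq_def bdry_grad_sq_def set_lebesgue_integral_def
  by (auto intro!: sum_nonneg integral_nonneg_AE)

lemma L2_norm_sq: "pw_affine \<T> v G C \<Longrightarrow> (L2_norm \<Omega> v)\<^sup>2 = vol_sq G C"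
proof -
  assume v: "pw_affine \<T> v G C"
  have "(LINT x:\<Omega>|lebesgue. (norm (v x))\<^sup>2) = vol_sq G C"
    unfolding vol_sq_def
    by (rule integral_\<Omega>_broken) (use v in \<open>auto simp: pw_affine_def intro!: continuous_intros\<close>)
  then show ?thesis using sq_nonneg(1)[of G C] by (simp add: L2_norm_def)
qed

lemma DG_norm_sq:
  assumes v: "pw_affine \<T> v G C" and c: "0 \<le> c"
  shows "(DG_norm \<Omega> c \<T> k v)\<^sup>2 = k\<^sup>2 * vol_sq G C + k\<^sup>2 * bdry_sq G C + c * bdry_grad_sq G + grad_sq G"
    and "0 \<le> DG_norm \<Omega> c \<T> k v"
proof -
  note g = pw_const_grad[OF v]
  have "(\<Sum>K\<in>\<T>. \<Sum>e\<in>boundary_facets \<Omega> K. LINT x|facet_measure e. (norm (trace_from K v x))\<^sup>2) = bdry_sq G C"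
    unfolding bdry_sq_def
  proof (intro sum.cong refl)
    fix K e assume K: "K \<in> \<T>" and "e \<in> boundary_facets \<Omega> K"
    then have e: "e facet_of K" by (simp add: boundary_facets_def)
    have m: "(\<lambda>x. (norm (trace_from K v x))\<^sup>2) \<in> borel_measurable borel"
      by (rule measurable_compose[OF trace_pw_affine_measurable[OF v K] borel_measurable_continuous_onI]) (intro continuous_intros)
    show "(LINT x|facet_measure e. (norm (trace_from K v x))\<^sup>2) = (LINT x|facet_measure e. (norm (dot_normal (G K) x + C K))\<^sup>2)"
      by (rule facet_integral_cong[OF K e m])
         (use facet_subset[OF e] in \<open>auto simp: trace_pw_affine[OF v K] intro!: continuous_intros\<close>)
  qed
  then have b: "(bdry_norm \<Omega> \<T> v)\<^sup>2 = bdry_sq G C" using sq_nonneg(3)[of G C] by (simp add: bdry_norm_def)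
  have "(\<Sum>K\<in>\<T>. \<Sum>e\<in>boundary_facets \<Omega> K. LINT x|facet_measure e. (norm (trace_from K (grad v) x))\<^sup>2) = bdry_grad_sq G"
    unfolding bdry_grad_sq_def
  proof (intro sum.cong refl)
    fix K e assume K: "K \<in> \<T>" and "e \<in> boundary_facets \<Omega> K"
    then have e: "e facet_of K" by (simp add: boundary_facets_def)
    have m: "(\<lambda>x. (norm (trace_from K (grad v) x))\<^sup>2) \<in> borel_measurable borel"
      by (rule measurable_compose[OF trace_pw_const_measurable[OF g K] borel_measurable_continuous_onI]) (intro continuous_intros)
    have "(LINT x|facet_measure e. (norm (trace_from K (grad v) x))\<^sup>2) = (LINT x|facet_measure e. (norm (G K))\<^sup>2)"
      by (rule facet_integral_cong[OF K e m])
         (use facet_subset[OF e] in \<open>auto simp: trace_pw_const[OF g K] intro!: continuous_intros\<close>)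
    then show "(LINT x|facet_measure e. (norm (trace_from K (grad v) x))\<^sup>2) = (norm (G K))\<^sup>2 * measure (facet_measure e) UNIV"
      by (simp add: flat_facet.space_facet_measure[OF flat[OF K e]])
  qed
  then have bg: "(bdry_norm \<Omega> \<T> (grad v))\<^sup>2 = bdry_grad_sq G" using sq_nonneg(4)[of G] by (simp add: bdry_norm_def)
  have "(L2_norm K (grad v))\<^sup>2 = (norm (G K))\<^sup>2 * measure lborel K" if K: "K \<in> \<T>" for K
  proof -
    have "(LINT x:K|lebesgue. (norm (grad v x))\<^sup>2) = (LINT x:K|lborel. (norm (G K))\<^sup>2)"
      by (rule full_simplex.integral_broken[OF full[OF K]])
         (use g K interior_subset in \<open>auto simp: pw_const_def intro!: continuous_intros\<close>)
    also have "\<dots> = (norm (G K))\<^sup>2 * measure lborel K"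
      by (simp add: set_lebesgue_integral_def borel_compact compact_K[OF K] emeasure_compact_finite)
    finally show ?thesis by (simp add: L2_norm_def)
  qed
  then have "(\<Sum>K\<in>\<T>. (L2_norm K (grad v))\<^sup>2) = grad_sq G" by (simp add: grad_sq_def)
  then have h: "(H1_seminorm \<T> v)\<^sup>2 = grad_sq G" using sq_nonneg(2)[of G] by (simp add: H1_seminorm_def)
  have "0 \<le> k\<^sup>2 * vol_sq G C + k\<^sup>2 * bdry_sq G C + c * bdry_grad_sq G + grad_sq G"
    using sq_nonneg c by (intro add_nonneg_nonneg mult_nonneg_nonneg) auto
  then show "(DG_norm \<Omega> c \<T> k v)\<^sup>2 = k\<^sup>2 * vol_sq G C + k\<^sup>2 * bdry_sq G C + c * bdry_grad_sq G + grad_sq G"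
    and "0 \<le> DG_norm \<Omega> c \<T> k v"
    unfolding DG_norm_def L2_norm_sq[OF v] b bg h by simp_all
qed

text \<open>This settles the test functions of norm zero: they vanish in all elements, hence so do their traces and gradients.\<close>

lemma pw_affine_zero_of_L2_norm_zero:
  assumes v: "pw_affine \<T> v G C" and z: "L2_norm \<Omega> v = 0"
  shows "pw_affine \<T> v (\<lambda>_. 0) (\<lambda>_. 0)"
proof -
  have "vol_sq G C = 0" using L2_norm_sq[OF v] z by simp
  moreover have nn: "0 \<le> (LINT x:K|lborel. (norm (dot_normal (G K) x + C K))\<^sup>2)" for K
    unfolding set_lebesgue_integral_def by (intro integral_nonneg_AE) auto
  ultimately have "\<forall>K\<in>\<T>. (LINT x:K|lborel. (norm (dot_normal (G K) x + C K))\<^sup>2) = 0"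
    unfolding vol_sq_def by (subst (asm) sum_nonneg_eq_0_iff[OF fin nn])
  then have zK: "(LINT x:K|lborel. (norm (dot_normal (G K) x + C K))\<^sup>2) = 0" if "K \<in> \<T>" for K
    using that by (rule bspec)
  have "v x = 0" if KT: "K \<in> \<T>" and x: "x \<in> interior K" for K x
  proof -
    interpret full_simplex K "verts K" by (rule full[OF KT])
    have "x \<in> K" using x interior_subset by blast
    then have "measure lborel K * (norm (dot_normal (G K) x + C K))\<^sup>2 \<le> 0"
      using norm_sq_le_integral[of x "G K" "C K"] zK[OF KT] by simp
    then have "dot_normal (G K) x + C K = 0" using measure_K by (simp add: mult_le_0_iff)
    moreover have "v x = dot_normal (G K) x + C K" using v KT x unfolding pw_affine_def by blast
    ultimately show ?thesis by simp
  qed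
  then show ?thesis by (simp add: pw_affine_def dot_normal_def)
qed

lemma A_h_zero:
  assumes w: "pw_affine \<T> w G C" and v: "pw_affine \<T> v (\<lambda>_. 0) (\<lambda>_. 0)"
  shows "A_h \<Omega> \<T> k \<beta> \<delta> w \<xi> v (\<lambda>x. - grad v x) = 0"
proof -
  have z: "dot_normal 0 x = 0" for x :: "real^'d" by (simp add: dot_normal_def)
  have "facet_form \<T> \<beta> \<delta> w v e = 0" if e: "e \<in> interior_facets \<T>" for e
  proof -
    obtain K L where "interior_facet \<Omega> \<T> e K L" by (rule interior_facetE[OF e])
    then show ?thesis using interior_facet.facet_form_eq[OF _ w v] by (simp add: z)
  qed
  moreover have "cdot u 0 = 0" for u :: "complex^'d" by (simp add: cdot_def)
  ultimately show ?thesis unfolding A_h_reduced[OF w v] by (simp add: z)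
qed

end

section \<open>The Rellich multiplier\<close>

context shape_mesh begin

text \<open>The divergence theorem for the fields \<open>(x - p) |\<nabla>w|\<^sup>2\<close>, where \<open>|\<nabla>w|\<^sup>2\<close> is constant on an element, and \<open>(x - p) |w|\<^sup>2\<close>.\<close>

lemma rellich_identity:
  assumes w: "pw_affine \<T> w G C"
  shows "(\<Sum>K\<in>\<T>. \<Sum>e | e facet_of K. (level K e - facet_normal K e \<bullet> p) *
      ((norm (G K))\<^sup>2 * measure (facet_measure e) UNIV - k\<^sup>2 * (LINT x|facet_measure e. (norm (dot_normal (G K) x + C K))\<^sup>2)))
    = real CARD('a) * grad_sq G - k\<^sup>2 * (real CARD('a) * vol_sq G C
        + 2 * Re (\<Sum>K\<in>\<T>. LINT x:K|lborel. (dot_normal (G K) x + C K) * cnj (dot_normal (G K) x + - dot_normal (G K) p)))"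
proof -
  let ?d = "real CARD('a)"
  have "(\<Sum>e | e facet_of K. (level K e - facet_normal K e \<bullet> p) *
      ((norm (G K))\<^sup>2 * measure (facet_measure e) UNIV - k\<^sup>2 * (LINT x|facet_measure e. (norm (dot_normal (G K) x + C K))\<^sup>2)))
    = ?d * ((norm (G K))\<^sup>2 * measure lborel K) - k\<^sup>2 * (?d * (LINT x:K|lborel. (norm (dot_normal (G K) x + C K))\<^sup>2)
      + 2 * Re (LINT x:K|lborel. (dot_normal (G K) x + C K) * cnj (dot_normal (G K) x + - dot_normal (G K) p)))"
    if K: "K \<in> \<T>" for K
  proof -
    let ?w = "\<lambda>x. dot_normal (G K) x + C K" and ?v = "\<lambda>x. dot_normal (G K) x + - dot_normal (G K) p"
    let ?\<alpha> = "\<lambda>e. level K e - facet_normal K e \<bullet> p"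
    have cK: "compact K" by (rule compact_K[OF K])
    have iw: "set_integrable lborel K (\<lambda>x. (norm (?w x))\<^sup>2)" and iwv: "set_integrable lborel K (\<lambda>x. ?w x * cnj (?v x))"
      and ir: "set_integrable lborel K (\<lambda>x. Re (?w x * cnj (?v x)))"
      by (intro set_integrable_lborel_continuous cK continuous_intros)+
    have sp: "space (facet_measure e) = UNIV" if "e facet_of K" for e by (rule flat_facet.space_facet_measure[OF flat[OF K that]])
    have 1: "?d * measure lborel K = (\<Sum>e | e facet_of K. ?\<alpha> e * measure (facet_measure e) UNIV)"
    proof -
      have "?d * measure lborel K = (LINT x:K|lborel. ?d * (norm (dot_normal 0 x + 1 :: complex))\<^sup>2 + 2 * Re ((dot_normal 0 x + 1) * cnj (dot_normal 0 (x - p))))"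
        using cK by (simp add: dot_normal_def set_lebesgue_integral_def borel_compact emeasure_compact_finite)
      also have "\<dots> = (\<Sum>e | e facet_of K. ?\<alpha> e * (LINT x|facet_measure e. (norm (dot_normal 0 x + 1 :: complex))\<^sup>2))"
        by (rule facet_divergence[OF K])
      also have "\<dots> = (\<Sum>e | e facet_of K. ?\<alpha> e * measure (facet_measure e) UNIV)"
        by (intro sum.cong) (auto simp: dot_normal_def sp)
      finally show ?thesis .
    qed
    have 2: "?d * (LINT x:K|lborel. (norm (?w x))\<^sup>2) + 2 * Re (LINT x:K|lborel. ?w x * cnj (?v x))
      = (\<Sum>e | e facet_of K. ?\<alpha> e * (LINT x|facet_measure e. (norm (?w x))\<^sup>2))"
    proof -
      have "?d * (LINT x:K|lborel. (norm (?w x))\<^sup>2) + 2 * Re (LINT x:K|lborel. ?w x * cnj (?v x))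
        = (LINT x:K|lborel. ?d * (norm (?w x))\<^sup>2 + 2 * Re (?w x * cnj (?v x)))"
        unfolding Re_set_integral[OF iwv]
        by (subst set_integral_add) (use iw ir in \<open>auto simp del: times_complex.sel\<close>)
      also have "\<dots> = (LINT x:K|lborel. ?d * (norm (?w x))\<^sup>2 + 2 * Re (?w x * cnj (dot_normal (G K) (x - p))))"
        by (simp add: dot_normal_right_simps)
      also have "\<dots> = (\<Sum>e | e facet_of K. ?\<alpha> e * (LINT x|facet_measure e. (norm (?w x))\<^sup>2))"
        by (rule facet_divergence[OF K])
      finally show ?thesis .
    qed
    have "(\<Sum>e | e facet_of K. ?\<alpha> e * ((norm (G K))\<^sup>2 * measure (facet_measure e) UNIV - k\<^sup>2 * (LINT x|facet_measure e. (norm (?w x))\<^sup>2)))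
      = (norm (G K))\<^sup>2 * (\<Sum>e | e facet_of K. ?\<alpha> e * measure (facet_measure e) UNIV)
        - k\<^sup>2 * (\<Sum>e | e facet_of K. ?\<alpha> e * (LINT x|facet_measure e. (norm (?w x))\<^sup>2))"
      unfolding sum_distrib_left sum_subtractf[symmetric] by (intro sum.cong) (auto simp: right_diff_distrib mult_ac)
    then show ?thesis unfolding 1[symmetric] 2[symmetric] by (simp add: mult_ac)
  qed
  then have "(\<Sum>K\<in>\<T>. \<Sum>e | e facet_of K. (level K e - facet_normal K e \<bullet> p) *
      ((norm (G K))\<^sup>2 * measure (facet_measure e) UNIV - k\<^sup>2 * (LINT x|facet_measure e. (norm (dot_normal (G K) x + C K))\<^sup>2)))
    = (\<Sum>K\<in>\<T>. ?d * ((norm (G K))\<^sup>2 * measure lborel K) - k\<^sup>2 * (?d * (LINT x:K|lborel. (norm (dot_normal (G K) x + C K))\<^sup>2)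
      + 2 * Re (LINT x:K|lborel. (dot_normal (G K) x + C K) * cnj (dot_normal (G K) x + - dot_normal (G K) p))))"
    by (intro sum.cong refl)
  then show ?thesis
    by (simp only: grad_sq_def vol_sq_def sum_subtractf sum.distrib sum_distrib_left Re_sum distrib_left)
qed

text \<open>Star-shapedness makes the gradient term positive.  Half of it absorbs the gradient in the impedance term,
  by Young's inequality with weight \<open>c / 2\<close>.\<close>

lemma boundary_contribution:
  assumes star: "strictly_star_shaped \<Omega> p c" and K: "K \<in> \<T>" and e: "e \<in> boundary_facets \<Omega> K"
    and R: "\<And>M x. M \<in> \<T> \<Longrightarrow> x \<in> M \<Longrightarrow> norm (x - p) \<le> R" and k: "k > 0"
  shows "(level K e - facet_normal K e \<bullet> p) *
      ((norm g)\<^sup>2 * measure (facet_measure e) UNIV - k\<^sup>2 * (LINT x|facet_measure e. (norm (dot_normal g x + a))\<^sup>2))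
      + 2 * Re (\<i> * of_real k * (LINT x|facet_measure e. (dot_normal g x + a) * cnj (dot_normal g x + - dot_normal g p)))
    \<ge> c / 2 * ((norm g)\<^sup>2 * measure (facet_measure e) UNIV)
      - k\<^sup>2 * (R + 2 * R\<^sup>2 / c) * (LINT x|facet_measure e. (norm (dot_normal g x + a))\<^sup>2)"
proof -
  have eK: "e facet_of K" using e by (simp add: boundary_facets_def)
  interpret flat_facet e "facet_normal K e" "level K e" by (rule flat[OF K eK])
  let ?\<alpha> = "level K e - facet_normal K e \<bullet> p" and ?E = "measure (facet_measure e) UNIV"
  let ?w = "\<lambda>x. dot_normal g x + a" and ?v = "\<lambda>x. dot_normal g x + - dot_normal g p"
  define W where "W = (LINT x|facet_measure e. (norm (?w x))\<^sup>2)"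
  have W0: "W \<ge> 0" by (simp add: W_def)
  have cp: "c > 0" using star by (simp add: strictly_star_shaped_def)
  have \<alpha>: "c \<le> ?\<alpha>" by (rule level_star_shaped[OF star K e])
  obtain y where y: "y \<in> e" using nonempty by blast
  have Re: "norm (x - p) \<le> R" if "x \<in> e" for x using R[OF K] facet_subset[OF eK] that by blast
  have R0: "R \<ge> 0" using Re[OF y] norm_ge_zero order_trans by blast
  have \<alpha>R: "?\<alpha> \<le> R"
  proof -
    have "?\<alpha> = facet_normal K e \<bullet> (y - p)" using in_hyperplane[OF y] by (simp add: inner_diff_right)
    also have "\<dots> \<le> 1 * norm (y - p)" using norm_cauchy_schwarz[of "facet_normal K e" "y - p"] unit by simp
    finally show ?thesis using Re[OF y] by simp
  qed
  have "norm (LINT x|facet_measure e. of_real (2 * k) * (?w x * cnj (?v x))) \<le> (LINT x|facet_measure e. c / 2 * (norm g)\<^sup>2 + 2 * k\<^sup>2 * R\<^sup>2 / c * (norm (?w x))\<^sup>2)"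
  proof (rule norm_integral_le)
    fix x assume x: "x \<in> e"
    have "norm (?v x) \<le> norm g * R"
    proof -
      have "?v x = dot_normal g (x - p)" by (simp add: dot_normal_right_simps)
      then have "norm (?v x) \<le> norm g * norm (x - p)" using norm_dot_normal_le by metis
      also have "\<dots> \<le> norm g * R" using Re[OF x] by (intro mult_left_mono) auto
      finally show ?thesis .
    qed
    then have "2 * k * (norm (?w x) * norm (?v x)) \<le> 2 * k * (norm (?w x) * (norm g * R))"
      using k by (intro mult_left_mono) auto
    moreover have "norm (of_real (2 * k) * (a * cnj b)) = 2 * k * (norm a * norm b)" for a b :: complex
      using k by (simp add: norm_mult)
    ultimately have "norm (of_real (2 * k) * (?w x * cnj (?v x))) \<le> 2 * k * (norm (?w x) * (norm g * R))" by (simp only:)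
    also have "\<dots> = 2 * norm g * (k * R * norm (?w x))" by (simp add: mult_ac)
    also have "\<dots> \<le> c / 2 * (norm g)\<^sup>2 + (k * R * norm (?w x))\<^sup>2 / (c / 2)" by (rule young) (use cp in simp)
    also have "(k * R * norm (?w x))\<^sup>2 / (c / 2) = 2 * k\<^sup>2 * R\<^sup>2 / c * (norm (?w x))\<^sup>2"
      by (simp add: power_mult_distrib)
    finally show "norm (of_real (2 * k) * (?w x * cnj (?v x))) \<le> c / 2 * (norm g)\<^sup>2 + 2 * k\<^sup>2 * R\<^sup>2 / c * (norm (?w x))\<^sup>2" .
  qed (use cp in \<open>auto intro!: continuous_intros\<close>)
  also have "\<dots> = c / 2 * ((norm g)\<^sup>2 * ?E) + 2 * k\<^sup>2 * R\<^sup>2 / c * W"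
    unfolding W_def
    by (subst Bochner_Integration.integral_add)
       (use cp in \<open>auto intro!: integrable_facet_measure_continuous continuous_intros simp: space_facet_measure\<close>)
  finally have b: "norm (of_real (2 * k) * (LINT x|facet_measure e. ?w x * cnj (?v x))) \<le> c / 2 * ((norm g)\<^sup>2 * ?E) + 2 * k\<^sup>2 * R\<^sup>2 / c * W"
    by (simp only: integral_mult_right_zero)
  define Z where "Z = (LINT x|facet_measure e. ?w x * cnj (?v x))"
  have "\<bar>2 * Re (\<i> * of_real k * Z)\<bar> \<le> norm (of_real (2 * k) * Z)"
    using abs_Im_le_cmod[of Z] k by (simp add: norm_mult abs_mult)
  then have b': "- (c / 2 * ((norm g)\<^sup>2 * ?E) + 2 * k\<^sup>2 * R\<^sup>2 / c * W) \<le> 2 * Re (\<i> * of_real k * Z)"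
    using b unfolding Z_def[symmetric] by linarith
  have "c * ((norm g)\<^sup>2 * ?E) \<le> ?\<alpha> * ((norm g)\<^sup>2 * ?E)" using \<alpha> by (intro mult_right_mono) auto
  moreover have "?\<alpha> * (k\<^sup>2 * W) \<le> R * (k\<^sup>2 * W)" using \<alpha>R W0 by (intro mult_right_mono) auto
  moreover have "k\<^sup>2 * (R + 2 * R\<^sup>2 / c) * W = R * (k\<^sup>2 * W) + 2 * k\<^sup>2 * R\<^sup>2 / c * W" by (simp add: algebra_simps)
  ultimately show ?thesis
    using b' unfolding Z_def[symmetric] W_def[symmetric] right_diff_distrib by linarith
qed

lemma gamma1_ge:
  assumes "e \<in> interior_facets \<T>"
  shows "1 + k + sqrt (\<beta> / \<delta>) + ((k\<^sup>2 + 1) / (\<beta> * diameter e) + 1 / (diameter e)\<^sup>2 + 1 / (\<beta> * diameter e ^ 3)) \<le> \<gamma>\<^sub>1 \<T> k \<beta> \<delta>"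
  unfolding \<gamma>\<^sub>1_def using assms finite_interior_facets by (intro add_left_mono Max_ge) auto

lemma gamma1_ge_base: "0 < \<beta> \<Longrightarrow> 0 < \<delta> \<Longrightarrow> 1 + k \<le> \<gamma>\<^sub>1 \<T> k \<beta> \<delta>"
proof -
  assume "0 < \<beta>" "0 < \<delta>"
  then have "0 \<le> sqrt (\<beta> / \<delta>)" by simp
  moreover have "0 \<le> Max (insert 0 ((\<lambda>e. (k\<^sup>2 + 1) / (\<beta> * diameter e) + 1 / (diameter e)\<^sup>2 + 1 / (\<beta> * (diameter e) ^ 3)) ` interior_facets \<T>))"
    using finite_interior_facets by (intro Max_ge) auto
  ultimately show ?thesis unfolding \<gamma>\<^sub>1_def by linarith
qed

lemma Im_A_h_self:
  assumes w: "pw_affine \<T> w G C"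
  shows "Im (A_h \<Omega> \<T> k \<beta> \<delta> w \<xi> w (\<lambda>x. - grad w x)) = k * bdry_sq G C + (\<Sum>e\<in>interior_facets \<T>. Im (facet_form \<T> \<beta> \<delta> w w e))"
    and "Re (A_h \<Omega> \<T> k \<beta> \<delta> w \<xi> w (\<lambda>x. - grad w x)) = grad_sq G - k\<^sup>2 * vol_sq G C + (\<Sum>e\<in>interior_facets \<T>. Re (facet_form \<T> \<beta> \<delta> w w e))"
proof -
  have sq: "z * cnj z = of_real ((norm z)\<^sup>2)" for z by (simp only: complex_norm_square)
  have 1: "(\<Sum>K\<in>\<T>. of_real (measure lborel K) * cdot (G K) (G K)) = of_real (grad_sq G)"
    by (simp add: grad_sq_def cdot_self mult.commute)
  have 2: "(\<Sum>K\<in>\<T>. LINT x:K|lborel. (dot_normal (G K) x + C K) * cnj (dot_normal (G K) x + C K)) = of_real (vol_sq G C)"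
    unfolding sq vol_sq_def of_real_sum set_lebesgue_integral_def
    by (simp add: scaleR_conv_of_real integral_complex_of_real[symmetric])
  have 3: "(\<Sum>K\<in>\<T>. \<Sum>e\<in>boundary_facets \<Omega> K. LINT x|facet_measure e. (dot_normal (G K) x + C K) * cnj (dot_normal (G K) x + C K)) = of_real (bdry_sq G C)"
    unfolding sq bdry_sq_def of_real_sum integral_complex_of_real ..
  note eq = A_h_reduced[OF w w, of k \<beta> \<delta> \<xi>, unfolded 1 2 3]
  show "Im (A_h \<Omega> \<T> k \<beta> \<delta> w \<xi> w (\<lambda>x. - grad w x)) = k * bdry_sq G C + (\<Sum>e\<in>interior_facets \<T>. Im (facet_form \<T> \<beta> \<delta> w w e))"
    unfolding eq by simp
  show "Re (A_h \<Omega> \<T> k \<beta> \<delta> w \<xi> w (\<lambda>x. - grad w x)) = grad_sq G - k\<^sup>2 * vol_sq G C + (\<Sum>e\<in>interior_facets \<T>. Re (facet_form \<T> \<beta> \<delta> w w e))"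
    unfolding eq by simp
qed

text \<open>The factor \<open>d - 1\<close> balances the two test functions: in the sum the Rellich identity leaves
  \<open>|\<nabla>\<^sub>h w|\<^sup>2\<close> and \<open>k\<^sup>2 |w|\<^sup>2\<close> each with coefficient 1.  A simplex has \<open>d + 1\<close> facets, so the choice of \<open>\<epsilon>\<close> makes the volume terms lost
  on interior facets half of what is gained.\<close>

lemma rellich_lower_bound:
  assumes w: "pw_affine \<T> w G C" and v: "pw_affine \<T> v G (\<lambda>K. - dot_normal (G K) p)"
    and star: "strictly_star_shaped \<Omega> p c"
    and R: "\<And>M x. M \<in> \<T> \<Longrightarrow> x \<in> M \<Longrightarrow> norm (x - p) \<le> R"
    and pos: "k > 0" "\<beta> > 0" "\<delta> > 0"
  defines "\<epsilon> \<equiv> 1 / (4 * (real CARD('a) + 1))"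
  shows "2 * Re (A_h \<Omega> \<T> k \<beta> \<delta> w \<xi> v (\<lambda>x. - grad v x)) + (real CARD('a) - 1) * Re (A_h \<Omega> \<T> k \<beta> \<delta> w \<xi> w (\<lambda>x. - grad w x))
    \<ge> (grad_sq G + k\<^sup>2 * vol_sq G C) / 2 + c / 2 * bdry_grad_sq G - k\<^sup>2 * (R + 2 * R\<^sup>2 / c) * bdry_sq G C
      - facet_const CARD('a) \<kappa> R \<epsilon> * \<gamma>\<^sub>1 \<T> k \<beta> \<delta> * (\<Sum>e\<in>interior_facets \<T>. Im (facet_form \<T> \<beta> \<delta> w w e))"
proof -
  let ?d = "real CARD('a)" and ?\<gamma> = "\<gamma>\<^sub>1 \<T> k \<beta> \<delta>"
  have \<epsilon>: "\<epsilon> > 0" by (simp add: \<epsilon>_def add_pos_pos)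
  define FK where "FK K e = (level K e - facet_normal K e \<bullet> p) *
      ((norm (G K))\<^sup>2 * measure (facet_measure e) UNIV - k\<^sup>2 * (LINT x|facet_measure e. (norm (dot_normal (G K) x + C K))\<^sup>2))" for K e
  define SK where "SK K = (norm (G K))\<^sup>2 * measure lborel K + k\<^sup>2 * (LINT x:K|lborel. (norm (dot_normal (G K) x + C K))\<^sup>2)" for K
  define X where "X e = (\<Sum>M | M \<in> \<T> \<and> e facet_of M. FK M e)
      + 2 * Re (facet_form \<T> \<beta> \<delta> w v e) + (?d - 1) * Re (facet_form \<T> \<beta> \<delta> w w e)" for e
  define BI where "BI K e = (LINT x|facet_measure e. (dot_normal (G K) x + C K) * cnj (dot_normal (G K) x + - dot_normal (G K) p))" for K e
  define RV where "RV = Re (\<Sum>K\<in>\<T>. LINT x:K|lborel. (dot_normal (G K) x + C K) * cnj (dot_normal (G K) x + - dot_normal (G K) p))"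
  have tot: "(\<Sum>e\<in>interior_facets \<T>. \<Sum>M | M \<in> \<T> \<and> e facet_of M. FK M e) + (\<Sum>K\<in>\<T>. \<Sum>e\<in>boundary_facets \<Omega> K. FK K e)
      = ?d * grad_sq G - k\<^sup>2 * (?d * vol_sq G C + 2 * RV)"
    unfolding sum_facets[symmetric] unfolding FK_def RV_def by (rule rellich_identity[OF w])
  have reA: "Re (A_h \<Omega> \<T> k \<beta> \<delta> w \<xi> v (\<lambda>x. - grad v x)) = grad_sq G - k\<^sup>2 * RV
      + (\<Sum>K\<in>\<T>. \<Sum>e\<in>boundary_facets \<Omega> K. Re (\<i> * of_real k * BI K e)) + (\<Sum>e\<in>interior_facets \<T>. Re (facet_form \<T> \<beta> \<delta> w v e))"
  proof -
    have 1: "(\<Sum>K\<in>\<T>. of_real (measure lborel K) * cdot (G K) (G K)) = of_real (grad_sq G)"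
      by (simp add: grad_sq_def cdot_self mult.commute)
    have 2: "\<i> * of_real k * (\<Sum>K\<in>\<T>. \<Sum>e\<in>boundary_facets \<Omega> K. BI K e) = (\<Sum>K\<in>\<T>. \<Sum>e\<in>boundary_facets \<Omega> K. \<i> * of_real k * BI K e)"
      by (simp only: sum_distrib_left)
    have 3: "Re (of_real (k\<^sup>2) * z) = k\<^sup>2 * Re z" for z by simp
    show ?thesis
      unfolding A_h_reduced[OF w v] 1 BI_def[symmetric] 2 minus_complex.sel plus_complex.sel 3 RV_def Re_sum Re_complex_of_real ..
  qed
  have eq: "2 * Re (A_h \<Omega> \<T> k \<beta> \<delta> w \<xi> v (\<lambda>x. - grad v x)) + (?d - 1) * Re (A_h \<Omega> \<T> k \<beta> \<delta> w \<xi> w (\<lambda>x. - grad w x))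
    = grad_sq G + k\<^sup>2 * vol_sq G C + (\<Sum>K\<in>\<T>. \<Sum>e\<in>boundary_facets \<Omega> K. FK K e + 2 * Re (\<i> * of_real k * BI K e)) + (\<Sum>e\<in>interior_facets \<T>. X e)"
  proof -
    have X: "(\<Sum>e\<in>interior_facets \<T>. X e) = (\<Sum>e\<in>interior_facets \<T>. \<Sum>M | M \<in> \<T> \<and> e facet_of M. FK M e)
        + 2 * (\<Sum>e\<in>interior_facets \<T>. Re (facet_form \<T> \<beta> \<delta> w v e)) + (?d - 1) * (\<Sum>e\<in>interior_facets \<T>. Re (facet_form \<T> \<beta> \<delta> w w e))"
      unfolding X_def by (simp only: sum.distrib sum_distrib_left)
    have B: "(\<Sum>K\<in>\<T>. \<Sum>e\<in>boundary_facets \<Omega> K. FK K e + 2 * Re (\<i> * of_real k * BI K e))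
      = (\<Sum>K\<in>\<T>. \<Sum>e\<in>boundary_facets \<Omega> K. FK K e) + 2 * (\<Sum>K\<in>\<T>. \<Sum>e\<in>boundary_facets \<Omega> K. Re (\<i> * of_real k * BI K e))"
      by (simp only: sum.distrib sum_distrib_left)
    have alg: "2 * (P - q * r + b + f) + (d - 1) * (P - q * V + f') = P + q * V + (bb + 2 * b) + (S + 2 * f + (d - 1) * f')"
      if "S + bb = d * P - q * (d * V + 2 * r)" for P q r b f d V f' bb S :: real
    proof -
      have "S = d * P - q * (d * V + 2 * r) - bb" using that by simp
      then show ?thesis by (simp add: algebra_simps)
    qed
    show ?thesis unfolding X B reA Im_A_h_self(2)[OF w] by (rule alg[OF tot])
  qed
  have bd: "(\<Sum>K\<in>\<T>. \<Sum>e\<in>boundary_facets \<Omega> K. FK K e + 2 * Re (\<i> * of_real k * BI K e)) \<ge> c / 2 * bdry_grad_sq G - k\<^sup>2 * (R + 2 * R\<^sup>2 / c) * bdry_sq G C"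
  proof -
    have "c / 2 * bdry_grad_sq G - k\<^sup>2 * (R + 2 * R\<^sup>2 / c) * bdry_sq G C
      = (\<Sum>K\<in>\<T>. \<Sum>e\<in>boundary_facets \<Omega> K. c / 2 * ((norm (G K))\<^sup>2 * measure (facet_measure e) UNIV)
      - k\<^sup>2 * (R + 2 * R\<^sup>2 / c) * (LINT x|facet_measure e. (norm (dot_normal (G K) x + C K))\<^sup>2))"
      unfolding bdry_grad_sq_def bdry_sq_def by (simp only: sum_distrib_left sum_subtractf)
    also have "\<dots> \<le> (\<Sum>K\<in>\<T>. \<Sum>e\<in>boundary_facets \<Omega> K. FK K e + 2 * Re (\<i> * of_real k * BI K e))"
      unfolding FK_def BI_def by (intro sum_mono boundary_contribution[OF star _ _ R pos(1)])
    finally show ?thesis .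
  qed
  have S0: "0 \<le> SK K" for K
    unfolding SK_def set_lebesgue_integral_def by (intro add_nonneg_nonneg mult_nonneg_nonneg integral_nonneg_AE) auto
  have Ssum: "(\<Sum>e\<in>interior_facets \<T>. \<Sum>M | M \<in> \<T> \<and> e facet_of M. SK M) \<le> (?d + 1) * (grad_sq G + k\<^sup>2 * vol_sq G C)"
  proof -
    have "(\<Sum>e\<in>interior_facets \<T>. \<Sum>M | M \<in> \<T> \<and> e facet_of M. SK M) \<le> (\<Sum>K\<in>\<T>. \<Sum>e | e facet_of K. SK K)"
      unfolding sum_facets[of "\<lambda>K e. SK K"] using S0 by (simp add: sum_nonneg)
    also have "\<dots> = (\<Sum>K\<in>\<T>. (?d + 1) * SK K)"
      by (intro sum.cong refl) (simp add: card_facets)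
    also have "\<dots> = (?d + 1) * (grad_sq G + k\<^sup>2 * vol_sq G C)"
      unfolding sum_distrib_left[symmetric] SK_def grad_sq_def vol_sq_def by (simp add: sum.distrib sum_distrib_left)
    finally show ?thesis .
  qed
  have "- (\<Sum>e\<in>interior_facets \<T>. X e) \<le> (\<Sum>e\<in>interior_facets \<T>. 2 * \<epsilon> * (\<Sum>M | M \<in> \<T> \<and> e facet_of M. SK M)
      + facet_const CARD('a) \<kappa> R \<epsilon> * ?\<gamma> * Im (facet_form \<T> \<beta> \<delta> w w e))"
    unfolding sum_negf[symmetric]
  proof (rule sum_mono)
    fix e assume e: "e \<in> interior_facets \<T>"
    have "\<bar>X e\<bar> \<le> 2 * \<epsilon> * (\<Sum>M | M \<in> \<T> \<and> e facet_of M. SK M)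
      + facet_const CARD('a) \<kappa> R \<epsilon> * ?\<gamma> * Im (facet_form \<T> \<beta> \<delta> w w e)"
      unfolding X_def FK_def SK_def by (rule facet_contribution(1)[OF w v e R pos \<epsilon> gamma1_ge[OF e]])
    then show "- X e \<le> 2 * \<epsilon> * (\<Sum>M | M \<in> \<T> \<and> e facet_of M. SK M)
      + facet_const CARD('a) \<kappa> R \<epsilon> * ?\<gamma> * Im (facet_form \<T> \<beta> \<delta> w w e)" by linarith
  qed
  also have "\<dots> = 2 * \<epsilon> * (\<Sum>e\<in>interior_facets \<T>. \<Sum>M | M \<in> \<T> \<and> e facet_of M. SK M)
      + facet_const CARD('a) \<kappa> R \<epsilon> * ?\<gamma> * (\<Sum>e\<in>interior_facets \<T>. Im (facet_form \<T> \<beta> \<delta> w w e))"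
    by (simp only: sum.distrib sum_distrib_left)
  finally have XF: "- (\<Sum>e\<in>interior_facets \<T>. X e) \<le> 2 * \<epsilon> * (\<Sum>e\<in>interior_facets \<T>. \<Sum>M | M \<in> \<T> \<and> e facet_of M. SK M)
      + facet_const CARD('a) \<kappa> R \<epsilon> * ?\<gamma> * (\<Sum>e\<in>interior_facets \<T>. Im (facet_form \<T> \<beta> \<delta> w w e))" .
  have "2 * \<epsilon> * (\<Sum>e\<in>interior_facets \<T>. \<Sum>M | M \<in> \<T> \<and> e facet_of M. SK M) \<le> 2 * \<epsilon> * ((?d + 1) * (grad_sq G + k\<^sup>2 * vol_sq G C))"
    using Ssum \<epsilon> by (intro mult_left_mono) auto
  also have "\<dots> = (grad_sq G + k\<^sup>2 * vol_sq G C) / 2"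
    by (simp add: \<epsilon>_def field_simps)
  finally have SE: "2 * \<epsilon> * (\<Sum>e\<in>interior_facets \<T>. \<Sum>M | M \<in> \<T> \<and> e facet_of M. SK M) \<le> (grad_sq G + k\<^sup>2 * vol_sq G C) / 2" .
  have lin: "PV / 2 + a - b - cf \<le> PV + bd + x" if "se \<le> PV / 2" "a - b \<le> bd" "- x \<le> se + cf"
    for PV a b cf bd x se :: real using that by linarith
  show ?thesis unfolding eq by (rule lin[OF SE bd XF])
qed

text \<open>On each element \<open>|v| \<le> R |\<nabla>w|\<close>, also on the boundary, where \<open>c\<close> times the square of the gradient is part of the norm.\<close>

lemma multiplier_norm:
  assumes w: "pw_affine \<T> w G C" and v: "pw_affine \<T> v G (\<lambda>K. - dot_normal (G K) p)"
    and R: "\<And>M x. M \<in> \<T> \<Longrightarrow> x \<in> M \<Longrightarrow> norm (x - p) \<le> R" and c: "c > 0" and k: "k > 0"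
  shows "DG_norm \<Omega> c \<T> k v \<le> (1 + k) * (1 + R\<^sup>2 + R\<^sup>2 / c) * DG_norm \<Omega> c \<T> k w"
proof -
  let ?C = "\<lambda>K. - dot_normal (G K) p"
  have pt: "(norm (dot_normal (G K) x + - dot_normal (G K) p))\<^sup>2 \<le> R\<^sup>2 * (norm (G K))\<^sup>2" if K: "K \<in> \<T>" "x \<in> K" for K x
  proof -
    have "dot_normal (G K) x + - dot_normal (G K) p = dot_normal (G K) (x - p)" by (simp add: dot_normal_right_simps)
    then have "norm (dot_normal (G K) x + - dot_normal (G K) p) \<le> norm (G K) * norm (x - p)"
      using norm_dot_normal_le by metis
    also have "\<dots> \<le> norm (G K) * R" using R[OF K] by (intro mult_left_mono) auto
    finally have "(norm (dot_normal (G K) x + - dot_normal (G K) p))\<^sup>2 \<le> (norm (G K) * R)\<^sup>2" by (intro power_mono) auto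
    then show ?thesis by (simp add: power_mult_distrib mult.commute)
  qed
  have vq: "vol_sq G ?C \<le> R\<^sup>2 * grad_sq G"
    unfolding vol_sq_def grad_sq_def sum_distrib_left
  proof (rule sum_mono)
    fix K assume K: "K \<in> \<T>"
    have "(LINT x:K|lborel. (norm (dot_normal (G K) x + - dot_normal (G K) p))\<^sup>2) \<le> (LINT x:K|lborel. R\<^sup>2 * (norm (G K))\<^sup>2)"
      by (intro set_integral_mono set_integrable_lborel_continuous compact_K[OF K] continuous_intros pt[OF K])
    also have "\<dots> = R\<^sup>2 * ((norm (G K))\<^sup>2 * measure lborel K)"
      by (simp add: set_lebesgue_integral_def borel_compact compact_K[OF K] emeasure_compact_finite)
    finally show "(LINT x:K|lborel. (norm (dot_normal (G K) x + - dot_normal (G K) p))\<^sup>2) \<le> R\<^sup>2 * ((norm (G K))\<^sup>2 * measure lborel K)" .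
  qed
  have bq: "bdry_sq G ?C \<le> R\<^sup>2 * bdry_grad_sq G"
    unfolding bdry_sq_def bdry_grad_sq_def sum_distrib_left
  proof (intro sum_mono)
    fix K e assume K: "K \<in> \<T>" and "e \<in> boundary_facets \<Omega> K"
    then have e: "e facet_of K" by (simp add: boundary_facets_def)
    interpret flat_facet e "facet_normal K e" "level K e" by (rule flat[OF K e])
    have "(LINT x|facet_measure e. (norm (dot_normal (G K) x + - dot_normal (G K) p))\<^sup>2) \<le> norm (LINT x|facet_measure e. (norm (dot_normal (G K) x + - dot_normal (G K) p))\<^sup>2)"
      by (simp only: real_norm_def abs_ge_self)
    also have "\<dots> \<le> (LINT x|facet_measure e. R\<^sup>2 * (norm (G K))\<^sup>2)"
    proof (rule norm_integral_le)
      fix x assume "x \<in> e"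
      then have "x \<in> K" using facet_subset[OF e] by blast
      then show "norm ((norm (dot_normal (G K) x + - dot_normal (G K) p))\<^sup>2) \<le> R\<^sup>2 * (norm (G K))\<^sup>2"
        using pt[OF K, of x] by (simp only: real_norm_def abs_power2)
    qed (intro continuous_intros)+
    finally show "(LINT x|facet_measure e. (norm (dot_normal (G K) x + - dot_normal (G K) p))\<^sup>2) \<le> R\<^sup>2 * ((norm (G K))\<^sup>2 * measure (facet_measure e) UNIV)"
      by (simp add: space_facet_measure mult_ac)
  qed
  let ?N = "1 + R\<^sup>2 + R\<^sup>2 / c"
  have N: "1 \<le> ?N" "R\<^sup>2 \<le> ?N" "R\<^sup>2 / c \<le> ?N" "0 \<le> R\<^sup>2 / c" using c by (auto simp: add_nonneg_nonneg)
  have kk: "k\<^sup>2 \<le> (1 + k)\<^sup>2 - 1" using k by (simp add: power2_sum)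
  have NN: "?N \<le> ?N\<^sup>2" using N(1) by (simp add: self_le_power)
  have cf: "k\<^sup>2 * a + 1 \<le> (1 + k)\<^sup>2 * ?N\<^sup>2" if "0 \<le> a" "a \<le> R\<^sup>2 + R\<^sup>2 / c" for a
  proof -
    have "k\<^sup>2 * a + 1 \<le> (1 + k)\<^sup>2 * a + (1 + k)\<^sup>2 * 1"
      using that kk k by (intro add_mono mult_right_mono) (auto simp: power2_sum)
    also have "\<dots> = (1 + k)\<^sup>2 * (1 + a)" by (simp add: algebra_simps)
    also have "\<dots> \<le> (1 + k)\<^sup>2 * ?N\<^sup>2" using that NN by (intro mult_left_mono) auto
    finally show ?thesis .
  qed
  note nn = sq_nonneg
  have "(DG_norm \<Omega> c \<T> k v)\<^sup>2 = k\<^sup>2 * vol_sq G ?C + k\<^sup>2 * bdry_sq G ?C + c * bdry_grad_sq G + grad_sq G"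
    by (rule DG_norm_sq(1)[OF v]) (use c in simp)
  also have "\<dots> \<le> k\<^sup>2 * (R\<^sup>2 * grad_sq G) + k\<^sup>2 * (R\<^sup>2 * bdry_grad_sq G) + c * bdry_grad_sq G + grad_sq G"
    using vq bq c by (intro add_mono mult_left_mono) auto
  also have "\<dots> = (k\<^sup>2 * R\<^sup>2 + 1) * grad_sq G + (k\<^sup>2 * (R\<^sup>2 / c) + 1) * (c * bdry_grad_sq G)"
    using c by (simp add: field_simps)
  also have "\<dots> \<le> (1 + k)\<^sup>2 * ?N\<^sup>2 * grad_sq G + (1 + k)\<^sup>2 * ?N\<^sup>2 * (c * bdry_grad_sq G)"
    using cf[of "R\<^sup>2"] cf[of "R\<^sup>2 / c"] N nn c by (intro add_mono mult_right_mono) auto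
  also have "\<dots> \<le> (1 + k)\<^sup>2 * ?N\<^sup>2 * (k\<^sup>2 * vol_sq G C + k\<^sup>2 * bdry_sq G C + c * bdry_grad_sq G + grad_sq G)"
    unfolding distrib_left[symmetric] using nn by (intro mult_left_mono) auto
  also have "\<dots> = ((1 + k) * ?N * DG_norm \<Omega> c \<T> k w)\<^sup>2"
    unfolding power_mult_distrib DG_norm_sq(1)[OF w less_imp_le[OF c]] ..
  finally show ?thesis
    by (rule power2_le_imp_le) (use DG_norm_sq(2)[OF w less_imp_le[OF c]] N k in \<open>intro mult_nonneg_nonneg; simp\<close>)
qed

end

text \<open>The summands stem, in this order, from the norm of the multiplier, the test with \<open>w\<close> itself, the boundary values and the
  penalties.\<close>

definition stability_const :: "nat \<Rightarrow> real \<Rightarrow> real \<Rightarrow> real \<Rightarrow> real" where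
  "stability_const d \<kappa> R c = 4 * (1 + R\<^sup>2 + R\<^sup>2 / c) + 2 * (real d - 1) + (1 + 2 * R + 4 * R\<^sup>2 / c)
     + 2 * facet_const d \<kappa> R (1 / (4 * (real d + 1)))"

context shape_mesh begin

lemma facet_const_nonneg: "0 \<le> R \<Longrightarrow> 0 < \<epsilon> \<Longrightarrow> 0 \<le> facet_const CARD('a) \<kappa> R \<epsilon>"
  unfolding facet_const_def using consts_pos
  by (intro add_nonneg_nonneg mult_nonneg_nonneg divide_nonneg_nonneg) (auto simp: norm_const_def)

lemma stability_const_pos: "0 \<le> R \<Longrightarrow> 0 < c \<Longrightarrow> 0 < stability_const CARD('a) \<kappa> R c"
proof -
  assume R: "0 \<le> R" and c: "0 < c"
  have "0 \<le> facet_const CARD('a) \<kappa> R (1 / (4 * (real CARD('a) + 1)))"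
    using R by (intro facet_const_nonneg) (auto simp: add_pos_pos)
  moreover have "0 \<le> R\<^sup>2" "0 \<le> R\<^sup>2 / c" "0 \<le> 4 * R\<^sup>2 / c" using c by auto
  moreover have "0 \<le> real CARD('a) - 1" using dim by auto
  moreover have "0 < 4 * (1 + x + y) + 2 * z + (1 + 2 * R + u) + 2 * t"
    if "0 \<le> t" "0 \<le> x" "0 \<le> y" "0 \<le> u" "0 \<le> z" for x y z t u :: real using that R by (smt (verit))
  ultimately show ?thesis unfolding stability_const_def by blast
qed

text \<open>If both parts of \<open>a(w, v)\<close> are at most \<open>s \<parallel>v\<parallel>\<close>, the imaginary part for \<open>v = w\<close> bounds the boundary values and
  penalties by \<open>s \<parallel>w\<parallel>\<close>, and \<open>rellich_lower_bound\<close> bounds \<open>\<parallel>w\<parallel>\<^sup>2\<close> by these and by \<open>s\<close> times the norms of the test functions.\<close>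

lemma DG_norm_le:
  assumes star: "strictly_star_shaped \<Omega> p c"
    and R: "\<And>M x. M \<in> \<T> \<Longrightarrow> x \<in> M \<Longrightarrow> norm (x - p) \<le> R" "0 \<le> R"
    and pos: "k > 0" "\<beta> > 0" "\<delta> > 0" and w: "w \<in> V_h \<T>" and s: "0 \<le> s"
    and re: "\<And>v. v \<in> V_h \<T> \<Longrightarrow> Re (A_h \<Omega> \<T> k \<beta> \<delta> w \<xi> v (\<lambda>x. - grad v x)) \<le> s * DG_norm \<Omega> c \<T> k v"
    and im: "\<And>v. v \<in> V_h \<T> \<Longrightarrow> Im (A_h \<Omega> \<T> k \<beta> \<delta> w \<xi> v (\<lambda>x. - grad v x)) \<le> s * DG_norm \<Omega> c \<T> k v"
  shows "DG_norm \<Omega> c \<T> k w \<le> stability_const CARD('a) \<kappa> R c * \<gamma>\<^sub>1 \<T> k \<beta> \<delta> * s"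
proof -
  let ?d = "real CARD('a)" and ?\<gamma> = "\<gamma>\<^sub>1 \<T> k \<beta> \<delta>"
  obtain G C where wp: "pw_affine \<T> w G C" using w by (auto simp: V_h_iff_pw_affine)
  define v where "v x = (\<Sum>K\<in>\<T>. if x \<in> interior K then dot_normal (G K) (x - p) else 0)" for x
  have vp: "pw_affine \<T> v G (\<lambda>K. - dot_normal (G K) p)"
    unfolding pw_affine_def
  proof (intro ballI)
    fix K x assume K: "K \<in> \<T>" and x: "x \<in> interior K"
    have "v x = (\<Sum>L\<in>\<T>. if L = K then dot_normal (G K) (x - p) else 0)"
      unfolding v_def using disjoint_interiors[OF K] x by (intro sum.cong) auto
    also have "\<dots> = dot_normal (G K) (x - p)" using K fin by simp
    finally show "v x = dot_normal (G K) x + - dot_normal (G K) p" by (simp add: dot_normal_right_simps)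
  qed
  have vV: "v \<in> V_h \<T>" using vp by (auto simp: V_h_iff_pw_affine)
  have c: "c > 0" using star by (simp add: strictly_star_shaped_def)
  define M where "M = DG_norm \<Omega> c \<T> k w"
  define F where "F = (\<Sum>e\<in>interior_facets \<T>. Im (facet_form \<T> \<beta> \<delta> w w e))"
  define C3 where "C3 = facet_const CARD('a) \<kappa> R (1 / (4 * (?d + 1)))"
  define N where "N = 1 + R\<^sup>2 + R\<^sup>2 / c"
  define B where "B = R + 2 * R\<^sup>2 / c"
  have C30: "0 \<le> C3" unfolding C3_def using R(2) by (intro facet_const_nonneg) (auto simp: add_pos_pos)
  have B0: "0 \<le> B" and N0: "0 \<le> N" using R(2) c by (auto simp: B_def N_def)
  have M0: "0 \<le> M" unfolding M_def by (rule DG_norm_sq(2)[OF wp less_imp_le[OF c]])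
  have M2: "M\<^sup>2 = k\<^sup>2 * vol_sq G C + k\<^sup>2 * bdry_sq G C + c * bdry_grad_sq G + grad_sq G"
    unfolding M_def by (rule DG_norm_sq(1)[OF wp less_imp_le[OF c]])
  have F0: "0 \<le> F" unfolding F_def
    by (intro sum_nonneg facet_contribution(2)[OF wp vp _ R(1) pos zero_less_one gamma1_ge])
  have imw: "k * bdry_sq G C + F \<le> s * M"
    using im[OF w] unfolding Im_A_h_self(1)[OF wp] F_def M_def .
  have kb0: "0 \<le> k * bdry_sq G C" using pos sq_nonneg by simp
  have F: "F \<le> s * M" and kb: "k * bdry_sq G C \<le> s * M" using imw F0 kb0 by linarith+
  have sM: "0 \<le> s * M" using s M0 by simp
  have \<gamma>1: "1 + k \<le> ?\<gamma>" by (rule gamma1_ge_base[OF pos(2,3)])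
  have d1: "0 \<le> ?d - 1" using dim by auto
  have low: "(grad_sq G + k\<^sup>2 * vol_sq G C) / 2 + c / 2 * bdry_grad_sq G - k\<^sup>2 * B * bdry_sq G C - C3 * ?\<gamma> * F
    \<le> 2 * (s * DG_norm \<Omega> c \<T> k v) + (?d - 1) * (s * M)"
  proof -
    have "(?d - 1) * Re (A_h \<Omega> \<T> k \<beta> \<delta> w \<xi> w (\<lambda>x. - grad w x)) \<le> (?d - 1) * (s * M)"
      unfolding M_def using re[OF w] d1 by (rule mult_left_mono)
    moreover have "(grad_sq G + k\<^sup>2 * vol_sq G C) / 2 + c / 2 * bdry_grad_sq G - k\<^sup>2 * B * bdry_sq G C - C3 * ?\<gamma> * F
      \<le> 2 * Re (A_h \<Omega> \<T> k \<beta> \<delta> w \<xi> v (\<lambda>x. - grad v x)) + (?d - 1) * Re (A_h \<Omega> \<T> k \<beta> \<delta> w \<xi> w (\<lambda>x. - grad w x))"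
      unfolding B_def C3_def F_def by (rule rellich_lower_bound[OF wp vp star _ pos]) (rule R(1))
    ultimately show ?thesis using re[OF vV] by linarith
  qed
  have DGv: "s * DG_norm \<Omega> c \<T> k v \<le> ?\<gamma> * N * (s * M)"
  proof -
    have "DG_norm \<Omega> c \<T> k v \<le> (1 + k) * N * M"
      unfolding N_def M_def by (rule multiplier_norm[OF wp vp R(1) c pos(1)])
    also have "\<dots> \<le> ?\<gamma> * N * M" using \<gamma>1 N0 M0 by (intro mult_right_mono) auto
    finally have "s * DG_norm \<Omega> c \<T> k v \<le> s * (?\<gamma> * N * M)" using s by (rule mult_left_mono)
    then show ?thesis by (simp add: mult_ac)
  qed
  have bd: "k\<^sup>2 * bdry_sq G C \<le> ?\<gamma> * (s * M)"
  proof -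
    have "k * (k * bdry_sq G C) \<le> ?\<gamma> * (s * M)" using kb kb0 \<gamma>1 pos by (intro mult_mono[of k ?\<gamma> "k * bdry_sq G C" "s * M"]) auto
    then show ?thesis by (simp add: power2_eq_square mult.assoc)
  qed
  have "M\<^sup>2 \<le> 4 * (s * DG_norm \<Omega> c \<T> k v) + 2 * ((?d - 1) * (s * M)) + (1 + 2 * B) * (k\<^sup>2 * bdry_sq G C) + 2 * (C3 * ?\<gamma> * F)"
  proof -
    have "(1 + 2 * B) * (k\<^sup>2 * bdry_sq G C) = k\<^sup>2 * bdry_sq G C + 2 * (k\<^sup>2 * B * bdry_sq G C)" by (simp add: algebra_simps)
    moreover have "c / 2 * bdry_grad_sq G = c * bdry_grad_sq G / 2" by simp
    moreover have "V + b + g + P \<le> 4 * sd + 2 * ds + BB + 2 * cf"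
      if "BB = b + 2 * bb" "h = g / 2" "(P + V) / 2 + h - bb - cf \<le> 2 * sd + ds" for P V g h b bb BB cf sd ds :: real
      using that unfolding add_divide_distrib by linarith
    ultimately show ?thesis using low unfolding M2 by blast
  qed
  also have "\<dots> \<le> 4 * (?\<gamma> * N * (s * M)) + 2 * ((?d - 1) * (?\<gamma> * (s * M))) + (1 + 2 * B) * (?\<gamma> * (s * M)) + 2 * (C3 * ?\<gamma> * (s * M))"
  proof -
    have "1 * (s * M) \<le> ?\<gamma> * (s * M)" using \<gamma>1 pos sM by (intro mult_right_mono) auto
    then have "(?d - 1) * (s * M) \<le> (?d - 1) * (?\<gamma> * (s * M))" using d1 by (intro mult_left_mono) auto
    moreover have "(1 + 2 * B) * (k\<^sup>2 * bdry_sq G C) \<le> (1 + 2 * B) * (?\<gamma> * (s * M))" using bd B0 by (intro mult_left_mono) auto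
    moreover have "C3 * ?\<gamma> * F \<le> C3 * ?\<gamma> * (s * M)" using F C30 \<gamma>1 pos by (intro mult_left_mono) auto
    ultimately show ?thesis using DGv by linarith
  qed
  also have "\<dots> = (4 * N + 2 * (?d - 1) + (1 + 2 * B) + 2 * C3) * ?\<gamma> * s * M" by (simp add: algebra_simps)
  also have "4 * N + 2 * (?d - 1) + (1 + 2 * B) + 2 * C3 = stability_const CARD('a) \<kappa> R c"
    unfolding stability_const_def N_def B_def C3_def by simp
  finally have fin: "M * M \<le> stability_const CARD('a) \<kappa> R c * ?\<gamma> * s * M" by (simp add: power2_eq_square)
  show ?thesis
  proof (cases "M = 0")
    case True
    have "0 \<le> stability_const CARD('a) \<kappa> R c * ?\<gamma> * s"
      using stability_const_pos[OF R(2) c] \<gamma>1 pos s by simp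
    then show ?thesis using True by (simp add: M_def)
  next
    case False
    then have "M \<le> stability_const CARD('a) \<kappa> R c * ?\<gamma> * s" using fin M0 by simp
    then show ?thesis by (simp add: M_def)
  qed
qed

end

section \<open>Inf-sup stability\<close>

theorem proposition3p1:
  fixes \<Omega> :: "(real^'d) set" and x\<^sub>\<Omega> :: "real^'d" and c\<^sub>\<Omega> :: real
    and \<TT> :: "(real^'d) set set set"
  assumes "CARD('d) = 2 \<or> CARD('d) = 3"
    and "open \<Omega>" and "connected \<Omega>" and "bounded \<Omega>"
    and "strictly_star_shaped \<Omega> x\<^sub>\<Omega> c\<^sub>\<Omega>"
    and "\<forall>\<T>\<in>\<TT>. partition_of \<Omega> \<T>"
    and "minimal_angle_condition \<TT>"
  shows "\<exists>c\<^sub>1::real. c\<^sub>1 > 0 \<and>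
    (\<forall>\<T>\<in>\<TT>. \<forall>k \<beta> \<delta> :: real. k > 0 \<longrightarrow> \<beta> > 0 \<longrightarrow> \<delta> > 0 \<longrightarrow>
      (\<forall>w\<in>V_h \<T>. \<forall>\<xi>\<in>\<Sigma>_h \<T>.
        (SUP (v, \<tau>)\<in>test_pairs \<Omega> \<T>. ereal (Re (A_h \<Omega> \<T> k \<beta> \<delta> w \<xi> v \<tau>) / DG_norm \<Omega> c\<^sub>\<Omega> \<T> k v))
        + (SUP (v, \<tau>)\<in>test_pairs \<Omega> \<T>. ereal (Im (A_h \<Omega> \<T> k \<beta> \<delta> w \<xi> v \<tau>) / DG_norm \<Omega> c\<^sub>\<Omega> \<T> k v))
        \<ge> ereal (c\<^sub>1 / \<gamma>\<^sub>1 \<T> k \<beta> \<delta> * DG_norm \<Omega> c\<^sub>\<Omega> \<T> k w)))"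
proof -
  note dim = assms(1) and star = assms(5)
  obtain \<kappa> where \<kappa>: "0 \<le> \<kappa>" "\<kappa> < 1" "\<And>\<T> K. \<T> \<in> \<TT> \<Longrightarrow> K \<in> \<T> \<Longrightarrow> angle_simplex K (verts K) \<kappa>"
    using minimal_angle_condition_simplices[OF dim assms(6,7)] by blast
  have c: "c\<^sub>\<Omega> > 0" and x0: "x\<^sub>\<Omega> \<in> \<Omega>" using star by (auto simp: strictly_star_shaped_def)
  have "bounded (closure \<Omega>)" using assms(4) by (rule bounded_closure)
  then obtain R where R: "\<And>x. x \<in> closure \<Omega> \<Longrightarrow> dist x\<^sub>\<Omega> x \<le> R" unfolding bounded_any_center[of _ x\<^sub>\<Omega>] by blast
  have R0: "0 \<le> R" using R[of x\<^sub>\<Omega>] x0 closure_subset[of \<Omega>] by force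
  let ?S = "stability_const CARD('d) \<kappa> R c\<^sub>\<Omega>"
  \<comment> \<open>The constant \<open>?S\<close> is positive as soon as there is a mesh; without one any \<open>c1\<close> will do.\<close>
  define c1 where "c1 = (if ?S > 0 then 1 / ?S else 1)"
  have "c1 > 0" by (simp add: c1_def)
  moreover have "ereal (c1 / \<gamma>\<^sub>1 \<T> k \<beta> \<delta> * DG_norm \<Omega> c\<^sub>\<Omega> \<T> k w)
     \<le> (SUP (v, \<tau>)\<in>test_pairs \<Omega> \<T>. ereal (Re (A_h \<Omega> \<T> k \<beta> \<delta> w \<xi> v \<tau>) / DG_norm \<Omega> c\<^sub>\<Omega> \<T> k v))
       + (SUP (v, \<tau>)\<in>test_pairs \<Omega> \<T>. ereal (Im (A_h \<Omega> \<T> k \<beta> \<delta> w \<xi> v \<tau>) / DG_norm \<Omega> c\<^sub>\<Omega> \<T> k v))"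
    if T: "\<T> \<in> \<TT>" and pos: "k > 0" "\<beta> > 0" "\<delta> > 0" and w: "w \<in> V_h \<T>" for \<T> k \<beta> \<delta> w \<xi>
  proof -
    interpret shape_mesh \<Omega> \<T> \<kappa>
      using assms(2,6) T dim \<kappa> by (intro shape_mesh.intro mesh.intro shape_mesh_axioms.intro) auto
    let ?DG = "DG_norm \<Omega> c\<^sub>\<Omega> \<T> k"
    let ?A = "\<lambda>v. A_h \<Omega> \<T> k \<beta> \<delta> w \<xi> v (\<lambda>x. - grad v x)"
    let ?P = "test_pairs \<Omega> \<T>"
    define SR where "SR = (SUP (v, \<tau>)\<in>?P. ereal (Re (A_h \<Omega> \<T> k \<beta> \<delta> w \<xi> v \<tau>) / ?DG v))"
    define SI where "SI = (SUP (v, \<tau>)\<in>?P. ereal (Im (A_h \<Omega> \<T> k \<beta> \<delta> w \<xi> v \<tau>) / ?DG v))"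
    obtain Gw Cw where wp: "pw_affine \<T> w Gw Cw" using w by (auto simp: V_h_iff_pw_affine)
    have dg0: "0 \<le> ?DG v" if "v \<in> V_h \<T>" for v
      using that DG_norm_sq(2)[OF _ less_imp_le[OF c]] by (auto simp: V_h_iff_pw_affine)
    have DG_zero: "pw_affine \<T> v (\<lambda>_. 0) (\<lambda>_. 0)" if v: "v \<in> V_h \<T>" and z: "?DG v = 0" for v
    proof -
      obtain G C where vp: "pw_affine \<T> v G C" using v by (auto simp: V_h_iff_pw_affine)
      have "0 = k\<^sup>2 * vol_sq G C + k\<^sup>2 * bdry_sq G C + c\<^sub>\<Omega> * bdry_grad_sq G + grad_sq G"
        using DG_norm_sq(1)[OF vp less_imp_le[OF c], of k] z by simp
      moreover have "0 \<le> k\<^sup>2 * vol_sq G C" "0 \<le> k\<^sup>2 * bdry_sq G C" "0 \<le> c\<^sub>\<Omega> * bdry_grad_sq G" "0 \<le> grad_sq G"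
        using sq_nonneg c by auto
      ultimately have "k\<^sup>2 * vol_sq G C = 0" by linarith
      then have "vol_sq G C = 0" using pos by simp
      then have "L2_norm \<Omega> v = 0" using L2_norm_sq[OF vp] by simp
      then show ?thesis by (rule pw_affine_zero_of_L2_norm_zero[OF vp])
    qed
    have test: "(v, \<lambda>x. - grad v x) \<in> ?P" if v: "v \<in> V_h \<T>" and p: "?DG v \<noteq> 0" for v
    proof -
      obtain G C where vp: "pw_affine \<T> v G C" using v by (auto simp: V_h_iff_pw_affine)
      have "\<not> (AE x\<in>\<Omega> in lebesgue. v x = 0)"
      proof
        assume "AE x\<in>\<Omega> in lebesgue. v x = 0"
        then have "AE x in lebesgue. indicator \<Omega> x *\<^sub>R (norm (v x))\<^sup>2 = 0"
          by (rule AE_mp) (auto simp: indicator_def intro!: AE_I2)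
        then have "(LINT x:\<Omega>|lebesgue. (norm (v x))\<^sup>2) = 0"
          unfolding set_lebesgue_integral_def by (rule integral_eq_zero_AE)
        then have "L2_norm \<Omega> v = 0" by (simp add: L2_norm_def)
        then have "pw_affine \<T> v (\<lambda>_. 0) (\<lambda>_. 0)" by (rule pw_affine_zero_of_L2_norm_zero[OF vp])
        then have "(?DG v)\<^sup>2 = 0"
          using DG_norm_sq(1)[OF _ less_imp_le[OF c], of v "\<lambda>_. 0" "\<lambda>_. 0" k]
          by (simp add: vol_sq_def bdry_sq_def bdry_grad_sq_def grad_sq_def dot_normal_def set_lebesgue_integral_def)
        then show False using p by simp
      qed
      then show ?thesis
        using v pw_const_in_Sigma_h[OF pw_const_uminus[OF pw_const_grad[OF vp]]] by (simp add: test_pairs_def)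
    qed
    have leR: "ereal (Re (?A v) / ?DG v) \<le> SR" and leI: "ereal (Im (?A v) / ?DG v) \<le> SI"
      if "v \<in> V_h \<T>" "?DG v \<noteq> 0" for v
      unfolding SR_def SI_def by (rule SUP_upper2[OF test[OF that]], simp)+
    \<comment> \<open>The constants \<open>1\<close> and \<open>-1\<close> have no jumps and no gradient, so the form changes sign between them.\<close>
    have "SR \<ge> 0 \<and> SI \<ge> 0"
    proof -
      have one: "pw_affine \<T> (\<lambda>_. z) (\<lambda>_. 0) (\<lambda>_. z)" for z :: complex by (simp add: pw_affine_def dot_normal_def)
      have V1: "(\<lambda>_. z) \<in> V_h \<T>" for z :: complex using one[of z] by (auto simp: V_h_iff_pw_affine)
      have ne: "?DG (\<lambda>_. z) \<noteq> 0" if z: "z \<noteq> 0" for z :: complex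
      proof
        assume d: "?DG (\<lambda>_. z) = 0"
        have "\<T> \<noteq> {}" using x0 \<Omega>_eq by auto
        then obtain K where K: "K \<in> \<T>" by blast
        obtain x where x: "x \<in> interior K" using full_simplex.interior_K[OF full[OF K]] by blast
        have "pw_affine \<T> (\<lambda>_. z) (\<lambda>_. 0) (\<lambda>_. 0)" by (rule DG_zero[OF V1 d])
        then show False using K x z by (auto simp: pw_affine_def dot_normal_def)
      qed
      define X where "X = - of_real (k\<^sup>2) * (\<Sum>K\<in>\<T>. LINT x:K|lborel. dot_normal (Gw K) x + Cw K)
        + \<i> * of_real k * (\<Sum>K\<in>\<T>. \<Sum>e\<in>boundary_facets \<Omega> K. LINT x|facet_measure e. dot_normal (Gw K) x + Cw K)"
      have AX: "?A (\<lambda>_. z) = X * cnj z" for z :: complex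
      proof -
        have z0: "dot_normal 0 x = 0" for x :: "real^'d" by (simp add: dot_normal_def)
        have "facet_form \<T> \<beta> \<delta> w (\<lambda>_. z) e = 0" if e: "e \<in> interior_facets \<T>" for e
        proof -
          obtain K L where "interior_facet \<Omega> \<T> e K L" by (rule interior_facetE[OF e])
          then show ?thesis using interior_facet.facet_form_eq[OF _ wp one[of z]] by (simp add: z0)
        qed
        then have ff: "(\<Sum>e\<in>interior_facets \<T>. facet_form \<T> \<beta> \<delta> w (\<lambda>_. z) e) = 0" by (intro sum.neutral) simp
        have c0: "cdot u 0 = 0" for u :: "complex^'d" by (simp add: cdot_def)
        have c1: "(LINT x:K|lborel. f x * cnj z) = (LINT x:K|lborel. f x) * cnj z" for K and f :: "real^'d \<Rightarrow> complex"
          unfolding set_lebesgue_integral_def mult_scaleR_left[symmetric] by (rule integral_mult_left_zero)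
        show ?thesis
          unfolding A_h_reduced[OF wp one[of z]] X_def ff c0 z0 add_0_left c1 integral_mult_left_zero sum_distrib_right[symmetric]
          by (simp only: mult_zero_right sum.neutral_const) (simp add: algebra_simps)
      qed
      have "0 \<le> SR"
      proof (cases "0 \<le> Re X")
        case True
        then have "0 \<le> ereal (Re (?A (\<lambda>_. 1)) / ?DG (\<lambda>_. 1))" using dg0[OF V1[of 1]] by (simp add: AX)
        then show ?thesis using leR[OF V1 ne[of 1]] by (rule order_trans) simp
      next
        case False
        then have "0 \<le> ereal (Re (?A (\<lambda>_. -1)) / ?DG (\<lambda>_. -1))" using dg0[OF V1[of "-1"]] by (simp add: AX divide_nonpos_nonneg)
        then show ?thesis using leR[OF V1 ne[of "-1"]] by (rule order_trans) simp
      qed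
      moreover have "0 \<le> SI"
      proof (cases "0 \<le> Im X")
        case True
        then have "0 \<le> ereal (Im (?A (\<lambda>_. 1)) / ?DG (\<lambda>_. 1))" using dg0[OF V1[of 1]] by (simp add: AX)
        then show ?thesis using leI[OF V1 ne[of 1]] by (rule order_trans) simp
      next
        case False
        then have "0 \<le> ereal (Im (?A (\<lambda>_. -1)) / ?DG (\<lambda>_. -1))" using dg0[OF V1[of "-1"]] by (simp add: AX divide_nonpos_nonneg)
        then show ?thesis using leI[OF V1 ne[of "-1"]] by (rule order_trans) simp
      qed
      ultimately show ?thesis ..
    qed
    then have S0: "0 \<le> SR" "0 \<le> SI" by auto
    have "ereal (c1 / \<gamma>\<^sub>1 \<T> k \<beta> \<delta> * ?DG w) \<le> SR + SI"
    proof (cases "SR = \<infinity> \<or> SI = \<infinity>")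
      case True
      then show ?thesis using S0 by auto
    next
      case False
      then obtain a b where ab: "SR = ereal a" "SI = ereal b" "0 \<le> a" "0 \<le> b"
        using S0 by (cases SR; cases SI) auto
      have mul: "t \<le> (a + b) * ?DG v" if "v \<in> V_h \<T>" "t / ?DG v \<le> a \<or> t / ?DG v \<le> b" "?DG v \<noteq> 0" for t v
      proof -
        have "?DG v > 0" using dg0[OF that(1)] that(3) by simp
        moreover have "t / ?DG v \<le> a + b" using that(2) ab by linarith
        ultimately show ?thesis by (simp add: divide_le_eq)
      qed
      have "?DG w \<le> ?S * \<gamma>\<^sub>1 \<T> k \<beta> \<delta> * (a + b)"
      proof (rule DG_norm_le[OF star _ R0 pos w])
        show "norm (x - x\<^sub>\<Omega>) \<le> R" if "M \<in> \<T>" "x \<in> M" for M x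
          using R[of x] K_closure[OF that(1)] that(2) by (auto simp: dist_norm norm_minus_commute)
        show "0 \<le> a + b" using ab by simp
        fix v assume v: "v \<in> V_h \<T>"
        show "Re (?A v) \<le> (a + b) * ?DG v"
        proof (cases "?DG v = 0")
          case True
          then show ?thesis using A_h_zero[OF wp DG_zero[OF v True]] by simp
        next
          case False
          then show ?thesis using leR[OF v False] ab by (intro mul[OF v]) auto
        qed
        show "Im (?A v) \<le> (a + b) * ?DG v"
        proof (cases "?DG v = 0")
          case True
          then show ?thesis using A_h_zero[OF wp DG_zero[OF v True]] by simp
        next
          case False
          then show ?thesis using leI[OF v False] ab by (intro mul[OF v]) auto
        qed
      qed
      moreover have "?S > 0" by (rule stability_const_pos[OF R0 c])
      moreover have "\<gamma>\<^sub>1 \<T> k \<beta> \<delta> > 0" using gamma1_ge_base[OF pos(2,3), of k] pos(1) by linarith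
      ultimately have "c1 / \<gamma>\<^sub>1 \<T> k \<beta> \<delta> * ?DG w \<le> a + b"
        by (simp add: c1_def field_simps)
      then show ?thesis by (simp add: ab)
    qed
    then show ?thesis unfolding SR_def SI_def .
  qed
  ultimately show ?thesis by blast
qed

end
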